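(* Let $\mathcal{C}$ be a model category with normal functorial factorizations (see context) and class of weak equivalences $\mathcal{W}$, with cofibrant and fibrant replacement functors $Q,R:\mathcal{C}\to\mathcal{C}$. Let $j:\mathcal{C}_{fc}\to\mathcal{C}$ be the full inclusion of the fibrant-cofibrant objects, $r:\mathcal{C}\to\mathcal{C}_{fc}$ the corestriction of $RQ$ (so $j\,r=RQ$), $i:\mathcal{C}\to\mathcal{H}o(\mathcal{C})$ and $i':\mathcal{C}_{fc}\to\mathcal{H}o(\mathcal{C}_{fc})$ the inclusions into the homotopy 2-categories of $(\mathcal{C},\mathcal{W})$ and $(\mathcal{C}_{fc},\mathcal{W}\cap\mathcal{C}_{fc})$, and $q=i'\,r:\mathcal{C}\to\mathcal{H}o(\mathcal{C}_{fc})$. Then there are a unique 2-functor $\overline{r}:\mathcal{H}o(\mathcal{C})\to\mathcal{H}o(\mathcal{C}_{fc})$ such that $\overline{r}\,i=q$ and a unique 2-functor $\overline{j}:\mathcal{H}o(\mathcal{C}_{fc})\to\mathcal{H}o(\mathcal{C})$ such that $\overline{j}\,i'=i\,j$; and the 2-functor $\overline{RQ}:=\overline{j}\,\overline{r}:\mathcal{H}o(\mathcal{C})\to\mathcal{H}o(\mathcal{C})$ satisfies $\overline{RQ}\,i=i\,RQ$.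
   Context: Model category means Quillen's closed model category (finite limits and colimits; three classes closed under retracts and composition; lifting; factorization; 3-for-2). Standing assumption (normal functorial factorizations). Both factorizations, (cofibration, trivial fibration) and (trivial cofibration, fibration), are functorial: each $f$ has a chosen factorization $f=\rho_f\lambda_f$, and each commutative square $(u,v):f\to g$ induces a map $F(u,v)$ between the middle objects commuting with the $\lambda$'s and $\rho$'s, with $F(id,id)=id$ and $F(uu',vv')=F(u,v)F(u',v')$. Factoring $0\to X$ as a cofibration $0\to QX$ followed by a trivial fibration $p_X:QX\to X$ gives a functor $Q$ and a natural transformation $p:Q\Rightarrow Id$; factoring $X\to 1$ as a trivial cofibration $v_X:X\to RX$ followed by a fibration gives a functor $R$ and a natural transformation $v:Id\Rightarrow R$. Normality: if $X$ is cofibrant then $QX=X$, $p_X=id_X$; if $X$ is fibrant then $RX=X$, $v_X=id_X$. $RQ$ takes values in $\mathcal{C}_{fc}$. The homotopy 2-category $\mathcal{H}o(\mathcal{A})$ of a category $\mathcal{A}$ with a class $\Sigma$ of arrows containing identities. Categories are 2-categories with only identity 2-cells; arrows are identified with their identity 2-cells. An arrow $f:X\to Y$ of a 2-category is an equivalence if there are $g:Y\to X$ and invertible 2-cells $id_X\Rightarrow gf$, $fg\Rightarrow id_Y$. A cylinder $C=(W,Z,d_0,d_1,s,x)$ for an object $X$ consists of arrows $d_0,d_1:X\to W$, $s:W\to Z$, $x:X\to Z$ of $\mathcal{A}$ with $s\in\Sigma$ and $sd_0=sd_1=x$. A homotopy $H=(C,h)$ from $f$ to $g$ ($f,g:X\to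 Y$) is a cylinder $C$ for $X$ with an arrow $h:W\to Y$ such that $hd_0=f$, $hd_1=g$. If $F:\mathcal{A}\to\mathcal{D}$ is a 2-functor into a 2-category sending $\Sigma$ to equivalences, there is a unique 2-cell $\widehat{FC}:Fd_0\Rightarrow Fd_1$ with $Fs\,\widehat{FC}=Fx$ (the identity 2-cell); put $\widehat{FH}=Fh\,\widehat{FC}:Ff\Rightarrow Fg$. $\mathcal{H}o(\mathcal{A})$ has the objects and arrows of $\mathcal{A}$. A 2-cell $f\Rightarrow g$ is a class $[H_n,\dots,H_1]$ of a finite sequence of composable homotopies from $f$ to $g$, where two sequences $(H_n,\dots,H_1)$, $(K_m,\dots,K_1)$ are equivalent iff $\widehat{FH_n}\circ\cdots\circ\widehat{FH_1}=\widehat{FK_m}\circ\cdots\circ\widehat{FK_1}$ for every 2-category $\mathcal{D}$ and every 2-functor $F:\mathcal{A}\to\mathcal{D}$ sending $\Sigma$ to equivalences. Vertical composition is juxtaposition of sequences; the identity of $f$ is the class of the homotopy with cylinder $(X,X,id,id,id,id)$ and $h=f$. Whiskering is $r[H]=[(C,rh)]$ and $[H]l=[(Cl,h)]$ with $Cl=(W,Z,d_0l,d_1l,s,xl)$, extended termwise; this determines horizontal composition. The inclusion $\mathcal{A}\to\mathcal{H}o(\mathcal{A})$ is the identity on objects and arrows. *)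

theory Defs
  imports Main "HOL-Library.FuncSet"
begin

section \<open>Categories and functors\<close>

record ('o, 'a) cat =
  Obj :: "'o set"
  Arr :: "'a set"
  Dom :: "'a \<Rightarrow> 'o"
  Cod :: "'a \<Rightarrow> 'o"
  Ide :: "'o \<Rightarrow> 'a"
  Comp :: "'a \<Rightarrow> 'a \<Rightarrow> 'a"  (infixr "\<cdot>\<index>" 75)

definition hom :: "('o, 'a, 'z) cat_scheme \<Rightarrow> 'o \<Rightarrow> 'o \<Rightarrow> 'a set" where
  "hom C X Y = {f \<in> Arr C. Dom C f = X \<and> Cod C f = Y}"

locale category =
  fixes C :: "('o, 'a, 'z) cat_scheme" (structure)
  assumes Dom_Obj: "f \<in> Arr C \<Longrightarrow> Dom C f \<in> Obj C"
    and Cod_Obj: "f \<in> Arr C \<Longrightarrow> Cod C f \<in> Obj C"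
    and Ide_hom: "X \<in> Obj C \<Longrightarrow> Ide C X \<in> hom C X X"
    and Comp_hom: "f \<in> hom C X Y \<Longrightarrow> g \<in> hom C Y Z \<Longrightarrow> g \<cdot> f \<in> hom C X Z"
    and Comp_Ide: "f \<in> Arr C \<Longrightarrow> f \<cdot> Ide C (Dom C f) = f"
    and Ide_Comp: "f \<in> Arr C \<Longrightarrow> Ide C (Cod C f) \<cdot> f = f"
    and Comp_assoc: "f \<in> hom C X Y \<Longrightarrow> g \<in> hom C Y Z \<Longrightarrow> h \<in> hom C Z T
      \<Longrightarrow> h \<cdot> (g \<cdot> f) = (h \<cdot> g) \<cdot> f"

text \<open>
  Functors are extensional (undefined outside the carriers of the source), so
  that HOL equality is equality of functors on the same source.
\<close>

record ('o, 'a, 'p, 'b) fnctr =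
  Fob :: "'o \<Rightarrow> 'p"
  Far :: "'a \<Rightarrow> 'b"

definition is_functor ::
  "('o, 'a, 'z) cat_scheme \<Rightarrow> ('p, 'b, 'y) cat_scheme \<Rightarrow> ('o, 'a, 'p, 'b, 'x) fnctr_scheme \<Rightarrow> bool" where
  "is_functor C D F \<longleftrightarrow>
     Fob F \<in> Obj C \<rightarrow>\<^sub>E Obj D \<and>
     Far F \<in> Arr C \<rightarrow>\<^sub>E Arr D \<and>
     (\<forall>f \<in> Arr C. Dom D (Far F f) = Fob F (Dom C f) \<and> Cod D (Far F f) = Fob F (Cod C f)) \<and>
     (\<forall>X \<in> Obj C. Far F (Ide C X) = Ide D (Fob F X)) \<and>
     (\<forall>f \<in> Arr C. \<forall>g \<in> Arr C. Dom C g = Cod C f \<longrightarrow>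
        Far F (g \<cdot>\<^bsub>C\<^esub> f) = Far F g \<cdot>\<^bsub>D\<^esub> Far F f)"

text \<open>Composite \<open>G F\<close> of functors, where \<open>C\<close> is the source of \<open>F\<close>.\<close>

definition fcomp ::
  "('o, 'a, 'z) cat_scheme \<Rightarrow> ('p, 'b, 'q, 'd) fnctr \<Rightarrow> ('o, 'a, 'p, 'b) fnctr \<Rightarrow> ('o, 'a, 'q, 'd) fnctr" where
  "fcomp C G F = \<lparr>Fob = compose (Obj C) (Fob G) (Fob F), Far = compose (Arr C) (Far G) (Far F)\<rparr>"

definition full_subcat :: "('o, 'a) cat \<Rightarrow> 'o set \<Rightarrow> ('o, 'a) cat" where
  "full_subcat C B = C\<lparr>Obj := Obj C \<inter> B, Arr := {f \<in> Arr C. Dom C f \<in> B \<and> Cod C f \<in> B}\<rparr>"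

definition incl_functor :: "('o, 'a) cat \<Rightarrow> ('o, 'a, 'o, 'a) fnctr" where
  "incl_functor B = \<lparr>Fob = (\<lambda>X \<in> Obj B. X), Far = (\<lambda>f \<in> Arr B. f)\<rparr>"


section \<open>Finite limits and colimits\<close>

definition cone ::
  "('o, 'a) cat \<Rightarrow> ('j, 'k) cat \<Rightarrow> ('j, 'k, 'o, 'a) fnctr \<Rightarrow> 'o \<Rightarrow> ('j \<Rightarrow> 'a) \<Rightarrow> bool" where
  "cone C J D L p \<longleftrightarrow> L \<in> Obj C \<and>
     (\<forall>j \<in> Obj J. p j \<in> hom C L (Fob D j)) \<and>
     (\<forall>k \<in> Arr J. Far D k \<cdot>\<^bsub>C\<^esub> p (Dom J k) = p (Cod J k))"

definition limit_cone ::
  "('o, 'a) cat \<Rightarrow> ('j, 'k) cat \<Rightarrow> ('j, 'k, 'o, 'a) fnctr \<Rightarrow> 'o \<Rightarrow> ('j \<Rightarrow> 'a) \<Rightarrow> bool" where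
  "limit_cone C J D L p \<longleftrightarrow> cone C J D L p \<and>
     (\<forall>L' p'. cone C J D L' p' \<longrightarrow>
        (\<exists>!u. u \<in> hom C L' L \<and> (\<forall>j \<in> Obj J. p j \<cdot>\<^bsub>C\<^esub> u = p' j)))"

definition cocone ::
  "('o, 'a) cat \<Rightarrow> ('j, 'k) cat \<Rightarrow> ('j, 'k, 'o, 'a) fnctr \<Rightarrow> 'o \<Rightarrow> ('j \<Rightarrow> 'a) \<Rightarrow> bool" where
  "cocone C J D L p \<longleftrightarrow> L \<in> Obj C \<and>
     (\<forall>j \<in> Obj J. p j \<in> hom C (Fob D j) L) \<and>
     (\<forall>k \<in> Arr J. p (Cod J k) \<cdot>\<^bsub>C\<^esub> Far D k = p (Dom J k))"

definition colimit_cocone ::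
  "('o, 'a) cat \<Rightarrow> ('j, 'k) cat \<Rightarrow> ('j, 'k, 'o, 'a) fnctr \<Rightarrow> 'o \<Rightarrow> ('j \<Rightarrow> 'a) \<Rightarrow> bool" where
  "colimit_cocone C J D L p \<longleftrightarrow> cocone C J D L p \<and>
     (\<forall>L' p'. cocone C J D L' p' \<longrightarrow>
        (\<exists>!u. u \<in> hom C L L' \<and> (\<forall>j \<in> Obj J. u \<cdot>\<^bsub>C\<^esub> p j = p' j)))"

text \<open>Every finite category is isomorphic to one whose objects and arrows are natural numbers.\<close>

definition has_finite_limits :: "('o, 'a) cat \<Rightarrow> bool" where
  "has_finite_limits C \<longleftrightarrow>
     (\<forall>(J :: (nat, nat) cat) D. category J \<and> finite (Obj J) \<and> finite (Arr J) \<and> is_functor J C D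
        \<longrightarrow> (\<exists>L p. limit_cone C J D L p))"

definition has_finite_colimits :: "('o, 'a) cat \<Rightarrow> bool" where
  "has_finite_colimits C \<longleftrightarrow>
     (\<forall>(J :: (nat, nat) cat) D. category J \<and> finite (Obj J) \<and> finite (Arr J) \<and> is_functor J C D
        \<longrightarrow> (\<exists>L p. colimit_cocone C J D L p))"

definition initial :: "('o, 'a) cat \<Rightarrow> 'o \<Rightarrow> bool" where
  "initial C z \<longleftrightarrow> z \<in> Obj C \<and> (\<forall>X \<in> Obj C. \<exists>!f. f \<in> hom C z X)"

definition terminal :: "('o, 'a) cat \<Rightarrow> 'o \<Rightarrow> bool" where
  "terminal C t \<longleftrightarrow> t \<in> Obj C \<and> (\<forall>X \<in> Obj C. \<exists>!f. f \<in> hom C X t)"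

definition the_arr :: "('o, 'a) cat \<Rightarrow> 'o \<Rightarrow> 'o \<Rightarrow> 'a" where
  "the_arr C X Y = (THE f. f \<in> hom C X Y)"


section \<open>Model categories\<close>

definition square :: "('o, 'a) cat \<Rightarrow> 'a \<Rightarrow> 'a \<Rightarrow> 'a \<Rightarrow> 'a \<Rightarrow> bool" where
  "square C f g u v \<longleftrightarrow> f \<in> Arr C \<and> g \<in> Arr C \<and>
     u \<in> hom C (Dom C f) (Dom C g) \<and> v \<in> hom C (Cod C f) (Cod C g) \<and>
     g \<cdot>\<^bsub>C\<^esub> u = v \<cdot>\<^bsub>C\<^esub> f"

definition arr_retract :: "('o, 'a) cat \<Rightarrow> 'a \<Rightarrow> 'a \<Rightarrow> bool" where
  "arr_retract C f g \<longleftrightarrow> (\<exists>u v u' v'. square C f g u v \<and> square C g f u' v' \<and>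
     u' \<cdot>\<^bsub>C\<^esub> u = Ide C (Dom C f) \<and> v' \<cdot>\<^bsub>C\<^esub> v = Ide C (Cod C f))"

definition retract_closed :: "('o, 'a) cat \<Rightarrow> 'a set \<Rightarrow> bool" where
  "retract_closed C K \<longleftrightarrow> (\<forall>f g. g \<in> K \<and> arr_retract C f g \<longrightarrow> f \<in> K)"

definition comp_closed :: "('o, 'a) cat \<Rightarrow> 'a set \<Rightarrow> bool" where
  "comp_closed C K \<longleftrightarrow> (\<forall>f \<in> K. \<forall>g \<in> K. Dom C g = Cod C f \<longrightarrow> g \<cdot>\<^bsub>C\<^esub> f \<in> K)"

definition lifts_against :: "('o, 'a) cat \<Rightarrow> 'a \<Rightarrow> 'a \<Rightarrow> bool" where
  "lifts_against C i p \<longleftrightarrow> (\<forall>u v. square C i p u v \<longrightarrow>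
     (\<exists>l \<in> hom C (Cod C i) (Dom C p). l \<cdot>\<^bsub>C\<^esub> i = u \<and> p \<cdot>\<^bsub>C\<^esub> l = v))"

locale model_category = category C
  for C :: "('o, 'a) cat" (structure) and Cof Fib Weq :: "'a set" +
  assumes classes_Arr: "Cof \<subseteq> Arr C" "Fib \<subseteq> Arr C" "Weq \<subseteq> Arr C"
    and finite_limits: "has_finite_limits C"
    and finite_colimits: "has_finite_colimits C"
    and retracts: "retract_closed C Cof" "retract_closed C Fib" "retract_closed C Weq"
    and composites: "comp_closed C Cof" "comp_closed C Fib" "comp_closed C Weq"
    and three_for_two:
      "f \<in> Arr C \<Longrightarrow> g \<in> Arr C \<Longrightarrow> Dom C g = Cod C f \<Longrightarrow> f \<in> Weq \<Longrightarrow> g \<cdot> f \<in> Weq \<Longrightarrow> g \<in> Weq"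
      "f \<in> Arr C \<Longrightarrow> g \<in> Arr C \<Longrightarrow> Dom C g = Cod C f \<Longrightarrow> g \<in> Weq \<Longrightarrow> g \<cdot> f \<in> Weq \<Longrightarrow> f \<in> Weq"
    and lifting:
      "i \<in> Cof \<Longrightarrow> p \<in> Fib \<inter> Weq \<Longrightarrow> lifts_against C i p"
      "i \<in> Cof \<inter> Weq \<Longrightarrow> p \<in> Fib \<Longrightarrow> lifts_against C i p"
    and factorization:
      "f \<in> Arr C \<Longrightarrow> \<exists>i \<in> Cof. \<exists>p \<in> Fib \<inter> Weq. Dom C p = Cod C i \<and> p \<cdot> i = f"
      "f \<in> Arr C \<Longrightarrow> \<exists>i \<in> Cof \<inter> Weq. \<exists>p \<in> Fib. Dom C p = Cod C i \<and> p \<cdot> i = f"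

text \<open>
  A functorial factorization \<open>f = Rho f \<cdot> Lam f\<close>; a commutative square \<open>(u, v) : f \<rightarrow> g\<close>
  induces \<open>Fmap f g u v : Mid f \<rightarrow> Mid g\<close>.
\<close>

record ('o, 'a) ffact =
  Mid :: "'a \<Rightarrow> 'o"
  Lam :: "'a \<Rightarrow> 'a"
  Rho :: "'a \<Rightarrow> 'a"
  Fmap :: "'a \<Rightarrow> 'a \<Rightarrow> 'a \<Rightarrow> 'a \<Rightarrow> 'a"

definition functorial_factorization ::
  "('o, 'a) cat \<Rightarrow> 'a set \<Rightarrow> 'a set \<Rightarrow> ('o, 'a) ffact \<Rightarrow> bool" where
  "functorial_factorization C L R \<Phi> \<longleftrightarrow>
     (\<forall>f \<in> Arr C.
        Lam \<Phi> f \<in> L \<and> Lam \<Phi> f \<in> hom C (Dom C f) (Mid \<Phi> f) \<and>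
        Rho \<Phi> f \<in> R \<and> Rho \<Phi> f \<in> hom C (Mid \<Phi> f) (Cod C f) \<and>
        Rho \<Phi> f \<cdot>\<^bsub>C\<^esub> Lam \<Phi> f = f) \<and>
     (\<forall>f g u v. square C f g u v \<longrightarrow>
        Fmap \<Phi> f g u v \<in> hom C (Mid \<Phi> f) (Mid \<Phi> g) \<and>
        Fmap \<Phi> f g u v \<cdot>\<^bsub>C\<^esub> Lam \<Phi> f = Lam \<Phi> g \<cdot>\<^bsub>C\<^esub> u \<and>
        Rho \<Phi> g \<cdot>\<^bsub>C\<^esub> Fmap \<Phi> f g u v = v \<cdot>\<^bsub>C\<^esub> Rho \<Phi> f) \<and>
     (\<forall>f \<in> Arr C. Fmap \<Phi> f f (Ide C (Dom C f)) (Ide C (Cod C f)) = Ide C (Mid \<Phi> f)) \<and>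
     (\<forall>f g h u v u' v'. square C f g u' v' \<and> square C g h u v \<longrightarrow>
        Fmap \<Phi> f h (u \<cdot>\<^bsub>C\<^esub> u') (v \<cdot>\<^bsub>C\<^esub> v') = Fmap \<Phi> g h u v \<cdot>\<^bsub>C\<^esub> Fmap \<Phi> f g u' v')"

definition cofibrant :: "('o, 'a) cat \<Rightarrow> 'a set \<Rightarrow> 'o \<Rightarrow> 'o \<Rightarrow> bool" where
  "cofibrant C Cof z X \<longleftrightarrow> X \<in> Obj C \<and> the_arr C z X \<in> Cof"

definition fibrant :: "('o, 'a) cat \<Rightarrow> 'a set \<Rightarrow> 'o \<Rightarrow> 'o \<Rightarrow> bool" where
  "fibrant C Fib t X \<longleftrightarrow> X \<in> Obj C \<and> the_arr C X t \<in> Fib"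

definition cofib_repl :: "('o, 'a) cat \<Rightarrow> 'o \<Rightarrow> ('o, 'a) ffact \<Rightarrow> ('o, 'a, 'o, 'a) fnctr" where
  "cofib_repl C z \<Phi> = \<lparr>
     Fob = (\<lambda>X \<in> Obj C. Mid \<Phi> (the_arr C z X)),
     Far = (\<lambda>f \<in> Arr C.
       Fmap \<Phi> (the_arr C z (Dom C f)) (the_arr C z (Cod C f)) (Ide C z) f)\<rparr>"

definition fib_repl :: "('o, 'a) cat \<Rightarrow> 'o \<Rightarrow> ('o, 'a) ffact \<Rightarrow> ('o, 'a, 'o, 'a) fnctr" where
  "fib_repl C t \<Psi> = \<lparr>
     Fob = (\<lambda>X \<in> Obj C. Mid \<Psi> (the_arr C X t)),
     Far = (\<lambda>f \<in> Arr C.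
       Fmap \<Psi> (the_arr C (Dom C f) t) (the_arr C (Cod C f) t) f (Ide C t))\<rparr>"

text \<open>
  A functor record does not mention its target, so this is also the corestriction
  of \<open>RQ\<close> to the fibrant-cofibrant objects; see \<open>RQ_corestriction\<close> below.
\<close>

definition RQ_functor ::
  "('o, 'a) cat \<Rightarrow> 'o \<Rightarrow> 'o \<Rightarrow> ('o, 'a) ffact \<Rightarrow> ('o, 'a) ffact \<Rightarrow> ('o, 'a, 'o, 'a) fnctr" where
  "RQ_functor C z t \<Phi> \<Psi> = fcomp C (fib_repl C t \<Psi>) (cofib_repl C z \<Phi>)"

text \<open>
  A model category with chosen initial object \<open>z\<close>, terminal object \<open>t\<close> and normal
  functorial factorizations \<open>\<Phi>\<close> (cofibration, trivial fibration) and \<open>\<Psi>\<close> (trivial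
  cofibration, fibration).  The natural transformations are \<open>p\<^sub>X = Rho \<Phi> (z \<rightarrow> X)\<close>
  and \<open>v\<^sub>X = Lam \<Psi> (X \<rightarrow> t)\<close>.
\<close>

locale normal_model_category = model_category C Cof Fib Weq
  for C :: "('o, 'a) cat" (structure) and Cof Fib Weq +
  fixes z t :: 'o and \<Phi> \<Psi> :: "('o, 'a) ffact"
  assumes initial_z: "initial C z"
    and terminal_t: "terminal C t"
    and fact_\<Phi>: "functorial_factorization C Cof (Fib \<inter> Weq) \<Phi>"
    and fact_\<Psi>: "functorial_factorization C (Cof \<inter> Weq) Fib \<Psi>"
    and normal_cofibrant: "cofibrant C Cof z X \<Longrightarrow>
      Fob (cofib_repl C z \<Phi>) X = X \<and> Rho \<Phi> (the_arr C z X) = Ide C X"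
    and normal_fibrant: "fibrant C Fib t X \<Longrightarrow>
      Fob (fib_repl C t \<Psi>) X = X \<and> Lam \<Psi> (the_arr C X t) = Ide C X"

definition fibrant_cofibrant :: "('o, 'a) cat \<Rightarrow> 'a set \<Rightarrow> 'a set \<Rightarrow> 'o \<Rightarrow> 'o \<Rightarrow> ('o, 'a) cat" where
  "fibrant_cofibrant C Cof Fib z t =
     full_subcat C {X. cofibrant C Cof z X \<and> fibrant C Fib t X}"


section \<open>Strict 2-categories and 2-functors\<close>

record ('o, 'a, 'c) two_cat = "('o, 'a) cat" +
  Cell :: "'c set"
  Src :: "'c \<Rightarrow> 'a"
  Trg :: "'c \<Rightarrow> 'a"
  Ide2 :: "'a \<Rightarrow> 'c"
  VComp :: "'c \<Rightarrow> 'c \<Rightarrow> 'c"  (infixr "\<bullet>\<index>" 70)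
  HComp :: "'c \<Rightarrow> 'c \<Rightarrow> 'c"  (infixr "\<star>\<index>" 75)

definition cells :: "('o, 'a, 'c, 'z) two_cat_scheme \<Rightarrow> 'a \<Rightarrow> 'a \<Rightarrow> 'c set" where
  "cells D f g = {\<alpha> \<in> Cell D. Src D \<alpha> = f \<and> Trg D \<alpha> = g}"

locale two_category = category D
  for D :: "('o, 'a, 'c, 'z) two_cat_scheme" (structure) +
  assumes Src_Trg: "\<alpha> \<in> Cell D \<Longrightarrow> \<exists>X Y. Src D \<alpha> \<in> hom D X Y \<and> Trg D \<alpha> \<in> hom D X Y"
    and Ide2_cells: "f \<in> Arr D \<Longrightarrow> Ide2 D f \<in> cells D f f"
    and VComp_cells: "\<alpha> \<in> cells D f g \<Longrightarrow> \<beta> \<in> cells D g h \<Longrightarrow> \<beta> \<bullet> \<alpha> \<in> cells D f h"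
    and VComp_Ide2: "\<alpha> \<in> cells D f g \<Longrightarrow> \<alpha> \<bullet> Ide2 D f = \<alpha>"
    and Ide2_VComp: "\<alpha> \<in> cells D f g \<Longrightarrow> Ide2 D g \<bullet> \<alpha> = \<alpha>"
    and VComp_assoc: "\<alpha> \<in> cells D f g \<Longrightarrow> \<beta> \<in> cells D g h \<Longrightarrow> \<gamma> \<in> cells D h k
      \<Longrightarrow> \<gamma> \<bullet> (\<beta> \<bullet> \<alpha>) = (\<gamma> \<bullet> \<beta>) \<bullet> \<alpha>"
    and HComp_cells: "\<alpha> \<in> cells D f g \<Longrightarrow> \<beta> \<in> cells D h k \<Longrightarrow> Cod D f = Dom D h
      \<Longrightarrow> \<beta> \<star> \<alpha> \<in> cells D (h \<cdot> f) (k \<cdot> g)"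
    and HComp_Ide: "\<alpha> \<in> cells D f g \<Longrightarrow> \<alpha> \<star> Ide2 D (Ide D (Dom D f)) = \<alpha>"
    and Ide_HComp: "\<alpha> \<in> cells D f g \<Longrightarrow> Ide2 D (Ide D (Cod D f)) \<star> \<alpha> = \<alpha>"
    and HComp_assoc: "\<alpha> \<in> cells D f f' \<Longrightarrow> \<beta> \<in> cells D g g' \<Longrightarrow> \<gamma> \<in> cells D h h'
      \<Longrightarrow> Cod D f = Dom D g \<Longrightarrow> Cod D g = Dom D h
      \<Longrightarrow> \<gamma> \<star> (\<beta> \<star> \<alpha>) = (\<gamma> \<star> \<beta>) \<star> \<alpha>"
    and HComp_Ide2: "f \<in> hom D X Y \<Longrightarrow> g \<in> hom D Y Z \<Longrightarrow> Ide2 D g \<star> Ide2 D f = Ide2 D (g \<cdot> f)"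
    and interchange: "\<alpha> \<in> cells D f f' \<Longrightarrow> \<alpha>' \<in> cells D f' f'' \<Longrightarrow> \<beta> \<in> cells D g g'
      \<Longrightarrow> \<beta>' \<in> cells D g' g'' \<Longrightarrow> Cod D f = Dom D g
      \<Longrightarrow> (\<beta>' \<bullet> \<beta>) \<star> (\<alpha>' \<bullet> \<alpha>) = (\<beta>' \<star> \<alpha>') \<bullet> (\<beta> \<star> \<alpha>)"

definition invertible_cell :: "('o, 'a, 'c, 'z) two_cat_scheme \<Rightarrow> 'c \<Rightarrow> bool" where
  "invertible_cell D \<alpha> \<longleftrightarrow> (\<exists>\<beta> \<in> cells D (Trg D \<alpha>) (Src D \<alpha>).
     \<beta> \<bullet>\<^bsub>D\<^esub> \<alpha> = Ide2 D (Src D \<alpha>) \<and> \<alpha> \<bullet>\<^bsub>D\<^esub> \<beta> = Ide2 D (Trg D \<alpha>))"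

definition equivalence :: "('o, 'a, 'c, 'z) two_cat_scheme \<Rightarrow> 'a \<Rightarrow> bool" where
  "equivalence D f \<longleftrightarrow> f \<in> Arr D \<and> (\<exists>g \<in> hom D (Cod D f) (Dom D f).
     (\<exists>\<eta> \<in> cells D (Ide D (Dom D f)) (g \<cdot>\<^bsub>D\<^esub> f). invertible_cell D \<eta>) \<and>
     (\<exists>\<epsilon> \<in> cells D (f \<cdot>\<^bsub>D\<^esub> g) (Ide D (Cod D f)). invertible_cell D \<epsilon>))"

record ('o, 'a, 'c, 'p, 'b, 'd) two_fnctr = "('o, 'a, 'p, 'b) fnctr" +
  Fce :: "'c \<Rightarrow> 'd"

definition is_two_functor ::
  "('o, 'a, 'c, 'z) two_cat_scheme \<Rightarrow> ('p, 'b, 'd, 'y) two_cat_scheme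
    \<Rightarrow> ('o, 'a, 'c, 'p, 'b, 'd) two_fnctr \<Rightarrow> bool" where
  "is_two_functor D E F \<longleftrightarrow> is_functor D E F \<and>
     Fce F \<in> Cell D \<rightarrow>\<^sub>E Cell E \<and>
     (\<forall>\<alpha> \<in> Cell D. Src E (Fce F \<alpha>) = Far F (Src D \<alpha>) \<and> Trg E (Fce F \<alpha>) = Far F (Trg D \<alpha>)) \<and>
     (\<forall>f \<in> Arr D. Fce F (Ide2 D f) = Ide2 E (Far F f)) \<and>
     (\<forall>\<alpha> \<in> Cell D. \<forall>\<beta> \<in> Cell D. Src D \<beta> = Trg D \<alpha> \<longrightarrow>
        Fce F (\<beta> \<bullet>\<^bsub>D\<^esub> \<alpha>) = Fce F \<beta> \<bullet>\<^bsub>E\<^esub> Fce F \<alpha>) \<and>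
     (\<forall>\<alpha> \<in> Cell D. \<forall>\<beta> \<in> Cell D. Dom D (Src D \<beta>) = Cod D (Src D \<alpha>) \<longrightarrow>
        Fce F (\<beta> \<star>\<^bsub>D\<^esub> \<alpha>) = Fce F \<beta> \<star>\<^bsub>E\<^esub> Fce F \<alpha>)"

text \<open>Composite \<open>G F\<close> of 2-functors, where \<open>D\<close> is the source of \<open>F\<close>.\<close>

definition two_comp ::
  "('o, 'a, 'c, 'z) two_cat_scheme \<Rightarrow> ('p, 'b, 'd, 'q, 'e, 'f) two_fnctr
    \<Rightarrow> ('o, 'a, 'c, 'p, 'b, 'd) two_fnctr \<Rightarrow> ('o, 'a, 'c, 'q, 'e, 'f) two_fnctr" where
  "two_comp D G F = \<lparr>
     Fob = compose (Obj D) (Fob G) (Fob F),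
     Far = compose (Arr D) (Far G) (Far F),
     Fce = compose (Cell D) (Fce G) (Fce F)\<rparr>"

text \<open>
  A category as a 2-category with only identity 2-cells: each arrow is its own
  identity 2-cell, so 2-cells and arrows have the same type.
\<close>

definition disc :: "('o, 'a) cat \<Rightarrow> ('o, 'a, 'a) two_cat" where
  "disc C = \<lparr>Obj = Obj C, Arr = Arr C, Dom = Dom C, Cod = Cod C, Ide = Ide C, Comp = Comp C,
     Cell = Arr C, Src = (\<lambda>f. f), Trg = (\<lambda>f. f), Ide2 = (\<lambda>f. f),
     VComp = (\<lambda>g f. f), HComp = Comp C\<rparr>"

definition disc_functor :: "('o, 'a, 'p, 'b) fnctr \<Rightarrow> ('o, 'a, 'a, 'p, 'b, 'b) two_fnctr" where
  "disc_functor F = \<lparr>Fob = Fob F, Far = Far F, Fce = Far F\<rparr>"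


section \<open>Cylinders and homotopies\<close>

datatype ('o, 'a) cylinder =
  Cylinder (cW: 'o) (cZ: 'o) (cd0: 'a) (cd1: 'a) (cs: 'a) (cx: 'a)

definition is_cylinder :: "('o, 'a) cat \<Rightarrow> 'a set \<Rightarrow> 'o \<Rightarrow> ('o, 'a) cylinder \<Rightarrow> bool" where
  "is_cylinder A \<Sigma> X K \<longleftrightarrow>
     cd0 K \<in> hom A X (cW K) \<and> cd1 K \<in> hom A X (cW K) \<and>
     cs K \<in> hom A (cW K) (cZ K) \<and> cx K \<in> hom A X (cZ K) \<and> cs K \<in> \<Sigma> \<and>
     cs K \<cdot>\<^bsub>A\<^esub> cd0 K = cx K \<and> cs K \<cdot>\<^bsub>A\<^esub> cd1 K = cx K"

type_synonym ('o, 'a) homotopy = "('o, 'a) cylinder \<times> 'a"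

definition is_homotopy :: "('o, 'a) cat \<Rightarrow> 'a set \<Rightarrow> 'a \<Rightarrow> 'a \<Rightarrow> ('o, 'a) homotopy \<Rightarrow> bool" where
  "is_homotopy A \<Sigma> f g H \<longleftrightarrow> (\<exists>X Y. f \<in> hom A X Y \<and> g \<in> hom A X Y \<and>
     is_cylinder A \<Sigma> X (fst H) \<and> snd H \<in> hom A (cW (fst H)) Y \<and>
     snd H \<cdot>\<^bsub>A\<^esub> cd0 (fst H) = f \<and> snd H \<cdot>\<^bsub>A\<^esub> cd1 (fst H) = g)"

text \<open>
  Nonempty sequences of composable homotopies from \<open>f\<close> to \<open>g\<close>, written
  \<open>[H\<^sub>n, \<dots>, H\<^sub>1]\<close>: the homotopy \<open>H\<^sub>1\<close> starting at \<open>f\<close> comes last.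
\<close>

inductive homotopy_seq ::
  "('o, 'a) cat \<Rightarrow> 'a set \<Rightarrow> 'a \<Rightarrow> 'a \<Rightarrow> ('o, 'a) homotopy list \<Rightarrow> bool"
  for A \<Sigma> f where
    single: "is_homotopy A \<Sigma> f g H \<Longrightarrow> homotopy_seq A \<Sigma> f g [H]"
  | step: "homotopy_seq A \<Sigma> f g Hs \<Longrightarrow> is_homotopy A \<Sigma> g h H \<Longrightarrow> homotopy_seq A \<Sigma> f h (H # Hs)"

definition id_homotopy :: "('o, 'a) cat \<Rightarrow> 'a \<Rightarrow> ('o, 'a) homotopy" where
  "id_homotopy A f = (let X = Dom A f; e = Ide A X in (Cylinder X X e e e e, f))"

definition whisk_left :: "('o, 'a) cat \<Rightarrow> 'a \<Rightarrow> ('o, 'a) homotopy \<Rightarrow> ('o, 'a) homotopy" where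
  "whisk_left A r H = (fst H, r \<cdot>\<^bsub>A\<^esub> snd H)"

definition whisk_right :: "('o, 'a) cat \<Rightarrow> ('o, 'a) homotopy \<Rightarrow> 'a \<Rightarrow> ('o, 'a) homotopy" where
  "whisk_right A H l = (case fst H of Cylinder W Z d0 d1 s x \<Rightarrow>
     (Cylinder W Z (d0 \<cdot>\<^bsub>A\<^esub> l) (d1 \<cdot>\<^bsub>A\<^esub> l) s (x \<cdot>\<^bsub>A\<^esub> l), snd H))"

definition inverts :: "'a set \<Rightarrow> ('p, 'b, 'd) two_cat \<Rightarrow> ('o, 'a, 'a, 'p, 'b, 'd) two_fnctr \<Rightarrow> bool" where
  "inverts \<Sigma> D F \<longleftrightarrow> (\<forall>s \<in> \<Sigma>. equivalence D (Far F s))"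

text \<open>
  The 2-cell \<open>F d\<^sub>0 \<Rightarrow> F d\<^sub>1\<close> induced by a cylinder, the 2-cell \<open>F f \<Rightarrow> F g\<close> induced by a
  homotopy, and the vertical composite of the latter along a sequence.  The description
  is meaningful when \<open>F s\<close> is an equivalence, see \<open>hat_cyl_unique\<close> below.
\<close>

definition hat_cyl ::
  "('p, 'b, 'd) two_cat \<Rightarrow> ('o, 'a, 'a, 'p, 'b, 'd) two_fnctr \<Rightarrow> ('o, 'a) cylinder \<Rightarrow> 'd" where
  "hat_cyl D F K = (THE \<alpha>. \<alpha> \<in> cells D (Far F (cd0 K)) (Far F (cd1 K)) \<and>
     Ide2 D (Far F (cs K)) \<star>\<^bsub>D\<^esub> \<alpha> = Ide2 D (Far F (cx K)))"

definition hat ::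
  "('p, 'b, 'd) two_cat \<Rightarrow> ('o, 'a, 'a, 'p, 'b, 'd) two_fnctr \<Rightarrow> ('o, 'a) homotopy \<Rightarrow> 'd" where
  "hat D F H = Ide2 D (Far F (snd H)) \<star>\<^bsub>D\<^esub> hat_cyl D F (fst H)"

fun hat_seq ::
  "('p, 'b, 'd) two_cat \<Rightarrow> ('o, 'a, 'a, 'p, 'b, 'd) two_fnctr \<Rightarrow> ('o, 'a) homotopy list \<Rightarrow> 'd" where
  "hat_seq D F [] = undefined"
| "hat_seq D F [H] = hat D F H"
| "hat_seq D F (H # Hs) = hat D F H \<bullet>\<^bsub>D\<^esub> hat_seq D F Hs"


section \<open>The homotopy 2-category\<close>

text \<open>
  HOL cannot quantify over the 2-categories of all types inside a definition, so
  the test 2-categories range over types of formal composites.  This loses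
  nothing: a 2-functor \<open>F : A \<rightarrow> D\<close> inverting \<open>\<Sigma>\<close> factors through the sub-2-category
  of \<open>D\<close> generated by the arrows \<open>F f\<close>, a chosen quasi-inverse of each \<open>F s\<close>
  (\<open>s \<in> \<Sigma>\<close>) and the invertible 2-cells exhibiting it, and every arrow and 2-cell of
  this sub-2-category is named by a formal composite.  Theorem \<open>homotopy_eq_universal\<close>
  below proves that equivalent sequences agree for 2-categories \<open>D\<close> of arbitrary type.
\<close>

datatype 'a arr_word = AGen 'a | AInv 'a | AComp "'a arr_word" "'a arr_word"

datatype 'a cell_word =
    CUnit 'a | CUnitInv 'a | CCounit 'a | CCounitInv 'a | CIde "'a arr_word"
  | CVComp "'a cell_word" "'a cell_word" | CHComp "'a cell_word" "'a cell_word"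

definition homotopy_eq ::
  "('o, 'a) cat \<Rightarrow> 'a set \<Rightarrow> ('o, 'a) homotopy list \<Rightarrow> ('o, 'a) homotopy list \<Rightarrow> bool" where
  "homotopy_eq A \<Sigma> Hs Ks \<longleftrightarrow>
     (\<exists>f g. homotopy_seq A \<Sigma> f g Hs \<and> homotopy_seq A \<Sigma> f g Ks) \<and>
     (\<forall>(D :: ('o, 'a arr_word, 'a cell_word) two_cat) F.
        two_category D \<and> is_two_functor (disc A) D F \<and> inverts \<Sigma> D F
          \<longrightarrow> hat_seq D F Hs = hat_seq D F Ks)"

definition hclass ::
  "('o, 'a) cat \<Rightarrow> 'a set \<Rightarrow> ('o, 'a) homotopy list \<Rightarrow> ('o, 'a) homotopy list set" where
  "hclass A \<Sigma> Hs = {Ks. homotopy_eq A \<Sigma> Hs Ks}"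

definition hrep :: "('o, 'a) homotopy list set \<Rightarrow> ('o, 'a) homotopy list" where
  "hrep \<alpha> = (SOME Hs. Hs \<in> \<alpha>)"

definition hSrc :: "('o, 'a) cat \<Rightarrow> 'a set \<Rightarrow> ('o, 'a) homotopy list set \<Rightarrow> 'a" where
  "hSrc A \<Sigma> \<alpha> = (THE f. \<exists>g. homotopy_seq A \<Sigma> f g (hrep \<alpha>))"

definition hTrg :: "('o, 'a) cat \<Rightarrow> 'a set \<Rightarrow> ('o, 'a) homotopy list set \<Rightarrow> 'a" where
  "hTrg A \<Sigma> \<alpha> = (THE g. \<exists>f. homotopy_seq A \<Sigma> f g (hrep \<alpha>))"

text \<open>
  For \<open>\<alpha> : f \<Rightarrow> g\<close> and \<open>\<beta> : h \<Rightarrow> k\<close> the horizontal composite \<open>\<beta> \<star> \<alpha> : h f \<Rightarrow> k g\<close>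
  is the vertical composite of \<open>h \<alpha>\<close> followed by \<open>\<beta> g\<close>.
\<close>

definition Ho :: "('o, 'a) cat \<Rightarrow> 'a set \<Rightarrow> ('o, 'a, ('o, 'a) homotopy list set) two_cat" where
  "Ho A \<Sigma> = \<lparr>Obj = Obj A, Arr = Arr A, Dom = Dom A, Cod = Cod A, Ide = Ide A, Comp = Comp A,
     Cell = {hclass A \<Sigma> Hs | Hs. \<exists>f g. homotopy_seq A \<Sigma> f g Hs},
     Src = hSrc A \<Sigma>,
     Trg = hTrg A \<Sigma>,
     Ide2 = (\<lambda>f. hclass A \<Sigma> [id_homotopy A f]),
     VComp = (\<lambda>\<beta> \<alpha>. hclass A \<Sigma> (hrep \<beta> @ hrep \<alpha>)),
     HComp = (\<lambda>\<beta> \<alpha>. hclass A \<Sigma>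
       (map (\<lambda>H. whisk_right A H (hTrg A \<Sigma> \<alpha>)) (hrep \<beta>) @
        map (whisk_left A (hSrc A \<Sigma> \<beta>)) (hrep \<alpha>)))\<rparr>"

definition Ho_incl ::
  "('o, 'a) cat \<Rightarrow> 'a set \<Rightarrow> ('o, 'a, 'a, 'o, 'a, ('o, 'a) homotopy list set) two_fnctr" where
  "Ho_incl A \<Sigma> = \<lparr>Fob = (\<lambda>X \<in> Obj A. X), Far = (\<lambda>f \<in> Arr A. f),
     Fce = (\<lambda>f \<in> Arr A. Ide2 (Ho A \<Sigma>) f)\<rparr>"


section \<open>Independence of the test types\<close>

lemma cellsD: "\<alpha> \<in> cells D f g \<Longrightarrow> \<alpha> \<in> Cell D \<and> Src D \<alpha> = f \<and> Trg D \<alpha> = g"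
  by (simp add: cells_def)

lemma homD: "f \<in> hom D X Y \<Longrightarrow> f \<in> Arr D \<and> Dom D f = X \<and> Cod D f = Y"
  by (simp add: hom_def)

context two_category
begin

lemma cells_par:
  assumes "\<alpha> \<in> cells D f g" "f \<in> hom D X Y"
  shows "g \<in> hom D X Y"
  using assms Src_Trg[of \<alpha>] by (auto simp: cells_def hom_def)

lemma cells_par':
  assumes "\<alpha> \<in> cells D f g" "g \<in> hom D X Y"
  shows "f \<in> hom D X Y"
  using assms Src_Trg[of \<alpha>] by (auto simp: cells_def hom_def)

lemma hom_Obj: "f \<in> hom D X Y \<Longrightarrow> X \<in> Obj D \<and> Y \<in> Obj D"
  using Dom_Obj Cod_Obj by (auto simp: hom_def)

lemma Ide2_cells_hom: "f \<in> hom D X Y \<Longrightarrow> Ide2 D f \<in> cells D f f"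
  using Ide2_cells by (simp add: hom_def)

lemma HComp_cells_hom:
  "\<alpha> \<in> cells D f g \<Longrightarrow> \<beta> \<in> cells D h k \<Longrightarrow> f \<in> hom D X Y \<Longrightarrow> h \<in> hom D Y Z
    \<Longrightarrow> \<beta> \<star> \<alpha> \<in> cells D (h \<cdot> f) (k \<cdot> g)"
  using HComp_cells by (simp add: hom_def)

lemma interchange_hom:
  "\<alpha> \<in> cells D f f' \<Longrightarrow> \<alpha>' \<in> cells D f' f'' \<Longrightarrow> \<beta> \<in> cells D g g' \<Longrightarrow> \<beta>' \<in> cells D g' g''
    \<Longrightarrow> f \<in> hom D X Y \<Longrightarrow> g \<in> hom D Y Z
    \<Longrightarrow> (\<beta>' \<bullet> \<beta>) \<star> (\<alpha>' \<bullet> \<alpha>) = (\<beta>' \<star> \<alpha>') \<bullet> (\<beta> \<star> \<alpha>)"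
  using interchange by (simp add: hom_def)

lemma HComp_assoc_hom: "\<alpha> \<in> cells D f f' \<Longrightarrow> \<beta> \<in> cells D g g' \<Longrightarrow> \<gamma> \<in> cells D h h'
      \<Longrightarrow> f \<in> hom D X Y \<Longrightarrow> g \<in> hom D Y Z \<Longrightarrow> h \<in> hom D Z T
      \<Longrightarrow> \<gamma> \<star> (\<beta> \<star> \<alpha>) = (\<gamma> \<star> \<beta>) \<star> \<alpha>"
  using HComp_assoc by (simp add: hom_def)

lemma whisk_unit:
  assumes s: "s \<in> hom D W Z" and g: "g \<in> hom D Z W"
    and \<eta>: "\<eta> \<in> cells D (Ide D W) (g \<cdot> s)"
    and a: "a \<in> hom D X W" and \<alpha>: "\<alpha> \<in> cells D a b"
  shows "(Ide2 D g \<star> (Ide2 D s \<star> \<alpha>)) \<bullet> (\<eta> \<star> Ide2 D a) = (\<eta> \<star> Ide2 D b) \<bullet> \<alpha>"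
proof -
  have b: "b \<in> hom D X W" using cells_par[OF \<alpha> a] .
  have W: "Ide D W \<in> hom D W W" using hom_Obj[OF a] Ide_hom by blast
  have gs: "g \<cdot> s \<in> hom D W W" using Comp_hom[OF s g] .
  note i = Ide2_cells_hom
  have "Ide2 D g \<star> (Ide2 D s \<star> \<alpha>) = Ide2 D (g \<cdot> s) \<star> \<alpha>"
    using HComp_assoc_hom[OF \<alpha> i[OF s] i[OF g] a s g] HComp_Ide2[OF s g] by simp
  then have "(Ide2 D g \<star> (Ide2 D s \<star> \<alpha>)) \<bullet> (\<eta> \<star> Ide2 D a)
      = (Ide2 D (g \<cdot> s) \<bullet> \<eta>) \<star> (\<alpha> \<bullet> Ide2 D a)"
    using interchange_hom[OF i[OF a] \<alpha> \<eta> i[OF gs] a W] by simp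
  also have "\<dots> = \<eta> \<star> \<alpha>" using Ide2_VComp[OF \<eta>] VComp_Ide2[OF \<alpha>] by simp
  also have "\<dots> = (\<eta> \<bullet> Ide2 D (Ide D W)) \<star> (Ide2 D b \<bullet> \<alpha>)"
    using VComp_Ide2[OF \<eta>] Ide2_VComp[OF \<alpha>] by simp
  also have "\<dots> = (\<eta> \<star> Ide2 D b) \<bullet> (Ide2 D (Ide D W) \<star> \<alpha>)"
    using interchange_hom[OF \<alpha> i[OF b] i[OF W] \<eta> a W] by simp
  also have "Ide2 D (Ide D W) \<star> \<alpha> = \<alpha>" using Ide_HComp[OF \<alpha>] a by (simp add: hom_def)
  finally show ?thesis .
qed

lemma inv_unit_whisk:
  assumes "b \<in> hom D X W" and "e \<in> hom D W W" and "f \<in> hom D W W"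
    and "\<eta> \<in> cells D e f" and "\<eta>' \<in> cells D f e" and "\<eta>' \<bullet> \<eta> = Ide2 D e"
  shows "(\<eta>' \<star> Ide2 D b) \<bullet> (\<eta> \<star> Ide2 D b) = Ide2 D (e \<cdot> b)"
  using interchange_hom[OF Ide2_cells_hom[OF assms(1)] Ide2_cells_hom[OF assms(1)] assms(4,5,1,2)]
    VComp_Ide2[OF Ide2_cells_hom[OF assms(1)]] HComp_Ide2[OF assms(1,2)] assms(6) by simp

lemma whisk_faithful:
  assumes s: "s \<in> hom D W Z" and g: "g \<in> hom D Z W"
    and \<eta>: "\<eta> \<in> cells D (Ide D W) (g \<cdot> s)" and \<eta>': "\<eta>' \<in> cells D (g \<cdot> s) (Ide D W)"
    and inv: "\<eta>' \<bullet> \<eta> = Ide2 D (Ide D W)"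
    and a: "a \<in> hom D X W" and \<alpha>: "\<alpha> \<in> cells D a b" and \<beta>: "\<beta> \<in> cells D a b"
    and eq: "Ide2 D s \<star> \<alpha> = Ide2 D s \<star> \<beta>"
  shows "\<alpha> = \<beta>"
proof -
  have b: "b \<in> hom D X W" using cells_par[OF \<alpha> a] .
  have W: "Ide D W \<in> hom D W W" using hom_Obj[OF a] Ide_hom by blast
  have gs: "g \<cdot> s \<in> hom D W W" using Comp_hom[OF s g] .
  have Wb: "Ide D W \<cdot> b = b" using Ide_Comp b by (auto simp: hom_def)
  have 1: "\<eta> \<star> Ide2 D b \<in> cells D b (g \<cdot> s \<cdot> b)"
    using HComp_cells_hom[OF Ide2_cells_hom[OF b] \<eta> b W] Wb Comp_assoc[OF b s g] by simp
  have 2: "\<eta>' \<star> Ide2 D b \<in> cells D (g \<cdot> s \<cdot> b) b"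
    using HComp_cells_hom[OF Ide2_cells_hom[OF b] \<eta>' b gs] Wb Comp_assoc[OF b s g] by simp
  have "\<gamma> = (\<eta>' \<star> Ide2 D b) \<bullet> ((Ide2 D g \<star> (Ide2 D s \<star> \<gamma>)) \<bullet> (\<eta> \<star> Ide2 D a))"
    if \<gamma>: "\<gamma> \<in> cells D a b" for \<gamma>
    using whisk_unit[OF s g \<eta> a \<gamma>] VComp_assoc[OF \<gamma> 1 2] inv_unit_whisk[OF b W gs \<eta> \<eta>' inv]
      Ide2_VComp[OF \<gamma>] Wb by simp
  from this[OF \<alpha>] this[OF \<beta>] eq show ?thesis by simp
qed

lemma whisk_ff:
  assumes eq: "equivalence D s" and s: "s \<in> hom D W Z"
    and a: "a \<in> hom D X W" and b: "b \<in> hom D X W" and \<gamma>: "\<gamma> \<in> cells D (s \<cdot> a) (s \<cdot> b)"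
  shows "\<exists>!\<alpha>. \<alpha> \<in> cells D a b \<and> Ide2 D s \<star> \<alpha> = \<gamma>"
proof -
  obtain g \<eta> \<epsilon> where g: "g \<in> hom D Z W"
    and \<eta>: "\<eta> \<in> cells D (Ide D W) (g \<cdot> s)" "invertible_cell D \<eta>"
    and \<epsilon>: "\<epsilon> \<in> cells D (s \<cdot> g) (Ide D Z)" "invertible_cell D \<epsilon>"
    using eq s unfolding equivalence_def hom_def by auto
  obtain \<eta>' where \<eta>': "\<eta>' \<in> cells D (g \<cdot> s) (Ide D W)"
    "\<eta>' \<bullet> \<eta> = Ide2 D (Ide D W)" "\<eta> \<bullet> \<eta>' = Ide2 D (g \<cdot> s)"
    using \<eta> unfolding invertible_cell_def by (auto simp: cells_def)
  obtain \<epsilon>' where \<epsilon>': "\<epsilon>' \<in> cells D (Ide D Z) (s \<cdot> g)" "\<epsilon> \<bullet> \<epsilon>' = Ide2 D (Ide D Z)"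
    using \<epsilon> unfolding invertible_cell_def by (auto simp: cells_def)
  have W: "Ide D W \<in> hom D W W" using hom_Obj[OF a] Ide_hom by blast
  have gs: "g \<cdot> s \<in> hom D W W" using Comp_hom[OF s g] .
  have sa: "s \<cdot> a \<in> hom D X Z" and sb: "s \<cdot> b \<in> hom D X Z" using Comp_hom a b s by blast+
  have gsa: "g \<cdot> s \<cdot> a \<in> hom D X W" and gsb: "g \<cdot> s \<cdot> b \<in> hom D X W" using Comp_hom sa sb g by blast+
  have Wx: "Ide D W \<cdot> x = x" if "x \<in> hom D X W" for x using Ide_Comp that by (auto simp: hom_def)
  have c1: "\<eta> \<star> Ide2 D x \<in> cells D x (g \<cdot> s \<cdot> x)" if x: "x \<in> hom D X W" for x
    using HComp_cells_hom[OF Ide2_cells_hom[OF x] \<eta>(1) x W] Wx[OF x] Comp_assoc[OF x s g] by simp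
  have c2: "\<eta>' \<star> Ide2 D x \<in> cells D (g \<cdot> s \<cdot> x) x" if x: "x \<in> hom D X W" for x
    using HComp_cells_hom[OF Ide2_cells_hom[OF x] \<eta>'(1) x gs] Wx[OF x] Comp_assoc[OF x s g] by simp
  have i1: "(\<eta>' \<star> Ide2 D x) \<bullet> (\<eta> \<star> Ide2 D x) = Ide2 D x" if x: "x \<in> hom D X W" for x
    using inv_unit_whisk[OF x W gs \<eta>(1) \<eta>'(1,2)] Wx[OF x] by simp
  have i2: "(\<eta> \<star> Ide2 D x) \<bullet> (\<eta>' \<star> Ide2 D x) = Ide2 D (g \<cdot> s \<cdot> x)" if x: "x \<in> hom D X W" for x
    using inv_unit_whisk[OF x gs W \<eta>'(1) \<eta>(1) \<eta>'(3)] Comp_assoc[OF x s g] by simp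
  have gc: "Ide2 D g \<star> \<gamma> \<in> cells D (g \<cdot> s \<cdot> a) (g \<cdot> s \<cdot> b)"
    using HComp_cells_hom[OF \<gamma> Ide2_cells_hom[OF g] sa g] .
  define \<delta> where "\<delta> = (Ide2 D g \<star> \<gamma>) \<bullet> (\<eta> \<star> Ide2 D a)"
  define \<alpha> where "\<alpha> = (\<eta>' \<star> Ide2 D b) \<bullet> \<delta>"
  have \<delta>: "\<delta> \<in> cells D a (g \<cdot> s \<cdot> b)" unfolding \<delta>_def using VComp_cells[OF c1[OF a] gc] .
  have \<alpha>: "\<alpha> \<in> cells D a b" unfolding \<alpha>_def using VComp_cells[OF \<delta> c2[OF b]] .
  have s\<alpha>: "Ide2 D s \<star> \<alpha> \<in> cells D (s \<cdot> a) (s \<cdot> b)"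
    using HComp_cells_hom[OF \<alpha> Ide2_cells_hom[OF s] a s] .
  have gs\<alpha>: "Ide2 D g \<star> (Ide2 D s \<star> \<alpha>) \<in> cells D (g \<cdot> s \<cdot> a) (g \<cdot> s \<cdot> b)"
    using HComp_cells_hom[OF s\<alpha> Ide2_cells_hom[OF g] sa g] .
  have e: "(Ide2 D g \<star> (Ide2 D s \<star> \<alpha>)) \<bullet> (\<eta> \<star> Ide2 D a) = (Ide2 D g \<star> \<gamma>) \<bullet> (\<eta> \<star> Ide2 D a)"
    using whisk_unit[OF s g \<eta>(1) a \<alpha>] VComp_assoc[OF \<delta> c2[OF b] c1[OF b]] i2[OF b] Ide2_VComp[OF \<delta>]
    by (simp add: \<alpha>_def \<delta>_def)
  have canc: "\<theta> = (\<theta> \<bullet> (\<eta> \<star> Ide2 D a)) \<bullet> (\<eta>' \<star> Ide2 D a)"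
    if \<theta>: "\<theta> \<in> cells D (g \<cdot> s \<cdot> a) (g \<cdot> s \<cdot> b)" for \<theta>
    using VComp_assoc[OF c2[OF a] c1[OF a] \<theta>] i2[OF a] VComp_Ide2[OF \<theta>] by simp
  have "Ide2 D g \<star> (Ide2 D s \<star> \<alpha>) = Ide2 D g \<star> \<gamma>"
    using canc[OF gs\<alpha>] canc[OF gc] e by metis
  then have "Ide2 D s \<star> \<alpha> = \<gamma>"
    using whisk_faithful[OF g s \<epsilon>'(1) \<epsilon>(1) \<epsilon>'(2) sa s\<alpha> \<gamma>] by simp
  moreover have "\<beta> = \<alpha>" if "\<beta> \<in> cells D a b" "Ide2 D s \<star> \<beta> = \<gamma>" for \<beta>
    using whisk_faithful[OF s g \<eta>(1) \<eta>'(1,2) a that(1) \<alpha>] that calculation by simp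
  ultimately show ?thesis using \<alpha> by blast
qed

end

lemma disc_simps [simp]:
  "Obj (disc A) = Obj A" "Arr (disc A) = Arr A" "Dom (disc A) = Dom A" "Cod (disc A) = Cod A"
  "Ide (disc A) = Ide A" "Comp (disc A) = Comp A" "Cell (disc A) = Arr A" "Src (disc A) = (\<lambda>f. f)"
  "Trg (disc A) = (\<lambda>f. f)" "Ide2 (disc A) = (\<lambda>f. f)"
  by (simp_all add: disc_def)

lemma functor_hom: "is_functor C D F \<Longrightarrow> f \<in> hom C X Y \<Longrightarrow> Far F f \<in> hom D (Fob F X) (Fob F Y)"
  by (auto simp: is_functor_def hom_def)

lemma functor_Comp: "is_functor C D F \<Longrightarrow> f \<in> hom C X Y \<Longrightarrow> g \<in> hom C Y Z
    \<Longrightarrow> Far F (g \<cdot>\<^bsub>C\<^esub> f) = Far F g \<cdot>\<^bsub>D\<^esub> Far F f"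
  by (auto simp: is_functor_def hom_def)

lemma two_functor_functor: "is_two_functor D E F \<Longrightarrow> is_functor D E F"
  by (simp add: is_two_functor_def)

lemma two_functor_cells: "is_two_functor D E F \<Longrightarrow> \<alpha> \<in> cells D f g
    \<Longrightarrow> Fce F \<alpha> \<in> cells E (Far F f) (Far F g)"
  by (auto simp: is_two_functor_def cells_def)

lemma is_functor_disc: "is_functor (disc A) D F = is_functor A D F"
  by (simp add: is_functor_def)

locale test_functor = two_category D
  for D :: "('p, 'b, 'd) two_cat" (structure) +
  fixes A :: "('o, 'a) cat" and \<Sigma> :: "'a set" and F :: "('o, 'a, 'a, 'p, 'b, 'd) two_fnctr"
  assumes F: "is_two_functor (disc A) D F" and inv: "inverts \<Sigma> D F"
begin

lemma F': "is_functor A D F"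
  using two_functor_functor[OF F] by (simp add: is_functor_disc)

lemmas Fhom = functor_hom[OF F'] and FComp = functor_Comp[OF F']

lemma hat_cyl_unique:
  assumes "is_cylinder A \<Sigma> X K"
  shows "\<exists>!\<alpha>. \<alpha> \<in> cells D (Far F (cd0 K)) (Far F (cd1 K)) \<and>
     Ide2 D (Far F (cs K)) \<star> \<alpha> = Ide2 D (Far F (cx K))"
proof -
  have h: "cd0 K \<in> hom A X (cW K)" "cd1 K \<in> hom A X (cW K)" "cs K \<in> hom A (cW K) (cZ K)"
    "cx K \<in> hom A X (cZ K)" "cs K \<in> \<Sigma>" "cs K \<cdot>\<^bsub>A\<^esub> cd0 K = cx K" "cs K \<cdot>\<^bsub>A\<^esub> cd1 K = cx K"
    using assms by (auto simp: is_cylinder_def)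
  show ?thesis
    using whisk_ff[OF _ Fhom[OF h(3)] Fhom[OF h(1)] Fhom[OF h(2)], of "Ide2 D (Far F (cx K))"]
      inv h(5) FComp[OF h(1,3)] FComp[OF h(2,3)] h(6,7) Ide2_cells_hom[OF Fhom[OF h(4)]]
    by (simp add: inverts_def)
qed

lemma hat_cyl:
  assumes "is_cylinder A \<Sigma> X K"
  shows "hat_cyl D F K \<in> cells D (Far F (cd0 K)) (Far F (cd1 K))"
    "Ide2 D (Far F (cs K)) \<star> hat_cyl D F K = Ide2 D (Far F (cx K))"
  using theI'[OF hat_cyl_unique[OF assms]] by (auto simp: hat_cyl_def)

lemma hat_cyl_eqI:
  assumes "is_cylinder A \<Sigma> X K" "\<alpha> \<in> cells D (Far F (cd0 K)) (Far F (cd1 K))"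
    "Ide2 D (Far F (cs K)) \<star> \<alpha> = Ide2 D (Far F (cx K))"
  shows "hat_cyl D F K = \<alpha>"
  using hat_cyl_unique[OF assms(1)] hat_cyl[OF assms(1)] assms(2,3) by auto

lemma hat_cells:
  assumes "is_homotopy A \<Sigma> f g H"
  shows "hat D F H \<in> cells D (Far F f) (Far F g)"
proof -
  obtain X Y where h: "is_cylinder A \<Sigma> X (fst H)" "snd H \<in> hom A (cW (fst H)) Y"
    "snd H \<cdot>\<^bsub>A\<^esub> cd0 (fst H) = f" "snd H \<cdot>\<^bsub>A\<^esub> cd1 (fst H) = g"
    using assms by (auto simp: is_homotopy_def)
  have d: "cd0 (fst H) \<in> hom A X (cW (fst H))" "cd1 (fst H) \<in> hom A X (cW (fst H))"
    using h(1) by (auto simp: is_cylinder_def)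
  show ?thesis
    using HComp_cells_hom[OF hat_cyl(1)[OF h(1)] Ide2_cells_hom[OF Fhom[OF h(2)]] Fhom[OF d(1)] Fhom[OF h(2)]]
      FComp[OF d(1) h(2)] FComp[OF d(2) h(2)] h(3,4) by (simp add: hat_def)
qed

lemma hat_seq_Cons: "Hs \<noteq> [] \<Longrightarrow> hat_seq D F (H # Hs) = hat D F H \<bullet> hat_seq D F Hs"
  by (cases Hs) auto

end

lemma homotopy_seq_ne: "homotopy_seq A \<Sigma> f g Hs \<Longrightarrow> Hs \<noteq> []"
  by (induction rule: homotopy_seq.induct) auto

lemma (in test_functor) hat_seq_cells:
  "homotopy_seq A \<Sigma> f g Hs \<Longrightarrow> hat_seq D F Hs \<in> cells D (Far F f) (Far F g)"
proof (induction rule: homotopy_seq.induct)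
  case (single g H)
  then show ?case using hat_cells by simp
next
  case (step g Hs h H)
  then show ?case using hat_seq_Cons[OF homotopy_seq_ne[OF step(1)]] hat_cells[OF step(2)]
      VComp_cells by simp
qed

text \<open>Postcomposing a test functor with a 2-functor \<open>G\<close> maps hats to hats.\<close>

locale test_functor_map = T: test_functor D A \<Sigma> F + T': test_functor D' A \<Sigma> F'
  for D :: "('p, 'b, 'd) two_cat" and A :: "('o, 'a) cat" and \<Sigma> F
    and D' :: "('q, 'e, 'h) two_cat" and F' +
  fixes G :: "('p, 'b, 'd, 'q, 'e, 'h) two_fnctr"
  assumes G: "is_two_functor D D' G" and GF: "\<And>f. f \<in> Arr A \<Longrightarrow> Far G (Far F f) = Far F' f"
begin

lemma hat_map:
  assumes "is_homotopy A \<Sigma> f g H"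
  shows "hat D' F' H = Fce G (hat D F H)"
proof -
  obtain X Y where h: "is_cylinder A \<Sigma> X (fst H)" "snd H \<in> hom A (cW (fst H)) Y"
    using assms by (auto simp: is_homotopy_def)
  let ?K = "fst H"
  have d: "cd0 ?K \<in> hom A X (cW ?K)" "cd1 ?K \<in> hom A X (cW ?K)" "cs ?K \<in> hom A (cW ?K) (cZ ?K)"
    "cx ?K \<in> hom A X (cZ ?K)"
    using h(1) by (auto simp: is_cylinder_def)
  have a: "cd0 ?K \<in> Arr A" "cd1 ?K \<in> Arr A" "cs ?K \<in> Arr A" "cx ?K \<in> Arr A" "snd H \<in> Arr A"
    using d h(2) by (auto simp: hom_def)
  have comp: "Fce G (Ide2 D (Far F r) \<star>\<^bsub>D\<^esub> hat_cyl D F ?K) = Ide2 D' (Far F' r) \<star>\<^bsub>D'\<^esub> Fce G (hat_cyl D F ?K)"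
    if r: "r \<in> hom A (cW ?K) Y" for r Y
  proof -
    have "Ide2 D (Far F r) \<in> cells D (Far F r) (Far F r)" "Far F r \<in> Arr D" "r \<in> Arr A"
      using T.Ide2_cells_hom[OF T.Fhom[OF r]] T.Fhom[OF r] r by (auto simp: hom_def)
    then show ?thesis
      using G T.hat_cyl(1)[OF h(1)] T.Fhom[OF r] T.Fhom[OF d(1)] GF
      by (auto simp: is_two_functor_def cells_def hom_def)
  qed
  have 1: "hat_cyl D' F' ?K = Fce G (hat_cyl D F ?K)"
  proof (rule T'.hat_cyl_eqI[OF h(1)])
    show "Fce G (hat_cyl D F ?K) \<in> cells D' (Far F' (cd0 ?K)) (Far F' (cd1 ?K))"
      using two_functor_cells[OF G T.hat_cyl(1)[OF h(1)]] GF a by simp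
    have "Fce G (Ide2 D (Far F (cx ?K))) = Ide2 D' (Far F' (cx ?K))"
      using G GF a T.Fhom[OF d(4)] by (auto simp: is_two_functor_def hom_def)
    then show "Ide2 D' (Far F' (cs ?K)) \<star>\<^bsub>D'\<^esub> Fce G (hat_cyl D F ?K) = Ide2 D' (Far F' (cx ?K))"
      using comp[OF d(3)] T.hat_cyl(2)[OF h(1)] by simp
  qed
  show ?thesis using comp[OF h(2)] 1 by (simp add: hat_def)
qed

lemma hat_seq_map: "homotopy_seq A \<Sigma> f g Hs \<Longrightarrow> hat_seq D' F' Hs = Fce G (hat_seq D F Hs)"
proof (induction rule: homotopy_seq.induct)
  case (single g H)
  then show ?case using hat_map by simp
next
  case (step g Hs h H)
  then show ?case
    using T.hat_seq_Cons[OF homotopy_seq_ne[OF step(1)]] T'.hat_seq_Cons[OF homotopy_seq_ne[OF step(1)]]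
      hat_map[OF step(2)] T.hat_cells[OF step(2)] T.hat_seq_cells[OF step(1)] G
    by (auto simp: is_two_functor_def cells_def)
qed

end

text \<open>A sub-2-category of \<open>D\<close>, copied along injections \<open>e\<^sub>0, e\<^sub>1, e\<^sub>2\<close> with left inverses \<open>k\<^sub>0, k\<^sub>1, k\<^sub>2\<close>.\<close>

locale sub_copy = two_category D
  for D :: "('p, 'b, 'd) two_cat" (structure) +
  fixes S0 :: "'p set" and S1 :: "'b set" and S2 :: "'d set"
    and e0 :: "'p \<Rightarrow> 'o" and e1 :: "'b \<Rightarrow> 'r" and e2 :: "'d \<Rightarrow> 'c"
    and k0 :: "'o \<Rightarrow> 'p" and k1 :: "'r \<Rightarrow> 'b" and k2 :: "'c \<Rightarrow> 'd"
  assumes ke [simp]: "X \<in> S0 \<Longrightarrow> k0 (e0 X) = X" "f \<in> S1 \<Longrightarrow> k1 (e1 f) = f" "\<alpha> \<in> S2 \<Longrightarrow> k2 (e2 \<alpha>) = \<alpha>"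
    and sub: "X \<in> S0 \<Longrightarrow> X \<in> Obj D" "f \<in> S1 \<Longrightarrow> f \<in> Arr D" "\<alpha> \<in> S2 \<Longrightarrow> \<alpha> \<in> Cell D"
    and cl [simp]: "f \<in> S1 \<Longrightarrow> Dom D f \<in> S0" "f \<in> S1 \<Longrightarrow> Cod D f \<in> S0" "X \<in> S0 \<Longrightarrow> Ide D X \<in> S1"
      "f \<in> S1 \<Longrightarrow> g \<in> S1 \<Longrightarrow> Dom D g = Cod D f \<Longrightarrow> g \<cdot> f \<in> S1"
      "\<alpha> \<in> S2 \<Longrightarrow> Src D \<alpha> \<in> S1" "\<alpha> \<in> S2 \<Longrightarrow> Trg D \<alpha> \<in> S1" "f \<in> S1 \<Longrightarrow> Ide2 D f \<in> S2"
      "\<alpha> \<in> S2 \<Longrightarrow> \<beta> \<in> S2 \<Longrightarrow> Src D \<beta> = Trg D \<alpha> \<Longrightarrow> \<beta> \<bullet> \<alpha> \<in> S2"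
      "\<alpha> \<in> S2 \<Longrightarrow> \<beta> \<in> S2 \<Longrightarrow> Dom D (Src D \<beta>) = Cod D (Src D \<alpha>) \<Longrightarrow> \<beta> \<star> \<alpha> \<in> S2"
begin

definition copy :: "('o, 'r, 'c) two_cat" where
  "copy = \<lparr>Obj = e0 ` S0, Arr = e1 ` S1, Dom = (\<lambda>f. e0 (Dom D (k1 f))), Cod = (\<lambda>f. e0 (Cod D (k1 f))),
     Ide = (\<lambda>X. e1 (Ide D (k0 X))), Comp = (\<lambda>g f. e1 (k1 g \<cdot> k1 f)),
     Cell = e2 ` S2, Src = (\<lambda>\<alpha>. e1 (Src D (k2 \<alpha>))), Trg = (\<lambda>\<alpha>. e1 (Trg D (k2 \<alpha>))),
     Ide2 = (\<lambda>f. e2 (Ide2 D (k1 f))), VComp = (\<lambda>\<beta> \<alpha>. e2 (k2 \<beta> \<bullet> k2 \<alpha>)),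
     HComp = (\<lambda>\<beta> \<alpha>. e2 (k2 \<beta> \<star> k2 \<alpha>))\<rparr>"

definition copy_incl :: "('o, 'r, 'c, 'p, 'b, 'd) two_fnctr" where
  "copy_incl = \<lparr>Fob = restrict k0 (e0 ` S0), Far = restrict k1 (e1 ` S1), Fce = restrict k2 (e2 ` S2)\<rparr>"

lemma e_inj [simp]:
  "X \<in> S0 \<Longrightarrow> Y \<in> S0 \<Longrightarrow> e0 X = e0 Y \<longleftrightarrow> X = Y"
  "f \<in> S1 \<Longrightarrow> g \<in> S1 \<Longrightarrow> e1 f = e1 g \<longleftrightarrow> f = g"
  "\<alpha> \<in> S2 \<Longrightarrow> \<beta> \<in> S2 \<Longrightarrow> e2 \<alpha> = e2 \<beta> \<longleftrightarrow> \<alpha> = \<beta>"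
  using ke by metis+

lemma par: "\<alpha> \<in> S2 \<Longrightarrow> Dom D (Trg D \<alpha>) = Dom D (Src D \<alpha>) \<and> Cod D (Trg D \<alpha>) = Cod D (Src D \<alpha>)"
  using Src_Trg sub by (fastforce simp: hom_def)

lemma IdeD [simp]: "X \<in> S0 \<Longrightarrow> Dom D (Ide D X) = X" "X \<in> S0 \<Longrightarrow> Cod D (Ide D X) = X"
  using Ide_hom sub by (auto simp: hom_def)

lemma CompD [simp]: "f \<in> S1 \<Longrightarrow> g \<in> S1 \<Longrightarrow> Dom D g = Cod D f \<Longrightarrow> Dom D (g \<cdot> f) = Dom D f"
  "f \<in> S1 \<Longrightarrow> g \<in> S1 \<Longrightarrow> Dom D g = Cod D f \<Longrightarrow> Cod D (g \<cdot> f) = Cod D g"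
  using Comp_hom sub by (auto simp: hom_def)

lemma Ide2D [simp]: "f \<in> S1 \<Longrightarrow> Src D (Ide2 D f) = f" "f \<in> S1 \<Longrightarrow> Trg D (Ide2 D f) = f"
  using Ide2_cells sub by (auto simp: cells_def)

lemma VCompD [simp]: "\<alpha> \<in> S2 \<Longrightarrow> \<beta> \<in> S2 \<Longrightarrow> Src D \<beta> = Trg D \<alpha> \<Longrightarrow> Src D (\<beta> \<bullet> \<alpha>) = Src D \<alpha>"
  "\<alpha> \<in> S2 \<Longrightarrow> \<beta> \<in> S2 \<Longrightarrow> Src D \<beta> = Trg D \<alpha> \<Longrightarrow> Trg D (\<beta> \<bullet> \<alpha>) = Trg D \<beta>"
  using VComp_cells sub by (auto simp: cells_def)

lemma HCompD [simp]: "\<alpha> \<in> S2 \<Longrightarrow> \<beta> \<in> S2 \<Longrightarrow> Dom D (Src D \<beta>) = Cod D (Src D \<alpha>)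
    \<Longrightarrow> Src D (\<beta> \<star> \<alpha>) = Src D \<beta> \<cdot> Src D \<alpha>"
  "\<alpha> \<in> S2 \<Longrightarrow> \<beta> \<in> S2 \<Longrightarrow> Dom D (Src D \<beta>) = Cod D (Src D \<alpha>)
    \<Longrightarrow> Trg D (\<beta> \<star> \<alpha>) = Trg D \<beta> \<cdot> Trg D \<alpha>"
  using HComp_cells sub by (auto simp: cells_def)

lemma two_category_copy: "two_category copy"
proof unfold_locales
  fix f' assume "f' \<in> Arr copy"
  then obtain f where f: "f \<in> S1" "f' = e1 f" by (auto simp: copy_def)
  show "Dom copy f' \<in> Obj copy" "Cod copy f' \<in> Obj copy" "Ide2 copy f' \<in> cells copy f' f'"
    "f' \<cdot>\<^bsub>copy\<^esub> Ide copy (Dom copy f') = f'" "Ide copy (Cod copy f') \<cdot>\<^bsub>copy\<^esub> f' = f'"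
    using f Comp_Ide Ide_Comp sub by (auto simp: copy_def cells_def)
next
  fix X' assume "X' \<in> Obj copy"
  then show "Ide copy X' \<in> hom copy X' X'" by (auto simp: copy_def hom_def)
next
  fix f' g' X' Y' Z'
  assume "f' \<in> hom copy X' Y'" "g' \<in> hom copy Y' Z'"
  then show "g' \<cdot>\<^bsub>copy\<^esub> f' \<in> hom copy X' Z'" "Ide2 copy g' \<star>\<^bsub>copy\<^esub> Ide2 copy f' = Ide2 copy (g' \<cdot>\<^bsub>copy\<^esub> f')"
    using HComp_Ide2[of _ "Dom D _" "Cod D _" _ "Cod D _"] sub by (auto simp: copy_def hom_def)
next
  fix f' g' h' X' Y' Z' T'
  assume "f' \<in> hom copy X' Y'" "g' \<in> hom copy Y' Z'" "h' \<in> hom copy Z' T'"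
  then show "h' \<cdot>\<^bsub>copy\<^esub> g' \<cdot>\<^bsub>copy\<^esub> f' = (h' \<cdot>\<^bsub>copy\<^esub> g') \<cdot>\<^bsub>copy\<^esub> f'"
    using Comp_assoc sub by (auto simp: copy_def hom_def)
next
  fix \<alpha>' assume "\<alpha>' \<in> Cell copy"
  then show "\<exists>X Y. Src copy \<alpha>' \<in> hom copy X Y \<and> Trg copy \<alpha>' \<in> hom copy X Y"
    using par by (auto simp: copy_def hom_def)
next
  fix \<alpha>' f' g' assume a: "\<alpha>' \<in> cells copy f' g'"
  show "\<alpha>' \<bullet>\<^bsub>copy\<^esub> Ide2 copy f' = \<alpha>'" "Ide2 copy g' \<bullet>\<^bsub>copy\<^esub> \<alpha>' = \<alpha>'"
    "\<alpha>' \<star>\<^bsub>copy\<^esub> Ide2 copy (Ide copy (Dom copy f')) = \<alpha>'"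
    "Ide2 copy (Ide copy (Cod copy f')) \<star>\<^bsub>copy\<^esub> \<alpha>' = \<alpha>'"
    using a VComp_Ide2 Ide2_VComp HComp_Ide Ide_HComp sub par by (auto simp: copy_def cells_def)
next
  fix \<alpha>' f' g' \<beta>' h' assume "\<alpha>' \<in> cells copy f' g'" "\<beta>' \<in> cells copy g' h'"
  then show "\<beta>' \<bullet>\<^bsub>copy\<^esub> \<alpha>' \<in> cells copy f' h'"
    by (auto simp: copy_def cells_def)
next
  fix \<alpha>' f' g' \<beta>' h' \<gamma>' k'
  assume "\<alpha>' \<in> cells copy f' g'" "\<beta>' \<in> cells copy g' h'" "\<gamma>' \<in> cells copy h' k'"
  then show "\<gamma>' \<bullet>\<^bsub>copy\<^esub> \<beta>' \<bullet>\<^bsub>copy\<^esub> \<alpha>' = (\<gamma>' \<bullet>\<^bsub>copy\<^esub> \<beta>') \<bullet>\<^bsub>copy\<^esub> \<alpha>'"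
    using VComp_assoc sub by (auto simp: copy_def cells_def)
next
  fix \<alpha>' f' g' \<beta>' h' k'
  assume "\<alpha>' \<in> cells copy f' g'" "\<beta>' \<in> cells copy h' k'" "Cod copy f' = Dom copy h'"
  then show "\<beta>' \<star>\<^bsub>copy\<^esub> \<alpha>' \<in> cells copy (h' \<cdot>\<^bsub>copy\<^esub> f') (k' \<cdot>\<^bsub>copy\<^esub> g')"
    using par by (auto simp: copy_def cells_def)
next
  fix \<alpha>' f' f2' \<beta>' g' g2' \<gamma>' h' h2'
  assume "\<alpha>' \<in> cells copy f' f2'" "\<beta>' \<in> cells copy g' g2'" "\<gamma>' \<in> cells copy h' h2'"
    "Cod copy f' = Dom copy g'" "Cod copy g' = Dom copy h'"
  then show "\<gamma>' \<star>\<^bsub>copy\<^esub> \<beta>' \<star>\<^bsub>copy\<^esub> \<alpha>' = (\<gamma>' \<star>\<^bsub>copy\<^esub> \<beta>') \<star>\<^bsub>copy\<^esub> \<alpha>'"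
    using HComp_assoc sub by (auto simp: copy_def cells_def)
next
  fix \<alpha>' f' f2' \<beta>' f3' \<gamma>' g' g2' \<delta>' g3'
  assume "\<alpha>' \<in> cells copy f' f2'" "\<beta>' \<in> cells copy f2' f3'" "\<gamma>' \<in> cells copy g' g2'"
    "\<delta>' \<in> cells copy g2' g3'" "Cod copy f' = Dom copy g'"
  then show "(\<delta>' \<bullet>\<^bsub>copy\<^esub> \<gamma>') \<star>\<^bsub>copy\<^esub> (\<beta>' \<bullet>\<^bsub>copy\<^esub> \<alpha>') = (\<delta>' \<star>\<^bsub>copy\<^esub> \<beta>') \<bullet>\<^bsub>copy\<^esub> (\<gamma>' \<star>\<^bsub>copy\<^esub> \<alpha>')"
    using interchange sub par by (auto simp: copy_def cells_def)
qed

lemma copy_incl_two_functor: "is_two_functor copy D copy_incl"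
  using sub by (auto simp: is_two_functor_def is_functor_def copy_def copy_incl_def PiE_iff)

end

locale generated = test_functor D A \<Sigma> F + A: category A
  for D :: "('p, 'b, 'd) two_cat" (structure) and A :: "('o, 'a) cat" and \<Sigma> F +
  fixes q :: "'a \<Rightarrow> 'b" and un un' co co' :: "'a \<Rightarrow> 'd"
  assumes \<Sigma>: "\<Sigma> \<subseteq> Arr A"
    and q: "s \<in> \<Sigma> \<Longrightarrow> q s \<in> hom D (Cod D (Far F s)) (Dom D (Far F s))"
    and un: "s \<in> \<Sigma> \<Longrightarrow> un s \<in> cells D (Ide D (Dom D (Far F s))) (q s \<cdot> Far F s)"
    and un': "s \<in> \<Sigma> \<Longrightarrow> un' s \<in> cells D (q s \<cdot> Far F s) (Ide D (Dom D (Far F s)))"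
    and co: "s \<in> \<Sigma> \<Longrightarrow> co s \<in> cells D (Far F s \<cdot> q s) (Ide D (Cod D (Far F s)))"
    and co': "s \<in> \<Sigma> \<Longrightarrow> co' s \<in> cells D (Ide D (Cod D (Far F s))) (Far F s \<cdot> q s)"
    and un_inv: "s \<in> \<Sigma> \<Longrightarrow> un' s \<bullet> un s = Ide2 D (Ide D (Dom D (Far F s)))"
      "s \<in> \<Sigma> \<Longrightarrow> un s \<bullet> un' s = Ide2 D (q s \<cdot> Far F s)"
    and co_inv: "s \<in> \<Sigma> \<Longrightarrow> co' s \<bullet> co s = Ide2 D (Far F s \<cdot> q s)"
      "s \<in> \<Sigma> \<Longrightarrow> co s \<bullet> co' s = Ide2 D (Ide D (Cod D (Far F s)))"
begin

primrec ev1 :: "'a arr_word \<Rightarrow> 'b" where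
  "ev1 (AGen f) = Far F f"
| "ev1 (AInv s) = q s"
| "ev1 (AComp w v) = ev1 w \<cdot> ev1 v"

primrec ev2 :: "'a cell_word \<Rightarrow> 'd" where
  "ev2 (CUnit s) = un s"
| "ev2 (CUnitInv s) = un' s"
| "ev2 (CCounit s) = co s"
| "ev2 (CCounitInv s) = co' s"
| "ev2 (CIde w) = Ide2 D (ev1 w)"
| "ev2 (CVComp w v) = ev2 w \<bullet> ev2 v"
| "ev2 (CHComp w v) = ev2 w \<star> ev2 v"

inductive_set S1 :: "'b set" where
  S1_gen: "f \<in> Arr A \<Longrightarrow> Far F f \<in> S1"
| S1_inv: "s \<in> \<Sigma> \<Longrightarrow> q s \<in> S1"
| S1_comp: "f \<in> S1 \<Longrightarrow> g \<in> S1 \<Longrightarrow> Dom D g = Cod D f \<Longrightarrow> g \<cdot> f \<in> S1"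

inductive_set S2 :: "'d set" where
  S2_un: "s \<in> \<Sigma> \<Longrightarrow> un s \<in> S2"
| S2_un': "s \<in> \<Sigma> \<Longrightarrow> un' s \<in> S2"
| S2_co: "s \<in> \<Sigma> \<Longrightarrow> co s \<in> S2"
| S2_co': "s \<in> \<Sigma> \<Longrightarrow> co' s \<in> S2"
| S2_ide: "f \<in> S1 \<Longrightarrow> Ide2 D f \<in> S2"
| S2_vcomp: "\<alpha> \<in> S2 \<Longrightarrow> \<beta> \<in> S2 \<Longrightarrow> Src D \<beta> = Trg D \<alpha> \<Longrightarrow> \<beta> \<bullet> \<alpha> \<in> S2"
| S2_hcomp: "\<alpha> \<in> S2 \<Longrightarrow> \<beta> \<in> S2 \<Longrightarrow> Dom D (Src D \<beta>) = Cod D (Src D \<alpha>) \<Longrightarrow> \<beta> \<star> \<alpha> \<in> S2"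

lemma S1_ev: "f \<in> S1 \<Longrightarrow> f \<in> range ev1"
proof (induction rule: S1.induct)
  case (S1_gen f) then show ?case by (metis ev1.simps(1) rangeI)
next
  case (S1_inv s) then show ?case by (metis ev1.simps(2) rangeI)
next
  case (S1_comp f g)
  then obtain v w where "f = ev1 v" "g = ev1 w" by blast
  then have "g \<cdot> f = ev1 (AComp w v)" by simp
  then show ?case by blast
qed

lemma S2_ev: "\<alpha> \<in> S2 \<Longrightarrow> \<alpha> \<in> range ev2"
proof (induction rule: S2.induct)
  case (S2_un s) then show ?case by (metis ev2.simps(1) rangeI)
next
  case (S2_un' s) then show ?case by (metis ev2.simps(2) rangeI)
next
  case (S2_co s) then show ?case by (metis ev2.simps(3) rangeI)
next
  case (S2_co' s) then show ?case by (metis ev2.simps(4) rangeI)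
next
  case (S2_ide f)
  then obtain w where "f = ev1 w" using S1_ev by blast
  then show ?case by (metis ev2.simps(5) rangeI)
next
  case (S2_vcomp \<alpha> \<beta>)
  then obtain v w where "\<alpha> = ev2 v" "\<beta> = ev2 w" by blast
  then have "\<beta> \<bullet> \<alpha> = ev2 (CVComp w v)" by simp
  then show ?case by blast
next
  case (S2_hcomp \<alpha> \<beta>)
  then obtain v w where "\<alpha> = ev2 v" "\<beta> = ev2 w" by blast
  then have "\<beta> \<star> \<alpha> = ev2 (CHComp w v)" by simp
  then show ?case by blast
qed

lemma F_Arr: "f \<in> Arr A \<Longrightarrow> Far F f \<in> Arr D \<and> Dom D (Far F f) = Fob F (Dom A f) \<and> Cod D (Far F f) = Fob F (Cod A f)"
  using F' by (auto simp: is_functor_def)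

lemma S1_Arr: "f \<in> S1 \<Longrightarrow> f \<in> Arr D \<and> Dom D f \<in> Fob F ` Obj A \<and> Cod D f \<in> Fob F ` Obj A"
proof (induction rule: S1.induct)
  case (S1_gen f) then show ?case using F_Arr A.Dom_Obj A.Cod_Obj by auto
next
  case (S1_inv s)
  then have "s \<in> Arr A" using \<Sigma> by blast
  then show ?case using q[OF S1_inv] F_Arr A.Dom_Obj A.Cod_Obj by (auto simp: hom_def)
next
  case (S1_comp f g)
  then show ?case using Comp_hom[of f "Dom D f" "Cod D f" g "Cod D g"] by (auto simp: hom_def)
qed

lemma S1_Ide: "X \<in> Fob F ` Obj A \<Longrightarrow> Ide D X \<in> S1"
proof -
  assume "X \<in> Fob F ` Obj A"
  then obtain Y where Y: "Y \<in> Obj A" "X = Fob F Y" by blast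
  then have "Far F (Ide A Y) = Ide D X" using F' by (auto simp: is_functor_def)
  then show ?thesis using S1_gen[of "Ide A Y"] A.Ide_hom[OF Y(1)] by (auto simp: hom_def)
qed

lemma S1_unit:
  assumes "s \<in> \<Sigma>"
  shows "Ide D (Dom D (Far F s)) \<in> S1" "Ide D (Cod D (Far F s)) \<in> S1"
    "q s \<cdot> Far F s \<in> S1" "Far F s \<cdot> q s \<in> S1"
proof -
  have s: "Far F s \<in> S1" using assms \<Sigma> S1_gen by blast
  show "Ide D (Dom D (Far F s)) \<in> S1" "Ide D (Cod D (Far F s)) \<in> S1"
    using S1_Ide S1_Arr[OF s] by blast+
  show "q s \<cdot> Far F s \<in> S1" "Far F s \<cdot> q s \<in> S1"
    using q[OF assms] S1_comp[OF s S1_inv[OF assms]] S1_comp[OF S1_inv[OF assms] s]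
    by (auto simp: hom_def)
qed

lemma S2_Cell: "\<alpha> \<in> S2 \<Longrightarrow> \<alpha> \<in> Cell D \<and> Src D \<alpha> \<in> S1 \<and> Trg D \<alpha> \<in> S1"
proof (induction rule: S2.induct)
  case (S2_un s) then show ?case using un S1_unit by (auto simp: cells_def)
next
  case (S2_un' s) then show ?case using un' S1_unit by (auto simp: cells_def)
next
  case (S2_co s) then show ?case using co S1_unit by (auto simp: cells_def)
next
  case (S2_co' s) then show ?case using co' S1_unit by (auto simp: cells_def)
next
  case (S2_ide f) then show ?case using Ide2_cells S1_Arr by (auto simp: cells_def)
next
  case (S2_vcomp \<alpha> \<beta>)
  then show ?case using VComp_cells[of \<alpha> "Src D \<alpha>" "Trg D \<alpha>" \<beta> "Trg D \<beta>"] by (auto simp: cells_def)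
next
  case (S2_hcomp \<alpha> \<beta>)
  have "Dom D (Trg D \<beta>) = Cod D (Trg D \<alpha>)"
    using Src_Trg[of \<alpha>] Src_Trg[of \<beta>] S2_hcomp by (auto simp: hom_def)
  then show ?case
    using HComp_cells[of \<alpha> "Src D \<alpha>" "Trg D \<alpha>" \<beta> "Src D \<beta>" "Trg D \<beta>"] S2_hcomp S1_comp
    by (auto simp: cells_def)
qed

sublocale sub_copy D "Fob F ` Obj A" S1 S2 "inv_into (Obj A) (Fob F)" "inv_into UNIV ev1" "inv_into UNIV ev2"
  "Fob F" ev1 ev2
proof unfold_locales
  fix X assume "X \<in> Fob F ` Obj A"
  then show "Fob F (inv_into (Obj A) (Fob F) X) = X" "X \<in> Obj D" "Ide D X \<in> S1"
    using F' S1_Ide by (auto simp: f_inv_into_f is_functor_def)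
next
  fix f assume "f \<in> S1"
  then show "ev1 (inv_into UNIV ev1 f) = f" "f \<in> Arr D" "Dom D f \<in> Fob F ` Obj A"
    "Cod D f \<in> Fob F ` Obj A" "Ide2 D f \<in> S2"
    using S1_ev S1_Arr S2_ide by (simp_all add: f_inv_into_f)
next
  fix \<alpha> assume "\<alpha> \<in> S2"
  then show "ev2 (inv_into UNIV ev2 \<alpha>) = \<alpha>" "\<alpha> \<in> Cell D" "Src D \<alpha> \<in> S1" "Trg D \<alpha> \<in> S1"
    using S2_ev S2_Cell by (simp_all add: f_inv_into_f)
qed (auto intro: S1_comp S2_vcomp S2_hcomp)

abbreviation "e0 \<equiv> inv_into (Obj A) (Fob F)"
abbreviation "e1 \<equiv> inv_into UNIV ev1"
abbreviation "e2 \<equiv> inv_into UNIV ev2"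

definition F_copy :: "('o, 'a, 'a, 'o, 'a arr_word, 'a cell_word) two_fnctr" where
  "F_copy = \<lparr>Fob = (\<lambda>X \<in> Obj A. e0 (Fob F X)), Far = (\<lambda>f \<in> Arr A. e1 (Far F f)),
     Fce = (\<lambda>f \<in> Arr A. e2 (Ide2 D (Far F f)))\<rparr>"

lemma F_copy_two_functor: "is_two_functor (disc A) copy F_copy"
proof -
  have 1: "g \<cdot>\<^bsub>A\<^esub> f \<in> Arr A" "Far F (g \<cdot>\<^bsub>A\<^esub> f) = Far F g \<cdot> Far F f"
    "Ide2 D (Far F (g \<cdot>\<^bsub>A\<^esub> f)) = Ide2 D (Far F g) \<star> Ide2 D (Far F f)"
    if "f \<in> Arr A" "g \<in> Arr A" "Dom A g = Cod A f" for f g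
  proof -
    have h: "f \<in> hom A (Dom A f) (Cod A f)" "g \<in> hom A (Cod A f) (Cod A g)"
      using that by (auto simp: hom_def)
    show "g \<cdot>\<^bsub>A\<^esub> f \<in> Arr A" using A.Comp_hom[OF h] by (simp add: hom_def)
    show c: "Far F (g \<cdot>\<^bsub>A\<^esub> f) = Far F g \<cdot> Far F f" by (rule FComp[OF h])
    show "Ide2 D (Far F (g \<cdot>\<^bsub>A\<^esub> f)) = Ide2 D (Far F g) \<star> Ide2 D (Far F f)"
      using HComp_Ide2[OF Fhom[OF h(1)] Fhom[OF h(2)]] c by simp
  qed
  have 2: "Ide A X \<in> Arr A" "Far F (Ide A X) = Ide D (Fob F X)" if "X \<in> Obj A" for X
    using A.Ide_hom[OF that] F' that by (auto simp: hom_def is_functor_def)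
  have 3: "Far F f \<in> S1" "Far F f \<in> Arr D" "Ide2 D (Far F f) \<in> S2" "Dom A f \<in> Obj A" "Cod A f \<in> Obj A"
     "Ide2 D (Far F f) \<bullet> Ide2 D (Far F f) = Ide2 D (Far F f)"
    if "f \<in> Arr A" for f
    using S1_gen[OF that] F_Arr[OF that] S2_ide A.Dom_Obj[OF that] A.Cod_Obj[OF that]
      VComp_Ide2[OF Ide2_cells] by auto
  show ?thesis
    unfolding is_two_functor_def is_functor_def F_copy_def copy_def
    using 1 2 3 F_Arr by (auto simp: PiE_iff disc_def)
qed

lemma F_copy_inverts: "inverts \<Sigma> copy F_copy"
  unfolding inverts_def
proof
  fix s assume s: "s \<in> \<Sigma>"
  then have sA: "s \<in> Arr A" using \<Sigma> by blast
  note S = S1_gen[OF sA] S1_inv[OF s] S1_unit[OF s]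
  have qD: "Dom D (q s) = Cod D (Far F s)" "Cod D (q s) = Dom D (Far F s)"
    using q[OF s] by (auto simp: hom_def)
  have Fs: "Far F_copy s = e1 (Far F s)" using sA by (simp add: F_copy_def)
  note d = un[OF s] un'[OF s] co[OF s] co'[OF s]
  note d' = d[THEN cellsD]
  note T = S2_un[OF s] S2_un'[OF s] S2_co[OF s] S2_co'[OF s]
  have g: "e1 (q s) \<in> hom copy (Cod copy (Far F_copy s)) (Dom copy (Far F_copy s))"
    using S Fs qD by (simp add: copy_def hom_def)
  have u: "e2 (un s) \<in> cells copy (Ide copy (Dom copy (Far F_copy s))) (e1 (q s) \<cdot>\<^bsub>copy\<^esub> Far F_copy s)"
    "invertible_cell copy (e2 (un s))"
    using S Fs qD T d' un_inv[OF s]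
    by (auto simp: copy_def cells_def invertible_cell_def intro!: bexI[of _ "e2 (un' s)"])
  have c: "e2 (co s) \<in> cells copy (Far F_copy s \<cdot>\<^bsub>copy\<^esub> e1 (q s)) (Ide copy (Cod copy (Far F_copy s)))"
    "invertible_cell copy (e2 (co s))"
    using S Fs qD T d' co_inv[OF s]
    by (auto simp: copy_def cells_def invertible_cell_def intro!: bexI[of _ "e2 (co' s)"])
  have "Far F_copy s \<in> Arr copy" using S Fs by (simp add: copy_def)
  then show "equivalence copy (Far F_copy s)"
    unfolding equivalence_def using g u c by blast
qed

lemma hat_seq_eq:
  assumes "homotopy_eq A \<Sigma> Hs Ks"
  shows "hat_seq D F Hs = hat_seq D F Ks"
proof -
  interpret test_functor copy A \<Sigma> F_copy
    by (intro test_functor.intro test_functor_axioms.intro two_category_copy F_copy_two_functor F_copy_inverts)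
  interpret M: test_functor_map copy A \<Sigma> F_copy D F copy_incl
  proof unfold_locales
    show "is_two_functor copy D copy_incl" by (rule copy_incl_two_functor)
    show "Far copy_incl (Far F_copy f) = Far F f" if "f \<in> Arr A" for f
      using S1_gen[OF that] that by (simp add: copy_incl_def F_copy_def)
  qed
  obtain f g where h: "homotopy_seq A \<Sigma> f g Hs" "homotopy_seq A \<Sigma> f g Ks"
    and eq: "hat_seq copy F_copy Hs = hat_seq copy F_copy Ks"
    using assms two_category_copy F_copy_two_functor F_copy_inverts by (auto simp: homotopy_eq_def)
  show ?thesis using M.hat_seq_map[OF h(1)] M.hat_seq_map[OF h(2)] eq by simp
qed

end

theorem homotopy_eq_universal:
  fixes A :: "('o, 'a) cat" and D :: "('p, 'b, 'd) two_cat"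
  assumes "category A" "\<Sigma> \<subseteq> Arr A" and eq: "homotopy_eq A \<Sigma> Hs Ks"
    and D: "two_category D" and F: "is_two_functor (disc A) D F" "inverts \<Sigma> D F"
  shows "hat_seq D F Hs = hat_seq D F Ks"
proof -
  define P where "P s g u u' c c' \<longleftrightarrow> g \<in> hom D (Cod D s) (Dom D s) \<and>
    u \<in> cells D (Ide D (Dom D s)) (g \<cdot>\<^bsub>D\<^esub> s) \<and> u' \<in> cells D (g \<cdot>\<^bsub>D\<^esub> s) (Ide D (Dom D s)) \<and>
    c \<in> cells D (s \<cdot>\<^bsub>D\<^esub> g) (Ide D (Cod D s)) \<and> c' \<in> cells D (Ide D (Cod D s)) (s \<cdot>\<^bsub>D\<^esub> g) \<and>
    u' \<bullet>\<^bsub>D\<^esub> u = Ide2 D (Ide D (Dom D s)) \<and> u \<bullet>\<^bsub>D\<^esub> u' = Ide2 D (g \<cdot>\<^bsub>D\<^esub> s) \<and>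
    c' \<bullet>\<^bsub>D\<^esub> c = Ide2 D (s \<cdot>\<^bsub>D\<^esub> g) \<and> c \<bullet>\<^bsub>D\<^esub> c' = Ide2 D (Ide D (Cod D s))" for s g u u' c c'
  have "\<exists>g u u' c c'. P s g u u' c c'" if eqv: "equivalence D s" for s
  proof -
    obtain g u c where g: "g \<in> hom D (Cod D s) (Dom D s)"
      and u: "u \<in> cells D (Ide D (Dom D s)) (g \<cdot>\<^bsub>D\<^esub> s)" "invertible_cell D u"
      and c: "c \<in> cells D (s \<cdot>\<^bsub>D\<^esub> g) (Ide D (Cod D s))" "invertible_cell D c"
      using eqv by (auto simp: equivalence_def)
    have "P s g u u' c c'" if "u' \<in> cells D (Trg D u) (Src D u)" "u' \<bullet>\<^bsub>D\<^esub> u = Ide2 D (Src D u)"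
      "u \<bullet>\<^bsub>D\<^esub> u' = Ide2 D (Trg D u)" "c' \<in> cells D (Trg D c) (Src D c)" "c' \<bullet>\<^bsub>D\<^esub> c = Ide2 D (Src D c)"
      "c \<bullet>\<^bsub>D\<^esub> c' = Ide2 D (Trg D c)" for u' c'
      using that g u(1) c(1) cellsD[OF u(1)] cellsD[OF c(1)] by (simp add: P_def)
    then show ?thesis using u(2) c(2) unfolding invertible_cell_def by meson
  qed
  then have "\<forall>s\<in>\<Sigma>. \<exists>x. case x of (g, u, u', c, c') \<Rightarrow> P (Far F s) g u u' c c'"
    using F(2) unfolding inverts_def by (metis (mono_tags, lifting) case_prod_conv)
  then obtain x where x: "\<And>s. s \<in> \<Sigma> \<Longrightarrow> case x s of (g, u, u', c, c') \<Rightarrow> P (Far F s) g u u' c c'"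
    by metis
  define q un un' co co' where "q = fst \<circ> x" and "un = fst \<circ> snd \<circ> x" and "un' = fst \<circ> snd \<circ> snd \<circ> x"
    and "co = fst \<circ> snd \<circ> snd \<circ> snd \<circ> x" and "co' = snd \<circ> snd \<circ> snd \<circ> snd \<circ> x"
  have Ps: "P (Far F s) (q s) (un s) (un' s) (co s) (co' s)" if "s \<in> \<Sigma>" for s
    using x[OF that] by (simp add: q_def un_def un'_def co_def co'_def split: prod.splits)
  interpret category A by fact
  interpret two_category D by fact
  interpret generated D A \<Sigma> F q un un' co co'
    by unfold_locales (use assms(2) F Ps in \<open>auto simp: P_def\<close>)
  show ?thesis by (rule hat_seq_eq[OF eq])
qed

section \<open>The homotopy 2-category is a 2-category\<close>

lemma homotopy_unique:
  "is_homotopy A \<Sigma> f g H \<Longrightarrow> is_homotopy A \<Sigma> f' g' H \<Longrightarrow> f = f' \<and> g = g'"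
  by (auto simp: is_homotopy_def)

lemma homotopy_seq_unique:
  "homotopy_seq A \<Sigma> f g Hs \<Longrightarrow> homotopy_seq A \<Sigma> f' g' Hs \<Longrightarrow> f = f' \<and> g = g'"
proof (induction arbitrary: g' rule: homotopy_seq.induct)
  case (single g H)
  from single.prems have "is_homotopy A \<Sigma> f' g' H"
    by (cases rule: homotopy_seq.cases) (auto dest: homotopy_seq_ne)
  then show ?case using homotopy_unique[OF single.hyps] by blast
next
  case (step g Hs h H)
  from step.prems obtain k where "homotopy_seq A \<Sigma> f' k Hs" "is_homotopy A \<Sigma> k g' H"
    by (cases rule: homotopy_seq.cases) (use homotopy_seq_ne[OF step(1)] in auto)
  then show ?case using step.IH[of k] homotopy_unique[of A \<Sigma> g h H k g'] step.hyps(2) by simp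
qed

lemma homotopy_eq_seq: "homotopy_eq A \<Sigma> Hs Ks \<Longrightarrow> homotopy_seq A \<Sigma> f g Hs \<Longrightarrow> homotopy_seq A \<Sigma> f g Ks"
  unfolding homotopy_eq_def by (auto dest: homotopy_seq_unique)

lemma homotopy_eq_hat: "homotopy_eq (A :: ('o, 'a) cat) \<Sigma> Hs Ks \<Longrightarrow> test_functor D A \<Sigma> F \<Longrightarrow> hat_seq D F Hs = hat_seq D F Ks"
  for D :: "('o, 'a arr_word, 'a cell_word) two_cat"
  unfolding homotopy_eq_def test_functor_def test_functor_axioms_def by blast

lemma homotopy_eqI:
  assumes "homotopy_seq A \<Sigma> f g Hs" "homotopy_seq A \<Sigma> f g Ks"
    "\<And>D F. test_functor (D :: ('o, 'a arr_word, 'a cell_word) two_cat) A \<Sigma> F \<Longrightarrow> hat_seq D F Hs = hat_seq D F Ks"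
  shows "homotopy_eq (A :: ('o, 'a) cat) \<Sigma> Hs Ks"
  using assms unfolding homotopy_eq_def test_functor_def test_functor_axioms_def by blast

lemma homotopy_eq_refl: "homotopy_seq A \<Sigma> f g Hs \<Longrightarrow> homotopy_eq A \<Sigma> Hs Hs"
  by (auto simp: homotopy_eq_def)

lemma homotopy_eq_sym: "homotopy_eq A \<Sigma> Hs Ks \<Longrightarrow> homotopy_eq A \<Sigma> Ks Hs"
  by (auto simp: homotopy_eq_def)

lemma homotopy_eq_trans:
  assumes "homotopy_eq A \<Sigma> Hs Ks" "homotopy_eq A \<Sigma> Ks Ls"
  shows "homotopy_eq A \<Sigma> Hs Ls"
proof -
  obtain f g where "homotopy_seq A \<Sigma> f g Hs" using assms(1) by (auto simp: homotopy_eq_def)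
  then show ?thesis
    using homotopy_eq_seq[OF assms(1)] homotopy_eq_seq[OF assms(2)] homotopy_eq_hat[OF assms(1)]
      homotopy_eq_hat[OF assms(2)] homotopy_eqI by metis
qed

lemma hclass_eqI: "homotopy_eq A \<Sigma> Hs Ks \<Longrightarrow> hclass A \<Sigma> Hs = hclass A \<Sigma> Ks"
  using homotopy_eq_trans[of A \<Sigma> Hs Ks] homotopy_eq_trans[OF homotopy_eq_sym, of A \<Sigma> Hs Ks]
  by (auto simp: hclass_def)

lemma hrep_eq: "homotopy_seq A \<Sigma> f g Hs \<Longrightarrow> homotopy_eq A \<Sigma> Hs (hrep (hclass A \<Sigma> Hs))"
  using someI[of "\<lambda>Ks. Ks \<in> hclass A \<Sigma> Hs" Hs] homotopy_eq_refl[of A \<Sigma> f g Hs]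
  by (simp add: hrep_def hclass_def)

lemma hrep_seq: "homotopy_seq A \<Sigma> f g Hs \<Longrightarrow> homotopy_seq A \<Sigma> f g (hrep (hclass A \<Sigma> Hs))"
  using homotopy_eq_seq[OF hrep_eq] .

lemma hSrc_class [simp]: "homotopy_seq A \<Sigma> f g Hs \<Longrightarrow> hSrc A \<Sigma> (hclass A \<Sigma> Hs) = f"
  unfolding hSrc_def by (rule the_equality) (auto dest: hrep_seq homotopy_seq_unique[OF hrep_seq])

lemma hTrg_class [simp]: "homotopy_seq A \<Sigma> f g Hs \<Longrightarrow> hTrg A \<Sigma> (hclass A \<Sigma> Hs) = g"
  unfolding hTrg_def by (rule the_equality) (auto dest: hrep_seq homotopy_seq_unique[OF hrep_seq])

lemma Ho_simps [simp]:
  "Obj (Ho A \<Sigma>) = Obj A" "Arr (Ho A \<Sigma>) = Arr A" "Dom (Ho A \<Sigma>) = Dom A" "Cod (Ho A \<Sigma>) = Cod A"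
  "Ide (Ho A \<Sigma>) = Ide A" "Comp (Ho A \<Sigma>) = Comp A" "Src (Ho A \<Sigma>) = hSrc A \<Sigma>" "Trg (Ho A \<Sigma>) = hTrg A \<Sigma>"
  by (simp_all add: Ho_def)

lemma hom_Ho [simp]: "hom (Ho A \<Sigma>) = hom A"
  by (intro ext) (simp add: hom_def)

lemma Ho_cells: "\<alpha> \<in> cells (Ho A \<Sigma>) f g \<longleftrightarrow> (\<exists>Hs. homotopy_seq A \<Sigma> f g Hs \<and> \<alpha> = hclass A \<Sigma> Hs)"
  unfolding cells_def by (auto simp: Ho_def)

lemma Ho_cells_rep:
  assumes "\<alpha> \<in> cells (Ho A \<Sigma>) f g"
  shows "homotopy_seq A \<Sigma> f g (hrep \<alpha>)" "hclass A \<Sigma> (hrep \<alpha>) = \<alpha>" "hSrc A \<Sigma> \<alpha> = f" "hTrg A \<Sigma> \<alpha> = g"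
proof -
  obtain Hs where Hs: "homotopy_seq A \<Sigma> f g Hs" "\<alpha> = hclass A \<Sigma> Hs" using assms Ho_cells by metis
  show "homotopy_seq A \<Sigma> f g (hrep \<alpha>)" "hclass A \<Sigma> (hrep \<alpha>) = \<alpha>" "hSrc A \<Sigma> \<alpha> = f" "hTrg A \<Sigma> \<alpha> = g"
    using Hs hrep_seq[OF Hs(1)] hclass_eqI[OF hrep_eq[OF Hs(1)]] by auto
qed

lemma homotopy_seq_append:
  assumes "homotopy_seq A \<Sigma> f g Hs"
  shows "homotopy_seq A \<Sigma> g h Ks \<Longrightarrow> homotopy_seq A \<Sigma> f h (Ks @ Hs)"
  by (induction rule: homotopy_seq.induct) (auto intro: assms homotopy_seq.step)

lemma homotopy_seq_map:
  assumes "\<And>f g H. is_homotopy A \<Sigma> f g H \<Longrightarrow> f \<in> hom A X Y \<Longrightarrow> is_homotopy A \<Sigma> (p f) (p g) (m H)"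
  shows "homotopy_seq A \<Sigma> f g Hs \<Longrightarrow> f \<in> hom A X Y \<Longrightarrow> homotopy_seq A \<Sigma> (p f) (p g) (map m Hs) \<and> g \<in> hom A X Y"
proof (induction rule: homotopy_seq.induct)
  case (single g H)
  then show ?case using assms homotopy_seq.single by (fastforce simp: is_homotopy_def hom_def)
next
  case (step g Hs h H)
  then show ?case using assms homotopy_seq.step by (fastforce simp: is_homotopy_def hom_def)
qed

lemma homotopy_seq_par: "homotopy_seq A \<Sigma> f g Hs \<Longrightarrow> \<exists>X Y. f \<in> hom A X Y \<and> g \<in> hom A X Y"
proof (induction rule: homotopy_seq.induct)
  case (single g H)
  then show ?case by (auto simp: is_homotopy_def)
next
  case (step g Hs h H)
  then show ?case by (fastforce simp: is_homotopy_def hom_def)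
qed

locale homotopical = category A
  for A :: "('o, 'a) cat" (structure) +
  fixes \<Sigma> :: "'a set"
  assumes \<Sigma>_Arr: "\<Sigma> \<subseteq> Arr A" and \<Sigma>_Ide: "X \<in> Obj A \<Longrightarrow> Ide A X \<in> \<Sigma>"
begin

lemma id_homotopy:
  assumes f: "f \<in> hom A X Y"
  shows "is_homotopy A \<Sigma> f f (id_homotopy A f)"
proof -
  have X: "X \<in> Obj A" using f Dom_Obj by (auto simp: hom_def)
  have e: "Ide A X \<in> hom A X X" "Ide A X \<in> Arr A" "Dom A (Ide A X) = X" using Ide_hom[OF X] by (auto simp: hom_def)
  have fX: "f \<cdot> Ide A X = f" "Ide A X \<cdot> Ide A X = Ide A X" "Dom A f = X"
    using Comp_Ide[of f] f Comp_Ide[OF e(2)] e by (auto simp: hom_def)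
  show ?thesis using f e fX \<Sigma>_Ide[OF X] by (auto simp: is_homotopy_def id_homotopy_def is_cylinder_def Let_def)
qed

lemma whisk_left_homotopy:
  assumes "is_homotopy A \<Sigma> f g H" "f \<in> hom A X Y" "r \<in> hom A Y Z"
  shows "is_homotopy A \<Sigma> (r \<cdot> f) (r \<cdot> g) (whisk_left A r H)"
proof -
  have h: "g \<in> hom A X Y" "is_cylinder A \<Sigma> X (fst H)" "snd H \<in> hom A (cW (fst H)) Y"
    "snd H \<cdot> cd0 (fst H) = f" "snd H \<cdot> cd1 (fst H) = g"
    using assms by (auto simp: is_homotopy_def hom_def)
  have d: "cd0 (fst H) \<in> hom A X (cW (fst H))" "cd1 (fst H) \<in> hom A X (cW (fst H))"
    using h(2) by (auto simp: is_cylinder_def)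
  show ?thesis
    using h(2,4,5) Comp_hom[OF h(3) assms(3)] Comp_hom[OF assms(2,3)] Comp_hom[OF h(1) assms(3)]
      Comp_assoc[OF d(1) h(3) assms(3)] Comp_assoc[OF d(2) h(3) assms(3)]
    by (auto simp: is_homotopy_def whisk_left_def)
qed

lemma whisk_right_cyl:
  assumes "is_cylinder A \<Sigma> X K" "l \<in> hom A X' X"
  shows "is_cylinder A \<Sigma> X' (fst (whisk_right A (K, h) l))"
proof (cases K)
  case (Cylinder W Z d0 d1 s x)
  then have d: "d0 \<in> hom A X W" "d1 \<in> hom A X W" "s \<in> hom A W Z" "x \<in> hom A X Z" "s \<in> \<Sigma>"
    "s \<cdot> d0 = x" "s \<cdot> d1 = x"
    using assms by (auto simp: is_cylinder_def)
  show ?thesis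
    using d(3,5,6,7) Cylinder Comp_hom[OF assms(2) d(1)] Comp_hom[OF assms(2) d(2)] Comp_hom[OF assms(2) d(4)]
      Comp_assoc[OF assms(2) d(1,3)] Comp_assoc[OF assms(2) d(2,3)]
    by (simp add: is_cylinder_def whisk_right_def)
qed

lemma whisk_right_homotopy:
  assumes "is_homotopy A \<Sigma> f g H" "f \<in> hom A X Y" "l \<in> hom A X' X"
  shows "is_homotopy A \<Sigma> (f \<cdot> l) (g \<cdot> l) (whisk_right A H l)"
proof -
  obtain K h where H: "H = (K, h)" by (cases H)
  have h: "g \<in> hom A X Y" "is_cylinder A \<Sigma> X K" "h \<in> hom A (cW K) Y" "h \<cdot> cd0 K = f" "h \<cdot> cd1 K = g"
    using assms H by (auto simp: is_homotopy_def hom_def)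
  have d: "cd0 K \<in> hom A X (cW K)" "cd1 K \<in> hom A X (cW K)" using h(2) by (auto simp: is_cylinder_def)
  have "cW (fst (whisk_right A H l)) = cW K" "cd0 (fst (whisk_right A H l)) = cd0 K \<cdot> l"
    "cd1 (fst (whisk_right A H l)) = cd1 K \<cdot> l" "snd (whisk_right A H l) = h"
    by (auto simp: H whisk_right_def split: cylinder.split)
  then show ?thesis
    using whisk_right_cyl[OF h(2) assms(3), of h] h(3,4,5) H Comp_hom[OF assms(3,2)] Comp_hom[OF assms(3) h(1)]
      Comp_assoc[OF assms(3) d(1) h(3)] Comp_assoc[OF assms(3) d(2) h(3)]
    by (auto simp: is_homotopy_def)
qed

lemma homotopy_seq_left:
  "homotopy_seq A \<Sigma> f g Hs \<Longrightarrow> f \<in> hom A X Y \<Longrightarrow> r \<in> hom A Y Z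
    \<Longrightarrow> homotopy_seq A \<Sigma> (r \<cdot> f) (r \<cdot> g) (map (whisk_left A r) Hs)"
  using homotopy_seq_map[of A \<Sigma> X Y "\<lambda>f. r \<cdot> f" "whisk_left A r"] whisk_left_homotopy by blast

lemma homotopy_seq_right:
  "homotopy_seq A \<Sigma> f g Hs \<Longrightarrow> f \<in> hom A X Y \<Longrightarrow> l \<in> hom A X' X
    \<Longrightarrow> homotopy_seq A \<Sigma> (f \<cdot> l) (g \<cdot> l) (map (\<lambda>H. whisk_right A H l) Hs)"
  using homotopy_seq_map[of A \<Sigma> X Y "\<lambda>f. f \<cdot> l" "\<lambda>H. whisk_right A H l"] whisk_right_homotopy by blast

end

locale homotopical_test = homotopical A \<Sigma> + T: test_functor D A \<Sigma> F
  for D :: "('p, 'b, 'd) two_cat" and A :: "('o, 'a) cat" and \<Sigma> F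
begin

lemma hat_append:
  assumes "homotopy_seq A \<Sigma> f g Hs"
  shows "homotopy_seq A \<Sigma> g h Ks \<Longrightarrow> hat_seq D F (Ks @ Hs) = hat_seq D F Ks \<bullet>\<^bsub>D\<^esub> hat_seq D F Hs"
proof (induction rule: homotopy_seq.induct)
  case (single h H)
  then show ?case using T.hat_seq_Cons homotopy_seq_ne[OF assms] by simp
next
  case (step h Ks k H)
  have "Ks \<noteq> []" "Ks @ Hs \<noteq> []" using homotopy_seq_ne[OF step(1)] by auto
  then show ?case
    using T.VComp_assoc[OF T.hat_seq_cells[OF assms] T.hat_seq_cells[OF step(1)] T.hat_cells[OF step(2)]]
      step.IH by (simp add: T.hat_seq_Cons)
qed

lemma hat_id:
  assumes f: "f \<in> hom A X Y"
  shows "hat D F (id_homotopy A f) = Ide2 D (Far F f)"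
proof -
  have X: "X \<in> Obj A" "Dom A f = X" using f Dom_Obj by (auto simp: hom_def)
  note h = id_homotopy[OF f]
  let ?K = "Cylinder X X (Ide A X) (Ide A X) (Ide A X) (Ide A X)"
  have K: "id_homotopy A f = (?K, f)" using X by (simp add: id_homotopy_def Let_def)
  have c: "is_cylinder A \<Sigma> X ?K" using h X K by (auto simp: is_homotopy_def hom_def)
  have e: "Ide A X \<in> hom A X X" "Ide A X \<cdot>\<^bsub>A\<^esub> Ide A X = Ide A X" "f \<cdot>\<^bsub>A\<^esub> Ide A X = f"
    using c h K by (auto simp: is_cylinder_def is_homotopy_def)
  have "hat_cyl D F ?K = Ide2 D (Far F (Ide A X))"
    using T.hat_cyl_eqI[OF c] T.Ide2_cells_hom[OF T.Fhom[OF e(1)]]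
      T.HComp_Ide2[OF T.Fhom[OF e(1)] T.Fhom[OF e(1)]] T.FComp[OF e(1) e(1)] e(2) by simp
  then show ?thesis
    using T.HComp_Ide2[OF T.Fhom[OF e(1)] T.Fhom[OF f]] T.FComp[OF e(1) f] e(3) K by (simp add: hat_def)
qed

lemma hat_whisk_left:
  assumes "is_homotopy A \<Sigma> f g H" "f \<in> hom A X Y" and r: "r \<in> hom A Y Z"
  shows "hat D F (whisk_left A r H) = Ide2 D (Far F r) \<star>\<^bsub>D\<^esub> hat D F H"
proof -
  have h: "is_cylinder A \<Sigma> X (fst H)" "snd H \<in> hom A (cW (fst H)) Y"
    using assms by (auto simp: is_homotopy_def hom_def)
  have d: "cd0 (fst H) \<in> hom A X (cW (fst H))" using h(1) by (auto simp: is_cylinder_def)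
  show ?thesis
    using T.HComp_assoc_hom[OF T.hat_cyl(1)[OF h(1)] T.Ide2_cells_hom[OF T.Fhom[OF h(2)]]
        T.Ide2_cells_hom[OF T.Fhom[OF r]] T.Fhom[OF d] T.Fhom[OF h(2)] T.Fhom[OF r]]
      T.HComp_Ide2[OF T.Fhom[OF h(2)] T.Fhom[OF r]] T.FComp[OF h(2) r]
    by (simp add: hat_def whisk_left_def)
qed

lemma hat_whisk_right:
  assumes "is_homotopy A \<Sigma> f g H" "f \<in> hom A X Y" and l: "l \<in> hom A X' X"
  shows "hat D F (whisk_right A H l) = hat D F H \<star>\<^bsub>D\<^esub> Ide2 D (Far F l)"
proof -
  obtain W Z d0 d1 s x h where H: "H = (Cylinder W Z d0 d1 s x, h)" by (metis cylinder.exhaust surj_pair)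
  let ?K = "Cylinder W Z d0 d1 s x" and ?L = "Cylinder W Z (d0 \<cdot>\<^bsub>A\<^esub> l) (d1 \<cdot>\<^bsub>A\<^esub> l) s (x \<cdot>\<^bsub>A\<^esub> l)"
  have h: "is_cylinder A \<Sigma> X ?K" "h \<in> hom A W Y" using assms H by (auto simp: is_homotopy_def hom_def)
  then have d: "d0 \<in> hom A X W" "d1 \<in> hom A X W" "s \<in> hom A W Z" "x \<in> hom A X Z" by (auto simp: is_cylinder_def)
  have L: "is_cylinder A \<Sigma> X' ?L" using whisk_right_cyl[OF h(1) l, of h] by (simp add: whisk_right_def)
  note K = T.hat_cyl[OF h(1), simplified]
  note il = T.Ide2_cells_hom[OF T.Fhom[OF l]]
  have "hat_cyl D F ?L = hat_cyl D F ?K \<star>\<^bsub>D\<^esub> Ide2 D (Far F l)"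
  proof (rule T.hat_cyl_eqI[OF L])
    show "hat_cyl D F ?K \<star>\<^bsub>D\<^esub> Ide2 D (Far F l) \<in> cells D (Far F (cd0 ?L)) (Far F (cd1 ?L))"
      using T.HComp_cells_hom[OF il K(1) T.Fhom[OF l] T.Fhom[OF d(1)]] T.FComp[OF l d(1)] T.FComp[OF l d(2)]
      by simp
    show "Ide2 D (Far F (cs ?L)) \<star>\<^bsub>D\<^esub> (hat_cyl D F ?K \<star>\<^bsub>D\<^esub> Ide2 D (Far F l)) = Ide2 D (Far F (cx ?L))"
      using T.HComp_assoc_hom[OF il K(1) T.Ide2_cells_hom[OF T.Fhom[OF d(3)]] T.Fhom[OF l] T.Fhom[OF d(1)] T.Fhom[OF d(3)]]
        K(2) T.HComp_Ide2[OF T.Fhom[OF l] T.Fhom[OF d(4)]] T.FComp[OF l d(4)] by simp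
  qed
  then show ?thesis
    using T.HComp_assoc_hom[OF il K(1) T.Ide2_cells_hom[OF T.Fhom[OF h(2)]] T.Fhom[OF l] T.Fhom[OF d(1)] T.Fhom[OF h(2)]]
    by (simp add: hat_def whisk_right_def H)
qed

lemma hat_seq_left:
  assumes r: "r \<in> hom A Y Z"
  shows "homotopy_seq A \<Sigma> f g Hs \<Longrightarrow> f \<in> hom A X Y
    \<Longrightarrow> hat_seq D F (map (whisk_left A r) Hs) = Ide2 D (Far F r) \<star>\<^bsub>D\<^esub> hat_seq D F Hs"
proof (induction rule: homotopy_seq.induct)
  case (single g H)
  then show ?case using hat_whisk_left[OF _ _ r] by simp
next
  case (step g Hs h H)
  have g: "g \<in> hom A X Y" using homotopy_seq_par[OF step(1)] step.prems by (auto simp: hom_def)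
  have ne: "Hs \<noteq> []" using homotopy_seq_ne[OF step(1)] .
  note i = T.Ide2_cells_hom[OF T.Fhom[OF r]]
  show ?case
    using T.interchange_hom[OF T.hat_seq_cells[OF step(1)] T.hat_cells[OF step(2)] i i T.Fhom[OF step.prems] T.Fhom[OF r]]
      T.VComp_Ide2[OF i] step.IH[OF step.prems] hat_whisk_left[OF step(2) g r] ne by (simp add: T.hat_seq_Cons)
qed

lemma hat_seq_right:
  assumes l: "l \<in> hom A X' X"
  shows "homotopy_seq A \<Sigma> f g Hs \<Longrightarrow> f \<in> hom A X Y
    \<Longrightarrow> hat_seq D F (map (\<lambda>H. whisk_right A H l) Hs) = hat_seq D F Hs \<star>\<^bsub>D\<^esub> Ide2 D (Far F l)"
proof (induction rule: homotopy_seq.induct)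
  case (single g H)
  then show ?case using hat_whisk_right[OF _ _ l] by simp
next
  case (step g Hs h H)
  have g: "g \<in> hom A X Y" using homotopy_seq_par[OF step(1)] step.prems by (auto simp: hom_def)
  have ne: "Hs \<noteq> []" using homotopy_seq_ne[OF step(1)] .
  note i = T.Ide2_cells_hom[OF T.Fhom[OF l]]
  show ?case
    using T.interchange_hom[OF i i T.hat_seq_cells[OF step(1)] T.hat_cells[OF step(2)] T.Fhom[OF l] T.Fhom[OF step.prems]]
      T.VComp_Ide2[OF i] step.IH[OF step.prems] hat_whisk_right[OF step(2) g l] ne by (simp add: T.hat_seq_Cons)
qed

end

context homotopical
begin

lemma Ho_Ide2:
  assumes f: "f \<in> Arr A"
  shows "Ide2 (Ho A \<Sigma>) f \<in> cells (Ho A \<Sigma>) f f" and "homotopy_seq A \<Sigma> f f [id_homotopy A f]"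
proof -
  show "homotopy_seq A \<Sigma> f f [id_homotopy A f]" using id_homotopy[of f] f homotopy_seq.single by (metis (mono_tags, lifting) hom_def mem_Collect_eq)
  then show "Ide2 (Ho A \<Sigma>) f \<in> cells (Ho A \<Sigma>) f f" unfolding Ho_cells by (auto simp: Ho_def)
qed

lemma Ho_VComp:
  assumes "\<alpha> \<in> cells (Ho A \<Sigma>) f g" "\<beta> \<in> cells (Ho A \<Sigma>) g h"
  shows "\<beta> \<bullet>\<^bsub>Ho A \<Sigma>\<^esub> \<alpha> \<in> cells (Ho A \<Sigma>) f h" and "homotopy_seq A \<Sigma> f h (hrep \<beta> @ hrep \<alpha>)"
proof -
  show "homotopy_seq A \<Sigma> f h (hrep \<beta> @ hrep \<alpha>)"
    using homotopy_seq_append Ho_cells_rep(1)[OF assms(1)] Ho_cells_rep(1)[OF assms(2)] by metis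
  then show "\<beta> \<bullet>\<^bsub>Ho A \<Sigma>\<^esub> \<alpha> \<in> cells (Ho A \<Sigma>) f h" unfolding Ho_cells by (auto simp: Ho_def)
qed

lemma Ho_HComp:
  assumes "\<alpha> \<in> cells (Ho A \<Sigma>) f g" "\<beta> \<in> cells (Ho A \<Sigma>) h k" "Cod A f = Dom A h"
  shows "\<beta> \<star>\<^bsub>Ho A \<Sigma>\<^esub> \<alpha> \<in> cells (Ho A \<Sigma>) (h \<cdot> f) (k \<cdot> g)"
    and "homotopy_seq A \<Sigma> (h \<cdot> f) (h \<cdot> g) (map (whisk_left A h) (hrep \<alpha>))"
    and "homotopy_seq A \<Sigma> (h \<cdot> g) (k \<cdot> g) (map (\<lambda>H. whisk_right A H g) (hrep \<beta>))"
    and "\<beta> \<star>\<^bsub>Ho A \<Sigma>\<^esub> \<alpha> = hclass A \<Sigma> (map (\<lambda>H. whisk_right A H g) (hrep \<beta>) @ map (whisk_left A h) (hrep \<alpha>))"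
proof -
  note a = Ho_cells_rep[OF assms(1)] and b = Ho_cells_rep[OF assms(2)]
  obtain X Y where f: "f \<in> hom A X Y" "g \<in> hom A X Y" using homotopy_seq_par[OF a(1)] by blast
  obtain Z where h: "h \<in> hom A Y Z" "k \<in> hom A Y Z" using homotopy_seq_par[OF b(1)] assms(3) f by (auto simp: hom_def)
  show 1: "homotopy_seq A \<Sigma> (h \<cdot> f) (h \<cdot> g) (map (whisk_left A h) (hrep \<alpha>))"
    using homotopy_seq_left[OF a(1) f(1) h(1)] .
  show 2: "homotopy_seq A \<Sigma> (h \<cdot> g) (k \<cdot> g) (map (\<lambda>H. whisk_right A H g) (hrep \<beta>))"
    using homotopy_seq_right[OF b(1) h(1) f(2)] .
  show 3: "\<beta> \<star>\<^bsub>Ho A \<Sigma>\<^esub> \<alpha> = hclass A \<Sigma> (map (\<lambda>H. whisk_right A H g) (hrep \<beta>) @ map (whisk_left A h) (hrep \<alpha>))"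
    using a(4) b(3) by (simp add: Ho_def)
  show "\<beta> \<star>\<^bsub>Ho A \<Sigma>\<^esub> \<alpha> \<in> cells (Ho A \<Sigma>) (h \<cdot> f) (k \<cdot> g)"
    unfolding Ho_cells 3 using homotopy_seq_append[OF 1 2] by blast
qed

end

context homotopical_test
begin

abbreviation hatc :: "('o, 'a) homotopy list set \<Rightarrow> 'd" where
  "hatc \<alpha> \<equiv> hat_seq D F (hrep \<alpha>)"

lemma hatc_class: "homotopy_seq A \<Sigma> f g Hs \<Longrightarrow> hatc (hclass A \<Sigma> Hs) = hat_seq D F Hs"
  using homotopy_eq_universal[OF category_axioms \<Sigma>_Arr hrep_eq T.two_category_axioms T.F T.inv] by metis

lemma hatc_cells: "\<alpha> \<in> cells (Ho A \<Sigma>) f g \<Longrightarrow> hatc \<alpha> \<in> cells D (Far F f) (Far F g)"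
  using T.hat_seq_cells Ho_cells_rep(1) by metis

lemma hatc_Ide2: "f \<in> Arr A \<Longrightarrow> hatc (Ide2 (Ho A \<Sigma>) f) = Ide2 D (Far F f)"
  using hatc_class[OF Ho_Ide2(2)] hat_id[of f] by (simp add: Ho_def hom_def)

lemma hatc_VComp:
  "\<alpha> \<in> cells (Ho A \<Sigma>) f g \<Longrightarrow> \<beta> \<in> cells (Ho A \<Sigma>) g h \<Longrightarrow> hatc (\<beta> \<bullet>\<^bsub>Ho A \<Sigma>\<^esub> \<alpha>) = hatc \<beta> \<bullet>\<^bsub>D\<^esub> hatc \<alpha>"
  using hatc_class[OF Ho_VComp(2)] hat_append[OF Ho_cells_rep(1) Ho_cells_rep(1)] by (simp add: Ho_def)

lemma hatc_HComp:
  assumes "\<alpha> \<in> cells (Ho A \<Sigma>) f g" "\<beta> \<in> cells (Ho A \<Sigma>) h k" "Cod A f = Dom A h"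
  shows "hatc (\<beta> \<star>\<^bsub>Ho A \<Sigma>\<^esub> \<alpha>) = hatc \<beta> \<star>\<^bsub>D\<^esub> hatc \<alpha>"
proof -
  note H = Ho_HComp[OF assms]
  note a = Ho_cells_rep[OF assms(1)] and b = Ho_cells_rep[OF assms(2)]
  obtain X Y where f: "f \<in> hom A X Y" "g \<in> hom A X Y" using homotopy_seq_par[OF a(1)] by blast
  obtain Z where h: "h \<in> hom A Y Z" "k \<in> hom A Y Z" using homotopy_seq_par[OF b(1)] assms(3) f by (auto simp: hom_def)
  have "hatc (\<beta> \<star>\<^bsub>Ho A \<Sigma>\<^esub> \<alpha>) = (hatc \<beta> \<star>\<^bsub>D\<^esub> Ide2 D (Far F g)) \<bullet>\<^bsub>D\<^esub> (Ide2 D (Far F h) \<star>\<^bsub>D\<^esub> hatc \<alpha>)"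
    unfolding H(4) using hatc_class[OF homotopy_seq_append[OF H(2,3)]] hat_append[OF H(2,3)]
      hat_seq_left[OF h(1) a(1) f(1)] hat_seq_right[OF f(2) b(1) h(1)] by simp
  also have "\<dots> = (hatc \<beta> \<bullet>\<^bsub>D\<^esub> Ide2 D (Far F h)) \<star>\<^bsub>D\<^esub> (Ide2 D (Far F g) \<bullet>\<^bsub>D\<^esub> hatc \<alpha>)"
    using T.interchange_hom[OF hatc_cells[OF assms(1)] T.Ide2_cells_hom[OF T.Fhom[OF f(2)]]
      T.Ide2_cells_hom[OF T.Fhom[OF h(1)]] hatc_cells[OF assms(2)] T.Fhom[OF f(1)] T.Fhom[OF h(1)]] by simp
  finally show ?thesis
    using T.VComp_Ide2[OF hatc_cells[OF assms(2)]] T.Ide2_VComp[OF hatc_cells[OF assms(1)]] by simp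
qed

end

context homotopical
begin

lemma Ho_cell_eqI:
  assumes "\<alpha> \<in> cells (Ho A \<Sigma>) f g" "\<beta> \<in> cells (Ho A \<Sigma>) f g"
    and "\<And>D F. homotopical_test (D :: ('o, 'a arr_word, 'a cell_word) two_cat) A \<Sigma> F
      \<Longrightarrow> hat_seq D F (hrep \<alpha>) = hat_seq D F (hrep \<beta>)"
  shows "\<alpha> = \<beta>"
proof -
  have "homotopy_eq A \<Sigma> (hrep \<alpha>) (hrep \<beta>)"
    using assms(3) homotopical_axioms
    by (intro homotopy_eqI[OF Ho_cells_rep(1)[OF assms(1)] Ho_cells_rep(1)[OF assms(2)]])
      (simp add: homotopical_test_def)
  then show ?thesis using hclass_eqI Ho_cells_rep(2)[OF assms(1)] Ho_cells_rep(2)[OF assms(2)] by metis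
qed

theorem two_category_Ho: "two_category (Ho A \<Sigma>)"
proof unfold_locales
  show "f \<in> Arr (Ho A \<Sigma>) \<Longrightarrow> Dom (Ho A \<Sigma>) f \<in> Obj (Ho A \<Sigma>)"
    "f \<in> Arr (Ho A \<Sigma>) \<Longrightarrow> Cod (Ho A \<Sigma>) f \<in> Obj (Ho A \<Sigma>)"
    "X \<in> Obj (Ho A \<Sigma>) \<Longrightarrow> Ide (Ho A \<Sigma>) X \<in> hom (Ho A \<Sigma>) X X"
    "f \<in> hom (Ho A \<Sigma>) X Y \<Longrightarrow> g \<in> hom (Ho A \<Sigma>) Y Z \<Longrightarrow> g \<cdot>\<^bsub>Ho A \<Sigma>\<^esub> f \<in> hom (Ho A \<Sigma>) X Z"
    "f \<in> Arr (Ho A \<Sigma>) \<Longrightarrow> f \<cdot>\<^bsub>Ho A \<Sigma>\<^esub> Ide (Ho A \<Sigma>) (Dom (Ho A \<Sigma>) f) = f"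
    "f \<in> Arr (Ho A \<Sigma>) \<Longrightarrow> Ide (Ho A \<Sigma>) (Cod (Ho A \<Sigma>) f) \<cdot>\<^bsub>Ho A \<Sigma>\<^esub> f = f"
    "f \<in> hom (Ho A \<Sigma>) X Y \<Longrightarrow> g \<in> hom (Ho A \<Sigma>) Y Z \<Longrightarrow> h \<in> hom (Ho A \<Sigma>) Z T
      \<Longrightarrow> h \<cdot>\<^bsub>Ho A \<Sigma>\<^esub> g \<cdot>\<^bsub>Ho A \<Sigma>\<^esub> f = (h \<cdot>\<^bsub>Ho A \<Sigma>\<^esub> g) \<cdot>\<^bsub>Ho A \<Sigma>\<^esub> f"
    for f g h X Y Z T
    using Dom_Obj Cod_Obj Ide_hom Comp_hom Comp_Ide Ide_Comp Comp_assoc[of f X Y g Z h T] by auto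
next
  fix \<alpha> assume "\<alpha> \<in> Cell (Ho A \<Sigma>)"
  then have "\<alpha> \<in> cells (Ho A \<Sigma>) (hSrc A \<Sigma> \<alpha>) (hTrg A \<Sigma> \<alpha>)" by (simp add: cells_def)
  then show "\<exists>X Y. Src (Ho A \<Sigma>) \<alpha> \<in> hom (Ho A \<Sigma>) X Y \<and> Trg (Ho A \<Sigma>) \<alpha> \<in> hom (Ho A \<Sigma>) X Y"
    using homotopy_seq_par Ho_cells_rep(1) by fastforce
next
  fix f assume "f \<in> Arr (Ho A \<Sigma>)"
  then show "Ide2 (Ho A \<Sigma>) f \<in> cells (Ho A \<Sigma>) f f" using Ho_Ide2 by simp
next
  fix \<alpha> f g \<beta> h assume "\<alpha> \<in> cells (Ho A \<Sigma>) f g" "\<beta> \<in> cells (Ho A \<Sigma>) g h"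
  then show "\<beta> \<bullet>\<^bsub>Ho A \<Sigma>\<^esub> \<alpha> \<in> cells (Ho A \<Sigma>) f h" by (rule Ho_VComp)
next
  fix \<alpha> f g assume a: "\<alpha> \<in> cells (Ho A \<Sigma>) f g"
  obtain X Y where f: "f \<in> hom A X Y" "g \<in> hom A X Y" using homotopy_seq_par[OF Ho_cells_rep(1)[OF a]] by blast
  have X: "X \<in> Obj A" "Y \<in> Obj A" using f Dom_Obj Cod_Obj by (auto simp: hom_def)
  have e: "Ide A X \<in> hom A X X" "Ide A Y \<in> hom A Y Y" using Ide_hom X by auto
  have arr: "f \<in> Arr A" "g \<in> Arr A" "Ide A X \<in> Arr A" "Ide A Y \<in> Arr A" using f e by (auto simp: hom_def)
  have u: "f \<cdot> Ide A X = f" "g \<cdot> Ide A X = g" "Ide A Y \<cdot> f = f" "Ide A Y \<cdot> g = g"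
    using Comp_Ide[of f] Comp_Ide[of g] Ide_Comp[of f] Ide_Comp[of g] f by (auto simp: hom_def)
  note i = Ho_Ide2(1)[OF arr(1)] Ho_Ide2(1)[OF arr(2)] Ho_Ide2(1)[OF arr(3)] Ho_Ide2(1)[OF arr(4)]
  have dc: "Dom A f = X" "Cod A f = Y" "Cod A (Ide A X) = Dom A f" "Cod A f = Dom A (Ide A Y)"
    using f e by (auto simp: hom_def)
  show "\<alpha> \<bullet>\<^bsub>Ho A \<Sigma>\<^esub> Ide2 (Ho A \<Sigma>) f = \<alpha>"
  proof (rule Ho_cell_eqI[OF Ho_VComp(1)[OF i(1) a] a])
    fix D F assume "homotopical_test (D :: ('o, 'a arr_word, 'a cell_word) two_cat) A \<Sigma> F"
    then interpret homotopical_test D A \<Sigma> F .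
    show "hatc (\<alpha> \<bullet>\<^bsub>Ho A \<Sigma>\<^esub> Ide2 (Ho A \<Sigma>) f) = hatc \<alpha>"
      using hatc_VComp[OF i(1) a] hatc_Ide2[OF arr(1)] T.VComp_Ide2[OF hatc_cells[OF a]] by simp
  qed
  show "Ide2 (Ho A \<Sigma>) g \<bullet>\<^bsub>Ho A \<Sigma>\<^esub> \<alpha> = \<alpha>"
  proof (rule Ho_cell_eqI[OF Ho_VComp(1)[OF a i(2)] a])
    fix D F assume "homotopical_test (D :: ('o, 'a arr_word, 'a cell_word) two_cat) A \<Sigma> F"
    then interpret homotopical_test D A \<Sigma> F .
    show "hatc (Ide2 (Ho A \<Sigma>) g \<bullet>\<^bsub>Ho A \<Sigma>\<^esub> \<alpha>) = hatc \<alpha>"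
      using hatc_VComp[OF a i(2)] hatc_Ide2[OF arr(2)] T.Ide2_VComp[OF hatc_cells[OF a]] by simp
  qed
  show "\<alpha> \<star>\<^bsub>Ho A \<Sigma>\<^esub> Ide2 (Ho A \<Sigma>) (Ide (Ho A \<Sigma>) (Dom (Ho A \<Sigma>) f)) = \<alpha>"
    unfolding Ho_simps dc
  proof (rule Ho_cell_eqI[OF _ a])
    show "\<alpha> \<star>\<^bsub>Ho A \<Sigma>\<^esub> Ide2 (Ho A \<Sigma>) (Ide A X) \<in> cells (Ho A \<Sigma>) f g"
      using Ho_HComp(1)[OF i(3) a dc(3)] u by simp
    fix D F assume "homotopical_test (D :: ('o, 'a arr_word, 'a cell_word) two_cat) A \<Sigma> F"
    then interpret homotopical_test D A \<Sigma> F .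
    have "Far F (Ide A X) = Ide D (Dom D (Far F f))"
      using T.F' X T.Fhom[OF f(1)] by (auto simp: is_functor_def hom_def)
    then show "hatc (\<alpha> \<star>\<^bsub>Ho A \<Sigma>\<^esub> Ide2 (Ho A \<Sigma>) (Ide A X)) = hatc \<alpha>"
      using hatc_HComp[OF i(3) a dc(3)] hatc_Ide2[OF arr(3)] T.HComp_Ide[OF hatc_cells[OF a]] by simp
  qed
  show "Ide2 (Ho A \<Sigma>) (Ide (Ho A \<Sigma>) (Cod (Ho A \<Sigma>) f)) \<star>\<^bsub>Ho A \<Sigma>\<^esub> \<alpha> = \<alpha>"
    unfolding Ho_simps dc
  proof (rule Ho_cell_eqI[OF _ a])
    show "Ide2 (Ho A \<Sigma>) (Ide A Y) \<star>\<^bsub>Ho A \<Sigma>\<^esub> \<alpha> \<in> cells (Ho A \<Sigma>) f g"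
      using Ho_HComp(1)[OF a i(4) dc(4)] u by simp
    fix D F assume "homotopical_test (D :: ('o, 'a arr_word, 'a cell_word) two_cat) A \<Sigma> F"
    then interpret homotopical_test D A \<Sigma> F .
    have "Far F (Ide A Y) = Ide D (Cod D (Far F f))"
      using T.F' X T.Fhom[OF f(1)] by (auto simp: is_functor_def hom_def)
    then show "hatc (Ide2 (Ho A \<Sigma>) (Ide A Y) \<star>\<^bsub>Ho A \<Sigma>\<^esub> \<alpha>) = hatc \<alpha>"
      using hatc_HComp[OF a i(4) dc(4)] hatc_Ide2[OF arr(4)] T.Ide_HComp[OF hatc_cells[OF a]] by simp
  qed
next
  fix \<alpha> f g \<beta> h \<gamma> k
  assume a: "\<alpha> \<in> cells (Ho A \<Sigma>) f g" and b: "\<beta> \<in> cells (Ho A \<Sigma>) g h" and c: "\<gamma> \<in> cells (Ho A \<Sigma>) h k"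
  note ba = Ho_VComp(1)[OF a b] and cb = Ho_VComp(1)[OF b c]
  show "\<gamma> \<bullet>\<^bsub>Ho A \<Sigma>\<^esub> \<beta> \<bullet>\<^bsub>Ho A \<Sigma>\<^esub> \<alpha> = (\<gamma> \<bullet>\<^bsub>Ho A \<Sigma>\<^esub> \<beta>) \<bullet>\<^bsub>Ho A \<Sigma>\<^esub> \<alpha>"
  proof (rule Ho_cell_eqI[OF Ho_VComp(1)[OF ba c] Ho_VComp(1)[OF a cb]])
    fix D F assume "homotopical_test (D :: ('o, 'a arr_word, 'a cell_word) two_cat) A \<Sigma> F"
    then interpret homotopical_test D A \<Sigma> F .
    show "hatc (\<gamma> \<bullet>\<^bsub>Ho A \<Sigma>\<^esub> \<beta> \<bullet>\<^bsub>Ho A \<Sigma>\<^esub> \<alpha>) = hatc ((\<gamma> \<bullet>\<^bsub>Ho A \<Sigma>\<^esub> \<beta>) \<bullet>\<^bsub>Ho A \<Sigma>\<^esub> \<alpha>)"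
      using hatc_VComp[OF ba c] hatc_VComp[OF a cb] hatc_VComp[OF a b] hatc_VComp[OF b c]
        T.VComp_assoc[OF hatc_cells[OF a] hatc_cells[OF b] hatc_cells[OF c]] by simp
  qed
next
  fix \<alpha> f g \<beta> h k
  assume "\<alpha> \<in> cells (Ho A \<Sigma>) f g" "\<beta> \<in> cells (Ho A \<Sigma>) h k" "Cod (Ho A \<Sigma>) f = Dom (Ho A \<Sigma>) h"
  then show "\<beta> \<star>\<^bsub>Ho A \<Sigma>\<^esub> \<alpha> \<in> cells (Ho A \<Sigma>) (h \<cdot>\<^bsub>Ho A \<Sigma>\<^esub> f) (k \<cdot>\<^bsub>Ho A \<Sigma>\<^esub> g)"
    using Ho_HComp(1) by simp
next
  fix \<alpha> f f' \<beta> g g' \<gamma> h h'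
  assume a: "\<alpha> \<in> cells (Ho A \<Sigma>) f f'" and b: "\<beta> \<in> cells (Ho A \<Sigma>) g g'" and c: "\<gamma> \<in> cells (Ho A \<Sigma>) h h'"
    and fg': "Cod (Ho A \<Sigma>) f = Dom (Ho A \<Sigma>) g" and gh': "Cod (Ho A \<Sigma>) g = Dom (Ho A \<Sigma>) h"
  then have fg: "Cod A f = Dom A g" and gh: "Cod A g = Dom A h" by auto
  obtain X Y where f: "f \<in> hom A X Y" "f' \<in> hom A X Y" using homotopy_seq_par[OF Ho_cells_rep(1)[OF a]] by blast
  obtain Z where g: "g \<in> hom A Y Z" "g' \<in> hom A Y Z"
    using homotopy_seq_par[OF Ho_cells_rep(1)[OF b]] f fg by (auto simp: hom_def)
  obtain T where h: "h \<in> hom A Z T" "h' \<in> hom A Z T"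
    using homotopy_seq_par[OF Ho_cells_rep(1)[OF c]] g gh by (auto simp: hom_def)
  have ba: "\<beta> \<star>\<^bsub>Ho A \<Sigma>\<^esub> \<alpha> \<in> cells (Ho A \<Sigma>) (g \<cdot> f) (g' \<cdot> f')" and cb: "\<gamma> \<star>\<^bsub>Ho A \<Sigma>\<^esub> \<beta> \<in> cells (Ho A \<Sigma>) (h \<cdot> g) (h' \<cdot> g')"
    using Ho_HComp(1)[OF a b fg] Ho_HComp(1)[OF b c gh] by auto
  have d1: "Cod A (g \<cdot> f) = Dom A h" and d2: "Cod A f = Dom A (h \<cdot> g)"
    using Comp_hom[OF f(1) g(1)] Comp_hom[OF g(1) h(1)] f h by (auto simp: hom_def)
  have ass: "(h \<cdot> g) \<cdot> f = h \<cdot> g \<cdot> f" "(h' \<cdot> g') \<cdot> f' = h' \<cdot> g' \<cdot> f'"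
    using Comp_assoc[OF f(1) g(1) h(1)] Comp_assoc[OF f(2) g(2) h(2)] by auto
  show "\<gamma> \<star>\<^bsub>Ho A \<Sigma>\<^esub> \<beta> \<star>\<^bsub>Ho A \<Sigma>\<^esub> \<alpha> = (\<gamma> \<star>\<^bsub>Ho A \<Sigma>\<^esub> \<beta>) \<star>\<^bsub>Ho A \<Sigma>\<^esub> \<alpha>"
  proof (rule Ho_cell_eqI[OF Ho_HComp(1)[OF ba c d1] Ho_HComp(1)[OF a cb d2, unfolded ass]])
    fix D F assume "homotopical_test (D :: ('o, 'a arr_word, 'a cell_word) two_cat) A \<Sigma> F"
    then interpret homotopical_test D A \<Sigma> F .
    show "hatc (\<gamma> \<star>\<^bsub>Ho A \<Sigma>\<^esub> \<beta> \<star>\<^bsub>Ho A \<Sigma>\<^esub> \<alpha>) = hatc ((\<gamma> \<star>\<^bsub>Ho A \<Sigma>\<^esub> \<beta>) \<star>\<^bsub>Ho A \<Sigma>\<^esub> \<alpha>)"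
      using hatc_HComp[OF ba c d1] hatc_HComp[OF a cb d2] hatc_HComp[OF a b fg] hatc_HComp[OF b c gh]
        T.HComp_assoc_hom[OF hatc_cells[OF a] hatc_cells[OF b] hatc_cells[OF c] T.Fhom[OF f(1)] T.Fhom[OF g(1)] T.Fhom[OF h(1)]]
      by simp
  qed
next
  fix f X Y g Z assume "f \<in> hom (Ho A \<Sigma>) X Y" "g \<in> hom (Ho A \<Sigma>) Y Z"
  then have f: "f \<in> hom A X Y" and g: "g \<in> hom A Y Z" by auto
  have arr: "f \<in> Arr A" "g \<in> Arr A" "g \<cdot> f \<in> Arr A" "Cod A f = Dom A g"
    using f g Comp_hom[OF f g] by (auto simp: hom_def)
  note i = Ho_Ide2(1)[OF arr(1)] Ho_Ide2(1)[OF arr(2)] Ho_Ide2(1)[OF arr(3)]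
  show "Ide2 (Ho A \<Sigma>) g \<star>\<^bsub>Ho A \<Sigma>\<^esub> Ide2 (Ho A \<Sigma>) f = Ide2 (Ho A \<Sigma>) (g \<cdot>\<^bsub>Ho A \<Sigma>\<^esub> f)"
    unfolding Ho_simps
  proof (rule Ho_cell_eqI[OF Ho_HComp(1)[OF i(1,2) arr(4)] i(3)])
    fix D F assume "homotopical_test (D :: ('o, 'a arr_word, 'a cell_word) two_cat) A \<Sigma> F"
    then interpret homotopical_test D A \<Sigma> F .
    show "hatc (Ide2 (Ho A \<Sigma>) g \<star>\<^bsub>Ho A \<Sigma>\<^esub> Ide2 (Ho A \<Sigma>) f) = hatc (Ide2 (Ho A \<Sigma>) (g \<cdot> f))"
      using hatc_HComp[OF i(1,2) arr(4)] hatc_Ide2[OF arr(1)] hatc_Ide2[OF arr(2)] hatc_Ide2[OF arr(3)]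
        T.HComp_Ide2[OF T.Fhom[OF f] T.Fhom[OF g]] T.FComp[OF f g] by simp
  qed
next
  fix \<alpha> f f' \<alpha>' f'' \<beta> g g' \<beta>' g''
  assume a: "\<alpha> \<in> cells (Ho A \<Sigma>) f f'" and a': "\<alpha>' \<in> cells (Ho A \<Sigma>) f' f''"
    and b: "\<beta> \<in> cells (Ho A \<Sigma>) g g'" and b': "\<beta>' \<in> cells (Ho A \<Sigma>) g' g''"
    and fg': "Cod (Ho A \<Sigma>) f = Dom (Ho A \<Sigma>) g"
  then have fg: "Cod A f = Dom A g" by simp
  obtain X Y where f: "f \<in> hom A X Y" "f' \<in> hom A X Y" using homotopy_seq_par[OF Ho_cells_rep(1)[OF a]] by blast
  obtain Z where g: "g \<in> hom A Y Z" "g' \<in> hom A Y Z"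
    using homotopy_seq_par[OF Ho_cells_rep(1)[OF b]] f fg by (auto simp: hom_def)
  have fg2: "Cod A f' = Dom A g'" using f g by (auto simp: hom_def)
  note aa = Ho_VComp(1)[OF a a'] and bb = Ho_VComp(1)[OF b b']
  note ba = Ho_HComp(1)[OF a b fg] and ba' = Ho_HComp(1)[OF a' b' fg2]
  show "(\<beta>' \<bullet>\<^bsub>Ho A \<Sigma>\<^esub> \<beta>) \<star>\<^bsub>Ho A \<Sigma>\<^esub> (\<alpha>' \<bullet>\<^bsub>Ho A \<Sigma>\<^esub> \<alpha>) = (\<beta>' \<star>\<^bsub>Ho A \<Sigma>\<^esub> \<alpha>') \<bullet>\<^bsub>Ho A \<Sigma>\<^esub> (\<beta> \<star>\<^bsub>Ho A \<Sigma>\<^esub> \<alpha>)"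
  proof (rule Ho_cell_eqI[OF Ho_HComp(1)[OF aa bb fg] Ho_VComp(1)[OF ba ba']])
    fix D F assume "homotopical_test (D :: ('o, 'a arr_word, 'a cell_word) two_cat) A \<Sigma> F"
    then interpret homotopical_test D A \<Sigma> F .
    show "hatc ((\<beta>' \<bullet>\<^bsub>Ho A \<Sigma>\<^esub> \<beta>) \<star>\<^bsub>Ho A \<Sigma>\<^esub> (\<alpha>' \<bullet>\<^bsub>Ho A \<Sigma>\<^esub> \<alpha>)) = hatc ((\<beta>' \<star>\<^bsub>Ho A \<Sigma>\<^esub> \<alpha>') \<bullet>\<^bsub>Ho A \<Sigma>\<^esub> (\<beta> \<star>\<^bsub>Ho A \<Sigma>\<^esub> \<alpha>))"
      using hatc_HComp[OF aa bb fg] hatc_VComp[OF ba ba'] hatc_VComp[OF a a'] hatc_VComp[OF b b']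
        hatc_HComp[OF a b fg] hatc_HComp[OF a' b' fg2]
        T.interchange_hom[OF hatc_cells[OF a] hatc_cells[OF a'] hatc_cells[OF b] hatc_cells[OF b'] T.Fhom[OF f(1)] T.Fhom[OF g(1)]]
      by simp
  qed
qed

theorem Ho_incl_two_functor: "is_two_functor (disc A) (Ho A \<Sigma>) (Ho_incl A \<Sigma>)"
proof -
  interpret H: two_category "Ho A \<Sigma>" by (rule two_category_Ho)
  have 1: "g \<cdot> f \<in> Arr A" "Ide2 (Ho A \<Sigma>) (g \<cdot> f) = Ide2 (Ho A \<Sigma>) g \<star>\<^bsub>Ho A \<Sigma>\<^esub> Ide2 (Ho A \<Sigma>) f"
    if "f \<in> Arr A" "g \<in> Arr A" "Dom A g = Cod A f" for f g
    using that Comp_hom[of f "Dom A f" "Cod A f" g "Cod A g"] H.HComp_Ide2[of f "Dom A f" "Cod A f" g "Cod A g"]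
    by (auto simp: hom_def)
  have 2: "Ide A X \<in> Arr A" if "X \<in> Obj A" for X using Ide_hom[OF that] by (simp add: hom_def)
  have 3: "Ide2 (Ho A \<Sigma>) f \<in> Cell (Ho A \<Sigma>)" "hSrc A \<Sigma> (Ide2 (Ho A \<Sigma>) f) = f" "hTrg A \<Sigma> (Ide2 (Ho A \<Sigma>) f) = f"
    "Ide2 (Ho A \<Sigma>) f \<bullet>\<^bsub>Ho A \<Sigma>\<^esub> Ide2 (Ho A \<Sigma>) f = Ide2 (Ho A \<Sigma>) f" if "f \<in> Arr A" for f
    using Ho_Ide2(1)[OF that] H.VComp_Ide2[OF Ho_Ide2(1)[OF that]] by (auto simp: cells_def)
  show ?thesis
    unfolding is_two_functor_def is_functor_def Ho_incl_def
    using 1 2 3 Dom_Obj Cod_Obj by (auto simp: disc_def)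
qed

end

section \<open>The replacement functors\<close>

lemma (in category) fcomp_functor:
  assumes "is_functor C D F" "is_functor D E G"
  shows "is_functor C E (fcomp C G F)"
proof -
  have "Dom C f \<in> Obj C" "Cod C f \<in> Obj C" if "f \<in> Arr C" for f using Dom_Obj Cod_Obj that by auto
  moreover have "Ide C X \<in> Arr C" if "X \<in> Obj C" for X using Ide_hom[OF that] by (simp add: hom_def)
  moreover have "g \<cdot> f \<in> Arr C" if "f \<in> Arr C" "g \<in> Arr C" "Dom C g = Cod C f" for f g
    using Comp_hom[of f "Dom C f" "Cod C f" g "Cod C g"] that by (simp add: hom_def)
  ultimately show ?thesis
    using assms by (auto simp: is_functor_def fcomp_def compose_def PiE_iff)
qed

context normal_model_category
begin

lemma from_z: "X \<in> Obj C \<Longrightarrow> the_arr C z X \<in> hom C z X"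
  "X \<in> Obj C \<Longrightarrow> f \<in> hom C z X \<Longrightarrow> the_arr C z X = f"
  using initial_z theI'[of "\<lambda>f. f \<in> hom C z X"] unfolding initial_def the_arr_def by (metis the_equality)+

lemma to_t: "X \<in> Obj C \<Longrightarrow> the_arr C X t \<in> hom C X t"
  "X \<in> Obj C \<Longrightarrow> f \<in> hom C X t \<Longrightarrow> the_arr C X t = f"
  using terminal_t theI'[of "\<lambda>f. f \<in> hom C X t"] unfolding terminal_def the_arr_def by (metis the_equality)+

lemma z: "z \<in> Obj C" and t: "t \<in> Obj C"
  using initial_z terminal_t by (auto simp: initial_def terminal_def)

lemma cofib_square:
  assumes f: "f \<in> hom C X Y"
  shows "square C (the_arr C z X) (the_arr C z Y) (Ide C z) f"
proof -
  have X: "X \<in> Obj C" "Y \<in> Obj C" using f Dom_Obj Cod_Obj by (auto simp: hom_def)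
  have "f \<cdot> the_arr C z X = the_arr C z Y" using from_z(2)[OF X(2)] Comp_hom[OF from_z(1)[OF X(1)] f] by simp
  then show ?thesis
    using from_z(1)[OF X(1)] from_z(1)[OF X(2)] f Ide_hom[OF z] Comp_Ide[of "the_arr C z Y"]
    by (auto simp: square_def hom_def)
qed

lemma fib_square:
  assumes f: "f \<in> hom C X Y"
  shows "square C (the_arr C X t) (the_arr C Y t) f (Ide C t)"
proof -
  have X: "X \<in> Obj C" "Y \<in> Obj C" using f Dom_Obj Cod_Obj by (auto simp: hom_def)
  have "the_arr C Y t \<cdot> f = the_arr C X t" using to_t(2)[OF X(1)] Comp_hom[OF f to_t(1)[OF X(2)]] by simp
  then show ?thesis
    using to_t(1)[OF X(1)] to_t(1)[OF X(2)] f Ide_hom[OF t] Ide_Comp[of "the_arr C X t"]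
    by (auto simp: square_def hom_def)
qed

lemma fact_lam:
  assumes "functorial_factorization C L R F" "f \<in> hom C X Y"
  shows "Lam F f \<in> L" "Lam F f \<in> hom C X (Mid F f)" "Rho F f \<in> R" "Rho F f \<in> hom C (Mid F f) Y"
  using assms by (auto simp: functorial_factorization_def hom_def)

lemma fact_mid: "functorial_factorization C L R F \<Longrightarrow> f \<in> hom C X Y \<Longrightarrow> Mid F f \<in> Obj C"
  using fact_lam(2)[of L R F f X Y] Cod_Obj[of "Lam F f"] by (auto simp: hom_def)

lemma fact_map:
  assumes "functorial_factorization C L R F"
  shows "square C f g u v \<Longrightarrow> Fmap F f g u v \<in> hom C (Mid F f) (Mid F g)"
    "f \<in> hom C X Y \<Longrightarrow> Fmap F f f (Ide C X) (Ide C Y) = Ide C (Mid F f)"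
    "square C f g u' v' \<Longrightarrow> square C g h u v
      \<Longrightarrow> Fmap F f h (u \<cdot> u') (v \<cdot> v') = Fmap F g h u v \<cdot> Fmap F f g u' v'"
  using assms unfolding functorial_factorization_def by (blast, auto simp: hom_def)

lemma cofib_repl_functor: "is_functor C C (cofib_repl C z \<Phi>)"
  unfolding is_functor_def cofib_repl_def fnctr.simps
proof (intro conjI ballI impI)
  have 1: "Mid \<Phi> (the_arr C z X) \<in> Obj C" if "X \<in> Obj C" for X
    using fact_mid[OF fact_\<Phi> from_z(1)[OF that]] .
  then show "(\<lambda>X\<in>Obj C. Mid \<Phi> (the_arr C z X)) \<in> Obj C \<rightarrow>\<^sub>E Obj C" by simp
  have 2: "Fmap \<Phi> (the_arr C z (Dom C f)) (the_arr C z (Cod C f)) (Ide C z) f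
      \<in> hom C (Mid \<Phi> (the_arr C z (Dom C f))) (Mid \<Phi> (the_arr C z (Cod C f)))" if "f \<in> Arr C" for f
    using fact_map(1)[OF fact_\<Phi> cofib_square[of f "Dom C f" "Cod C f"]] that by (simp add: hom_def)
  then show "(\<lambda>f\<in>Arr C. Fmap \<Phi> (the_arr C z (Dom C f)) (the_arr C z (Cod C f)) (Ide C z) f) \<in> Arr C \<rightarrow>\<^sub>E Arr C"
    by (auto simp: hom_def)
  fix f assume f: "f \<in> Arr C"
  show "Dom C ((\<lambda>f\<in>Arr C. Fmap \<Phi> (the_arr C z (Dom C f)) (the_arr C z (Cod C f)) (Ide C z) f) f)
      = (\<lambda>X\<in>Obj C. Mid \<Phi> (the_arr C z X)) (Dom C f)"
    "Cod C ((\<lambda>f\<in>Arr C. Fmap \<Phi> (the_arr C z (Dom C f)) (the_arr C z (Cod C f)) (Ide C z) f) f)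
      = (\<lambda>X\<in>Obj C. Mid \<Phi> (the_arr C z X)) (Cod C f)"
    using 2[OF f] f Dom_Obj Cod_Obj by (auto simp: hom_def)
  fix g assume g: "g \<in> Arr C" and fg: "Dom C g = Cod C f"
  have h: "f \<in> hom C (Dom C f) (Cod C f)" "g \<in> hom C (Cod C f) (Cod C g)" using f g fg by (auto simp: hom_def)
  have gf: "g \<cdot> f \<in> hom C (Dom C f) (Cod C g)" using Comp_hom[OF h] .
  have zz: "Ide C z \<cdot> Ide C z = Ide C z" using Comp_Ide[of "Ide C z"] Ide_hom[OF z] by (auto simp: hom_def)
  show "(\<lambda>f\<in>Arr C. Fmap \<Phi> (the_arr C z (Dom C f)) (the_arr C z (Cod C f)) (Ide C z) f) (g \<cdot> f)
    = (\<lambda>f\<in>Arr C. Fmap \<Phi> (the_arr C z (Dom C f)) (the_arr C z (Cod C f)) (Ide C z) f) g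
      \<cdot> (\<lambda>f\<in>Arr C. Fmap \<Phi> (the_arr C z (Dom C f)) (the_arr C z (Cod C f)) (Ide C z) f) f"
    using fact_map(3)[OF fact_\<Phi> cofib_square[OF h(1)] cofib_square[OF h(2)]] zz f g fg gf
    by (auto simp: hom_def)
next
  fix X assume X: "X \<in> Obj C"
  show "(\<lambda>f\<in>Arr C. Fmap \<Phi> (the_arr C z (Dom C f)) (the_arr C z (Cod C f)) (Ide C z) f) (Ide C X)
    = Ide C ((\<lambda>X\<in>Obj C. Mid \<Phi> (the_arr C z X)) X)"
    using fact_map(2)[OF fact_\<Phi> from_z(1)[OF X]] Ide_hom[OF X] X by (auto simp: hom_def)
qed

lemma fib_repl_functor: "is_functor C C (fib_repl C t \<Psi>)"
  unfolding is_functor_def fib_repl_def fnctr.simps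
proof (intro conjI ballI impI)
  have 1: "Mid \<Psi> (the_arr C X t) \<in> Obj C" if "X \<in> Obj C" for X
    using fact_mid[OF fact_\<Psi> to_t(1)[OF that]] .
  then show "(\<lambda>X\<in>Obj C. Mid \<Psi> (the_arr C X t)) \<in> Obj C \<rightarrow>\<^sub>E Obj C" by simp
  have 2: "Fmap \<Psi> (the_arr C (Dom C f) t) (the_arr C (Cod C f) t) f (Ide C t)
      \<in> hom C (Mid \<Psi> (the_arr C (Dom C f) t)) (Mid \<Psi> (the_arr C (Cod C f) t))" if "f \<in> Arr C" for f
    using fact_map(1)[OF fact_\<Psi> fib_square[of f "Dom C f" "Cod C f"]] that by (simp add: hom_def)
  then show "(\<lambda>f\<in>Arr C. Fmap \<Psi> (the_arr C (Dom C f) t) (the_arr C (Cod C f) t) f (Ide C t)) \<in> Arr C \<rightarrow>\<^sub>E Arr C"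
    by (auto simp: hom_def)
  fix f assume f: "f \<in> Arr C"
  show "Dom C ((\<lambda>f\<in>Arr C. Fmap \<Psi> (the_arr C (Dom C f) t) (the_arr C (Cod C f) t) f (Ide C t)) f)
      = (\<lambda>X\<in>Obj C. Mid \<Psi> (the_arr C X t)) (Dom C f)"
    "Cod C ((\<lambda>f\<in>Arr C. Fmap \<Psi> (the_arr C (Dom C f) t) (the_arr C (Cod C f) t) f (Ide C t)) f)
      = (\<lambda>X\<in>Obj C. Mid \<Psi> (the_arr C X t)) (Cod C f)"
    using 2[OF f] f Dom_Obj Cod_Obj by (auto simp: hom_def)
  fix g assume g: "g \<in> Arr C" and fg: "Dom C g = Cod C f"
  have h: "f \<in> hom C (Dom C f) (Cod C f)" "g \<in> hom C (Cod C f) (Cod C g)" using f g fg by (auto simp: hom_def)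
  have gf: "g \<cdot> f \<in> hom C (Dom C f) (Cod C g)" using Comp_hom[OF h] .
  have tt: "Ide C t \<cdot> Ide C t = Ide C t" using Comp_Ide[of "Ide C t"] Ide_hom[OF t] by (auto simp: hom_def)
  show "(\<lambda>f\<in>Arr C. Fmap \<Psi> (the_arr C (Dom C f) t) (the_arr C (Cod C f) t) f (Ide C t)) (g \<cdot> f)
    = (\<lambda>f\<in>Arr C. Fmap \<Psi> (the_arr C (Dom C f) t) (the_arr C (Cod C f) t) f (Ide C t)) g
      \<cdot> (\<lambda>f\<in>Arr C. Fmap \<Psi> (the_arr C (Dom C f) t) (the_arr C (Cod C f) t) f (Ide C t)) f"
    using fact_map(3)[OF fact_\<Psi> fib_square[OF h(1)] fib_square[OF h(2)]] tt f g fg gf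
    by (auto simp: hom_def)
next
  fix X assume X: "X \<in> Obj C"
  show "(\<lambda>f\<in>Arr C. Fmap \<Psi> (the_arr C (Dom C f) t) (the_arr C (Cod C f) t) f (Ide C t)) (Ide C X)
    = Ide C ((\<lambda>X\<in>Obj C. Mid \<Psi> (the_arr C X t)) X)"
    using fact_map(2)[OF fact_\<Psi> to_t(1)[OF X]] Ide_hom[OF X] X by (auto simp: hom_def)
qed

lemma RQ_fibrant_cofibrant:
  assumes X: "X \<in> Obj C"
  shows "cofibrant C Cof z (Fob (RQ_functor C z t \<Phi> \<Psi>) X)" "fibrant C Fib t (Fob (RQ_functor C z t \<Phi> \<Psi>) X)"
proof -
  define Y where "Y = Mid \<Phi> (the_arr C z X)"
  have Y: "Y \<in> Obj C" unfolding Y_def using fact_mid[OF fact_\<Phi> from_z(1)[OF X]] .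
  define Z where "Z = Mid \<Psi> (the_arr C Y t)"
  have Z: "Z \<in> Obj C" unfolding Z_def using fact_mid[OF fact_\<Psi> to_t(1)[OF Y]] .
  have RQ: "Fob (RQ_functor C z t \<Phi> \<Psi>) X = Z"
    using X Y by (simp add: RQ_functor_def fcomp_def compose_def fib_repl_def cofib_repl_def Y_def Z_def)
  note l = fact_lam[OF fact_\<Phi> from_z(1)[OF X], folded Y_def] fact_lam[OF fact_\<Psi> to_t(1)[OF Y], folded Z_def]
  have "the_arr C z Z = Lam \<Psi> (the_arr C Y t) \<cdot> Lam \<Phi> (the_arr C z X)"
    using from_z(2)[OF Z] Comp_hom[OF l(2,6)] by simp
  moreover have "Lam \<Psi> (the_arr C Y t) \<cdot> Lam \<Phi> (the_arr C z X) \<in> Cof"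
    using composites(1) l(1,2,5,6) by (auto simp: comp_closed_def hom_def)
  ultimately show "cofibrant C Cof z (Fob (RQ_functor C z t \<Phi> \<Psi>) X)"
    using Z RQ by (simp add: cofibrant_def)
  show "fibrant C Fib t (Fob (RQ_functor C z t \<Phi> \<Psi>) X)"
    using Z RQ to_t(2)[OF Z l(8)] l(7) by (simp add: fibrant_def)
qed

theorem RQ_corestriction:
  shows "is_functor C (fibrant_cofibrant C Cof Fib z t) (RQ_functor C z t \<Phi> \<Psi>)"
    and "fcomp C (incl_functor (fibrant_cofibrant C Cof Fib z t)) (RQ_functor C z t \<Phi> \<Psi>) = RQ_functor C z t \<Phi> \<Psi>"
proof -
  have F: "is_functor C C (RQ_functor C z t \<Phi> \<Psi>)"
    unfolding RQ_functor_def using fcomp_functor[OF cofib_repl_functor fib_repl_functor] .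
  have simps: "Dom (fibrant_cofibrant C Cof Fib z t) = Dom C" "Cod (fibrant_cofibrant C Cof Fib z t) = Cod C"
    "Ide (fibrant_cofibrant C Cof Fib z t) = Ide C" "Comp (fibrant_cofibrant C Cof Fib z t) = Comp C"
    by (simp_all add: fibrant_cofibrant_def full_subcat_def)
  have o: "Fob (RQ_functor C z t \<Phi> \<Psi>) X \<in> Obj (fibrant_cofibrant C Cof Fib z t)" if "X \<in> Obj C" for X
    using F that RQ_fibrant_cofibrant[OF that]
    by (auto simp: is_functor_def fibrant_cofibrant_def full_subcat_def)
  have a: "Far (RQ_functor C z t \<Phi> \<Psi>) f \<in> Arr (fibrant_cofibrant C Cof Fib z t)" if f: "f \<in> Arr C" for f
    using F f RQ_fibrant_cofibrant[OF Dom_Obj[OF f]] RQ_fibrant_cofibrant[OF Cod_Obj[OF f]]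
    by (auto simp: is_functor_def fibrant_cofibrant_def full_subcat_def)
  show "is_functor C (fibrant_cofibrant C Cof Fib z t) (RQ_functor C z t \<Phi> \<Psi>)"
    using F o a unfolding is_functor_def simps by (auto simp: PiE_iff)
  have e: "Fob (RQ_functor C z t \<Phi> \<Psi>) \<in> extensional (Obj C)" "Far (RQ_functor C z t \<Phi> \<Psi>) \<in> extensional (Arr C)"
    using F by (auto simp: is_functor_def PiE_iff)
  have "Fob (fcomp C (incl_functor (fibrant_cofibrant C Cof Fib z t)) (RQ_functor C z t \<Phi> \<Psi>)) = Fob (RQ_functor C z t \<Phi> \<Psi>)"
    "Far (fcomp C (incl_functor (fibrant_cofibrant C Cof Fib z t)) (RQ_functor C z t \<Phi> \<Psi>)) = Far (RQ_functor C z t \<Phi> \<Psi>)"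
    using o a e by (auto simp: fcomp_def incl_functor_def compose_def extensional_def fun_eq_iff)
  then show "fcomp C (incl_functor (fibrant_cofibrant C Cof Fib z t)) (RQ_functor C z t \<Phi> \<Psi>) = RQ_functor C z t \<Phi> \<Psi>"
    by (intro fnctr.equality) auto
qed

end

end

theory Submission
  imports Defs
begin

text \<open>
  The 2-category \<open>Ho A \<Sigma>\<close> is universal among 2-categories under \<open>A\<close> in which \<open>\<Sigma>\<close> becomes
  equivalences.  Sending the class of a sequence to its hat gives existence.  For uniqueness, the
  class \<open>[(K, id)]\<close> of a cylinder \<open>K = (W, Z, d\<^sub>0, d\<^sub>1, s, x)\<close> satisfies \<open>s [(K, id)] = x\<close> already in
  \<open>Ho A \<Sigma>\<close>, so a 2-functor must send it to the unique 2-cell with this property; and the classes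
  \<open>[(K, h)] = h [(K, id)]\<close> generate all 2-cells.  Note that \<open>Ho_incl A \<Sigma>\<close> itself is not assumed to
  invert \<open>\<Sigma>\<close>.

  It remains that \<open>q\<close> and \<open>i j\<close> invert the weak equivalences.  The functor \<open>RQ\<close> preserves them by
  3-for-2, and a weak equivalence between fibrant-cofibrant objects has a homotopy inverse, with
  homotopies whose cylinders lie in \<open>C\<^sub>f\<^sub>c\<close>, hence also in \<open>C\<close>.
\<close>

section \<open>The universal property of the homotopy 2-category\<close>

context homotopical
begin

text \<open>Over a homotopical category every test functor of \<open>homotopy_eq\<close> is a
  \<open>homotopical_test\<close>, so the rules for hats of composites, whiskerings and identities
  become available for comparing sequences.\<close>

lemma hclass_eq_hatI:
  assumes "homotopy_seq A \<Sigma> f g Hs" "homotopy_seq A \<Sigma> f g Ks"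
    and "\<And>D F. homotopical_test (D :: ('o, 'a arr_word, 'a cell_word) two_cat) A \<Sigma> F
      \<Longrightarrow> hat_seq D F Hs = hat_seq D F Ks"
  shows "hclass A \<Sigma> Hs = hclass A \<Sigma> Ks"
  using homotopy_eqI[OF assms(1,2)] assms(3) homotopical_axioms hclass_eqI
  by (simp add: homotopical_test_def)

lemma hclass_cells: "homotopy_seq A \<Sigma> f g Hs \<Longrightarrow> hclass A \<Sigma> Hs \<in> cells (Ho A \<Sigma>) f g"
  unfolding Ho_cells by blast

text \<open>Vertical composition in \<open>Ho A \<Sigma>\<close> is defined through the
  representatives chosen by \<open>hrep\<close>. These have the same hats as the given sequences, so
  the choice does not matter.\<close>

lemma hclass_append:
  assumes "homotopy_seq A \<Sigma> f g Hs" "homotopy_seq A \<Sigma> g h Ks"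
  shows "hclass A \<Sigma> (Ks @ Hs) = hclass A \<Sigma> Ks \<bullet>\<^bsub>Ho A \<Sigma>\<^esub> hclass A \<Sigma> Hs"
proof -
  have "hclass A \<Sigma> (Ks @ Hs) = hclass A \<Sigma> (hrep (hclass A \<Sigma> Ks) @ hrep (hclass A \<Sigma> Hs))"
  proof (rule hclass_eq_hatI)
    show "homotopy_seq A \<Sigma> f h (Ks @ Hs)"
      using homotopy_seq_append[OF assms] .
    show "homotopy_seq A \<Sigma> f h (hrep (hclass A \<Sigma> Ks) @ hrep (hclass A \<Sigma> Hs))"
      using homotopy_seq_append[OF hrep_seq[OF assms(1)] hrep_seq[OF assms(2)]] .
    fix D :: "('o, 'a arr_word, 'a cell_word) two_cat" and F
    assume "homotopical_test D A \<Sigma> F"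
    then interpret homotopical_test D A \<Sigma> F .
    show "hat_seq D F (Ks @ Hs) = hat_seq D F (hrep (hclass A \<Sigma> Ks) @ hrep (hclass A \<Sigma> Hs))"
      using hat_append[OF assms] hat_append[OF hrep_seq[OF assms(1)] hrep_seq[OF assms(2)]]
        hatc_class[OF assms(1)] hatc_class[OF assms(2)] by simp
  qed
  then show ?thesis by (simp add: Ho_def)
qed

text \<open>The horizontal composite also contains the right whiskerings of a representative of the
  identity of \<open>r\<close>, so the two sides come from different sequences. Every test functor
  nevertheless gives both the value \<open>Ide2 D (Far F r) \<star> hat D F H\<close>.\<close>

lemma hclass_whisk_left:
  assumes H: "is_homotopy A \<Sigma> f g H" and f: "f \<in> hom A X Y" and r: "r \<in> hom A Y Z"
  shows "hclass A \<Sigma> [whisk_left A r H] = Ide2 (Ho A \<Sigma>) r \<star>\<^bsub>Ho A \<Sigma>\<^esub> hclass A \<Sigma> [H]"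
proof (rule Ho_cell_eqI)
  note w = homotopy_seq.single[OF whisk_left_homotopy[OF H f r]]
  note c = hclass_cells[OF homotopy_seq.single[OF H]]
  have r': "r \<in> Arr A" "Cod A f = Dom A r" using f r by (auto simp: hom_def)
  show "hclass A \<Sigma> [whisk_left A r H] \<in> cells (Ho A \<Sigma>) (r \<cdot> f) (r \<cdot> g)"
    using hclass_cells[OF w] .
  show "Ide2 (Ho A \<Sigma>) r \<star>\<^bsub>Ho A \<Sigma>\<^esub> hclass A \<Sigma> [H] \<in> cells (Ho A \<Sigma>) (r \<cdot> f) (r \<cdot> g)"
    using Ho_HComp(1)[OF c Ho_Ide2(1)] r' by blast
  fix D :: "('o, 'a arr_word, 'a cell_word) two_cat" and F
  assume "homotopical_test D A \<Sigma> F"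
  then interpret homotopical_test D A \<Sigma> F .
  show "hatc (hclass A \<Sigma> [whisk_left A r H]) = hatc (Ide2 (Ho A \<Sigma>) r \<star>\<^bsub>Ho A \<Sigma>\<^esub> hclass A \<Sigma> [H])"
    using hatc_class[OF w] hatc_HComp[OF c Ho_Ide2(1)] r' hatc_Ide2 hat_whisk_left[OF H f r]
      hatc_class[OF homotopy_seq.single[OF H]] by simp
qed

lemma cyl_homotopy:
  assumes "is_cylinder A \<Sigma> X K" "r \<in> hom A (cW K) Y"
  shows "is_homotopy A \<Sigma> (r \<cdot> cd0 K) (r \<cdot> cd1 K) (K, r)"
  using assms Comp_hom[OF _ assms(2), of _ X] by (auto simp: is_homotopy_def is_cylinder_def)

text \<open>Whiskering \<open>(K, id)\<close> on the left by \<open>r\<close> is literally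
  \<open>(K, r)\<close>. Hence one 2-cell per cylinder controls all homotopies with that
  cylinder.\<close>

lemma hclass_cyl:
  assumes K: "is_cylinder A \<Sigma> X K" and r: "r \<in> hom A (cW K) Y"
  shows "hclass A \<Sigma> [(K, r)] = Ide2 (Ho A \<Sigma>) r \<star>\<^bsub>Ho A \<Sigma>\<^esub> hclass A \<Sigma> [(K, Ide A (cW K))]"
    "hclass A \<Sigma> [(K, Ide A (cW K))] \<in> cells (Ho A \<Sigma>) (cd0 K) (cd1 K)"
proof -
  have d: "cd0 K \<in> hom A X (cW K)" "cd1 K \<in> hom A X (cW K)" using K by (auto simp: is_cylinder_def)
  have W: "Ide A (cW K) \<in> hom A (cW K) (cW K)" using d(1) Cod_Obj[of "cd0 K"] by (intro Ide_hom) (auto simp: hom_def)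
  have H: "is_homotopy A \<Sigma> (cd0 K) (cd1 K) (K, Ide A (cW K))"
    using cyl_homotopy[OF K W] Ide_Comp[of "cd0 K"] Ide_Comp[of "cd1 K"] d by (simp add: hom_def)
  have "whisk_left A r (K, Ide A (cW K)) = (K, r)"
    using Comp_Ide[of r] r by (simp add: whisk_left_def hom_def)
  then show "hclass A \<Sigma> [(K, r)] = Ide2 (Ho A \<Sigma>) r \<star>\<^bsub>Ho A \<Sigma>\<^esub> hclass A \<Sigma> [(K, Ide A (cW K))]"
    using hclass_whisk_left[OF H d(1) r] by simp
  show "hclass A \<Sigma> [(K, Ide A (cW K))] \<in> cells (Ho A \<Sigma>) (cd0 K) (cd1 K)"
    using hclass_cells[OF homotopy_seq.single[OF H]] .
qed

text \<open>The left side is the class of \<open>(K, s)\<close>. Its hat is \<open>F s\<close>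
  applied to the cell of the cylinder, which is the identity of \<open>F x\<close> by the very
  definition of that cell; this is also the hat of the identity homotopy of
  \<open>x\<close>.\<close>

lemma hclass_cyl_s:
  assumes K: "is_cylinder A \<Sigma> X K"
  shows "Ide2 (Ho A \<Sigma>) (cs K) \<star>\<^bsub>Ho A \<Sigma>\<^esub> hclass A \<Sigma> [(K, Ide A (cW K))] = Ide2 (Ho A \<Sigma>) (cx K)"
proof -
  have s: "cs K \<in> hom A (cW K) (cZ K)" "cs K \<cdot> cd0 K = cx K" "cs K \<cdot> cd1 K = cx K"
    "cx K \<in> hom A X (cZ K)" using K by (auto simp: is_cylinder_def)
  have "hclass A \<Sigma> [(K, cs K)] = hclass A \<Sigma> [id_homotopy A (cx K)]"
  proof (rule hclass_eq_hatI)
    show "homotopy_seq A \<Sigma> (cx K) (cx K) [(K, cs K)]"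
      using homotopy_seq.single[OF cyl_homotopy[OF K s(1)]] s(2,3) by simp
    show "homotopy_seq A \<Sigma> (cx K) (cx K) [id_homotopy A (cx K)]"
      using homotopy_seq.single[OF id_homotopy[OF s(4)]] .
    fix D :: "('o, 'a arr_word, 'a cell_word) two_cat" and F
    assume "homotopical_test D A \<Sigma> F"
    then interpret homotopical_test D A \<Sigma> F .
    show "hat_seq D F [(K, cs K)] = hat_seq D F [id_homotopy A (cx K)]"
      using hat_id[OF s(4)] T.hat_cyl(2)[OF K] by (simp add: hat_def)
  qed
  then show ?thesis using hclass_cyl(1)[OF K s(1)] by (simp add: Ho_def)
qed

end

section \<open>Factoring a 2-functor that inverts \<open>\<Sigma>\<close> through
  \<open>Ho A \<Sigma>\<close>\<close>

context homotopical_test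
begin

text \<open>\<open>hatc\<close> evaluates a chosen representative. By
  \<open>homotopy_eq_universal\<close>, the result depends only on the class, for a target
  \<open>D\<close> of any type; compatibility with the three operations is \<open>hatc_Ide2\<close>,
  \<open>hatc_VComp\<close> and \<open>hatc_HComp\<close>.\<close>

lemma Ho_factor:
  defines "G \<equiv> \<lparr>Fob = Fob F, Far = Far F, Fce = restrict hatc (Cell (Ho A \<Sigma>))\<rparr>"
  shows "is_two_functor (Ho A \<Sigma>) D G" "two_comp (disc A) G (Ho_incl A \<Sigma>) = F"
proof -
  interpret H: two_category "Ho A \<Sigma>" by (rule two_category_Ho)
  have c: "\<alpha> \<in> cells (Ho A \<Sigma>) (hSrc A \<Sigma> \<alpha>) (hTrg A \<Sigma> \<alpha>)" if "\<alpha> \<in> Cell (Ho A \<Sigma>)" for \<alpha>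
    using that by (simp add: cells_def)
  have par: "Dom A (hTrg A \<Sigma> \<alpha>) = Dom A (hSrc A \<Sigma> \<alpha>)" "Cod A (hTrg A \<Sigma> \<alpha>) = Cod A (hSrc A \<Sigma> \<alpha>)"
    if "\<alpha> \<in> Cell (Ho A \<Sigma>)" for \<alpha>
    using H.Src_Trg[OF that] by (auto simp: hom_def)
  have GF: "is_functor (Ho A \<Sigma>) D G"
    using T.F' by (simp add: is_functor_def G_def)
  have V: "\<beta> \<bullet>\<^bsub>Ho A \<Sigma>\<^esub> \<alpha> \<in> Cell (Ho A \<Sigma>)"
    if "\<alpha> \<in> Cell (Ho A \<Sigma>)" "\<beta> \<in> Cell (Ho A \<Sigma>)" "hSrc A \<Sigma> \<beta> = hTrg A \<Sigma> \<alpha>" for \<alpha> \<beta>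
    using H.VComp_cells[OF c[OF that(1)], of \<beta> "hTrg A \<Sigma> \<beta>"] c[OF that(2)] that(3) cellsD by fastforce
  have Hc: "\<beta> \<star>\<^bsub>Ho A \<Sigma>\<^esub> \<alpha> \<in> Cell (Ho A \<Sigma>)"
    if "\<alpha> \<in> Cell (Ho A \<Sigma>)" "\<beta> \<in> Cell (Ho A \<Sigma>)" "Dom A (hSrc A \<Sigma> \<beta>) = Cod A (hSrc A \<Sigma> \<alpha>)" for \<alpha> \<beta>
    using H.HComp_cells[OF c[OF that(1)] c[OF that(2)]] that(3) cellsD by fastforce
  have I: "Ide2 (Ho A \<Sigma>) f \<in> Cell (Ho A \<Sigma>)" if "f \<in> Arr A" for f
    using Ho_Ide2(1)[OF that] cellsD by fast
  show "is_two_functor (Ho A \<Sigma>) D G"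
    unfolding is_two_functor_def
  proof (intro conjI ballI impI)
    show "is_functor (Ho A \<Sigma>) D G" by (rule GF)
    show "Fce G \<in> Cell (Ho A \<Sigma>) \<rightarrow>\<^sub>E Cell D"
      using hatc_cells[OF c] by (auto simp: G_def cells_def)
  next
    fix \<alpha> assume a: "\<alpha> \<in> Cell (Ho A \<Sigma>)"
    show "Src D (Fce G \<alpha>) = Far G (Src (Ho A \<Sigma>) \<alpha>)" "Trg D (Fce G \<alpha>) = Far G (Trg (Ho A \<Sigma>) \<alpha>)"
      using hatc_cells[OF c[OF a]] a by (auto simp: G_def cells_def)
  next
    fix f assume "f \<in> Arr (Ho A \<Sigma>)"
    then show "Fce G (Ide2 (Ho A \<Sigma>) f) = Ide2 D (Far G f)"
      using hatc_Ide2 I by (simp add: G_def)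
  next
    fix \<alpha> \<beta> assume a: "\<alpha> \<in> Cell (Ho A \<Sigma>)" "\<beta> \<in> Cell (Ho A \<Sigma>)" "Src (Ho A \<Sigma>) \<beta> = Trg (Ho A \<Sigma>) \<alpha>"
    then show "Fce G (\<beta> \<bullet>\<^bsub>Ho A \<Sigma>\<^esub> \<alpha>) = Fce G \<beta> \<bullet>\<^bsub>D\<^esub> Fce G \<alpha>"
      using hatc_VComp[OF c[OF a(1)], of \<beta> "hTrg A \<Sigma> \<beta>"] c[OF a(2)] V by (simp add: G_def)
  next
    fix \<alpha> \<beta> assume a: "\<alpha> \<in> Cell (Ho A \<Sigma>)" "\<beta> \<in> Cell (Ho A \<Sigma>)"
      "Dom (Ho A \<Sigma>) (Src (Ho A \<Sigma>) \<beta>) = Cod (Ho A \<Sigma>) (Src (Ho A \<Sigma>) \<alpha>)"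
    then show "Fce G (\<beta> \<star>\<^bsub>Ho A \<Sigma>\<^esub> \<alpha>) = Fce G \<beta> \<star>\<^bsub>D\<^esub> Fce G \<alpha>"
      using hatc_HComp[OF c[OF a(1)] c[OF a(2)]] Hc by (simp add: G_def)
  qed
  have e: "Fob F \<in> extensional (Obj A)" "Far F \<in> extensional (Arr A)" "Fce F \<in> extensional (Arr A)"
    using T.F by (auto simp: is_two_functor_def is_functor_def PiE_iff)
  \<comment> \<open>The 2-cells of \<open>disc A\<close> are the identities of arrows, so
    \<open>Fce F\<close> is determined by \<open>Far F\<close>.\<close>
  have "Fce F f = Ide2 D (Far F f)" if "f \<in> Arr A" for f
    using T.F that by (simp add: is_two_functor_def)
  then show "two_comp (disc A) G (Ho_incl A \<Sigma>) = F"
    using e I hatc_Ide2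
    by (intro two_fnctr.equality)
      (auto simp: two_comp_def Ho_incl_def G_def compose_def extensional_def fun_eq_iff)
qed

text \<open>\<open>G\<close> carries the equation of \<open>hclass_cyl_s\<close> to the equation in
  \<open>D\<close> that characterizes \<open>hat_cyl D F K\<close>. Whiskering with \<open>h\<close>
  then gives the hat of \<open>(K, h)\<close>.\<close>

lemma Ho_factor_hat:
  assumes G: "is_two_functor (Ho A \<Sigma>) D G" and GF: "\<And>f. f \<in> Arr A \<Longrightarrow> Far G f = Far F f"
    and H: "is_homotopy A \<Sigma> f g H"
  shows "Fce G (hclass A \<Sigma> [H]) = hat D F H"
proof -
  have whisk: "Fce G (Ide2 (Ho A \<Sigma>) r \<star>\<^bsub>Ho A \<Sigma>\<^esub> \<alpha>) = Ide2 D (Far F r) \<star>\<^bsub>D\<^esub> Fce G \<alpha>"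
    if "r \<in> hom A Y Z" "\<alpha> \<in> cells (Ho A \<Sigma>) f g" "f \<in> hom A X Y" for r Y Z \<alpha> f g X
    using G that Ho_Ide2(1)[of r] GF[of r] by (auto simp: is_two_functor_def cells_def hom_def)
  obtain X Y K h where Kh: "H = (K, h)" "is_cylinder A \<Sigma> X K" "h \<in> hom A (cW K) Y"
    using H by (cases H) (auto simp: is_homotopy_def)
  note c = hclass_cyl[OF Kh(2,3)]
  have d: "cd0 K \<in> hom A X (cW K)" "cd1 K \<in> hom A X (cW K)" "cs K \<in> hom A (cW K) (cZ K)"
    "cx K \<in> hom A X (cZ K)" using Kh(2) by (auto simp: is_cylinder_def)
  then have a: "cd0 K \<in> Arr A" "cd1 K \<in> Arr A" "cx K \<in> Arr A" by (auto simp: hom_def)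
  have "Fce G (Ide2 (Ho A \<Sigma>) (cx K)) = Ide2 D (Far F (cx K))"
    using G GF a(3) by (simp add: is_two_functor_def)
  then have "hat_cyl D F K = Fce G (hclass A \<Sigma> [(K, Ide A (cW K))])"
    using T.hat_cyl_eqI[OF Kh(2)] two_functor_cells[OF G c(2)] GF a
      whisk[OF d(3) c(2) d(1)] hclass_cyl_s[OF Kh(2)] by simp
  then show ?thesis
    using whisk[OF Kh(3) c(2) d(1)] c(1) Kh(1) by (simp add: hat_def)
qed

lemma Ho_factor_hat_seq:
  assumes G: "is_two_functor (Ho A \<Sigma>) D G" and GF: "\<And>f. f \<in> Arr A \<Longrightarrow> Far G f = Far F f"
  shows "homotopy_seq A \<Sigma> f g Hs \<Longrightarrow> Fce G (hclass A \<Sigma> Hs) = hat_seq D F Hs"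
proof (induction rule: homotopy_seq.induct)
  case (single g H)
  then show ?case using Ho_factor_hat[OF G GF] by simp
next
  case (step g Hs h H)
  note s = homotopy_seq.single[OF step(2)]
  have "hclass A \<Sigma> (H # Hs) = hclass A \<Sigma> [H] \<bullet>\<^bsub>Ho A \<Sigma>\<^esub> hclass A \<Sigma> Hs"
    using hclass_append[OF step(1) s] by simp
  moreover have "Fce G (hclass A \<Sigma> [H] \<bullet>\<^bsub>Ho A \<Sigma>\<^esub> hclass A \<Sigma> Hs)
      = Fce G (hclass A \<Sigma> [H]) \<bullet>\<^bsub>D\<^esub> Fce G (hclass A \<Sigma> Hs)"
    using G hclass_cells[OF step(1)] hclass_cells[OF s] by (auto simp: is_two_functor_def cells_def)
  ultimately show ?case
    using Ho_factor_hat[OF G GF step(2)] step.IH T.hat_seq_Cons[OF homotopy_seq_ne[OF step(1)]] by simp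
qed

theorem Ho_universal:
  "\<exists>!G. is_two_functor (Ho A \<Sigma>) D G \<and> two_comp (disc A) G (Ho_incl A \<Sigma>) = F"
proof (rule ex_ex1I)
  show "\<exists>G. is_two_functor (Ho A \<Sigma>) D G \<and> two_comp (disc A) G (Ho_incl A \<Sigma>) = F"
    using Ho_factor by blast
  fix G G'
  assume G: "is_two_functor (Ho A \<Sigma>) D G \<and> two_comp (disc A) G (Ho_incl A \<Sigma>) = F"
    and G': "is_two_functor (Ho A \<Sigma>) D G' \<and> two_comp (disc A) G' (Ho_incl A \<Sigma>) = F"
  \<comment> \<open>Each 2-cell is the class of its own representative, so any factorization agrees
    with \<open>hatc\<close> on cells. Extensionality turns this agreement into equality of
    2-functors.\<close>
  have on: "Fob E = Fob F \<and> Far E = Far F \<and> (\<forall>\<alpha> \<in> Cell (Ho A \<Sigma>). Fce E \<alpha> = hatc \<alpha>) \<and>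
      Fce E \<in> extensional (Cell (Ho A \<Sigma>))"
    if E: "is_two_functor (Ho A \<Sigma>) D E" and EF: "two_comp (disc A) E (Ho_incl A \<Sigma>) = F" for E
  proof -
    have e: "Fob E \<in> extensional (Obj A)" "Far E \<in> extensional (Arr A)" "Fce E \<in> extensional (Cell (Ho A \<Sigma>))"
      using E by (auto simp: is_two_functor_def is_functor_def PiE_iff)
    have FE: "Fob E = Fob F" "Far E = Far F"
      unfolding EF[symmetric] using e(1,2)
      by (auto simp: two_comp_def Ho_incl_def compose_def extensional_def fun_eq_iff)
    have "Fce E \<alpha> = hatc \<alpha>" if a: "\<alpha> \<in> Cell (Ho A \<Sigma>)" for \<alpha>
    proof -
      obtain f g where "\<alpha> \<in> cells (Ho A \<Sigma>) f g" using a by (simp add: cells_def)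
      from Ho_cells_rep(1,2)[OF this] show ?thesis using Ho_factor_hat_seq[OF E, of f g "hrep \<alpha>"] FE by simp
    qed
    then show ?thesis using FE e(3) by blast
  qed
  have "Fce G = Fce G'"
    using on[of G] on[of G'] G G' by (metis (no_types, lifting) extensionalityI)
  then show "G = G'" using on[of G] on[of G'] G G' by (intro two_fnctr.equality) auto
qed

end

section \<open>Weak equivalences between fibrant-cofibrant objects\<close>

context homotopical
begin

text \<open>Exchange the two ends of the cylinder. After whiskering with \<open>F s\<close>, both
  the composite of the two cylinder cells and the identity of \<open>F d0\<close> become the
  identity of \<open>F x\<close>, so they agree because \<open>F s\<close> is an
  equivalence.\<close>

lemma homotopy_rev:
  assumes "is_homotopy A \<Sigma> f g (Cylinder W Z d0 d1 s x, h)"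
  shows "is_homotopy A \<Sigma> g f (Cylinder W Z d1 d0 s x, h)"
    and "hclass A \<Sigma> [(Cylinder W Z d1 d0 s x, h)] \<bullet>\<^bsub>Ho A \<Sigma>\<^esub> hclass A \<Sigma> [(Cylinder W Z d0 d1 s x, h)] = Ide2 (Ho A \<Sigma>) f"
proof -
  let ?K = "Cylinder W Z d0 d1 s x" and ?L = "Cylinder W Z d1 d0 s x"
  obtain X Y where h: "f \<in> hom A X Y" "is_cylinder A \<Sigma> X ?K" "h \<in> hom A W Y" "h \<cdot> d0 = f" "h \<cdot> d1 = g"
    using assms by (auto simp: is_homotopy_def)
  have d: "d0 \<in> hom A X W" "d1 \<in> hom A X W" "s \<in> hom A W Z" "x \<in> hom A X Z" "s \<cdot> d0 = x"
    using h(2) by (auto simp: is_cylinder_def)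
  show L: "is_homotopy A \<Sigma> g f (?L, h)"
    using assms by (auto simp: is_homotopy_def is_cylinder_def)
  \<comment> \<open>The degenerate cylinder with both ends \<open>d0\<close> makes the uniqueness of
    cylinder cells apply to endocells of \<open>F d0\<close>.\<close>
  have cyl: "is_cylinder A \<Sigma> X ?L" "is_cylinder A \<Sigma> X (Cylinder W Z d0 d0 s x)"
    using h(2) by (auto simp: is_cylinder_def)
  note s1 = homotopy_seq.single[OF assms] and s2 = homotopy_seq.single[OF L]
  have f: "f \<in> Arr A" using h(1) by (simp add: hom_def)
  have "hclass A \<Sigma> ([(?L, h)] @ [(?K, h)]) = hclass A \<Sigma> [id_homotopy A f]"
  proof (rule hclass_eq_hatI)
    show "homotopy_seq A \<Sigma> f f ([(?L, h)] @ [(?K, h)])" using homotopy_seq_append[OF s1 s2] .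
    show "homotopy_seq A \<Sigma> f f [id_homotopy A f]" using Ho_Ide2(2)[OF f] .
    fix D :: "('o, 'a arr_word, 'a cell_word) two_cat" and F
    assume "homotopical_test D A \<Sigma> F"
    then interpret homotopical_test D A \<Sigma> F .
    note K = T.hat_cyl[OF h(2), simplified] and L = T.hat_cyl[OF cyl(1), simplified]
    note iS = T.Ide2_cells_hom[OF T.Fhom[OF d(3)]] and ih = T.Ide2_cells_hom[OF T.Fhom[OF h(3)]]
      and ix = T.Ide2_cells_hom[OF T.Fhom[OF d(4)]] and i0 = T.Ide2_cells_hom[OF T.Fhom[OF d(1)]]
    have LK: "hat_cyl D F ?L \<bullet>\<^bsub>D\<^esub> hat_cyl D F ?K \<in> cells D (Far F d0) (Far F d0)"
      using T.VComp_cells[OF K(1) L(1)] .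
    have "Ide2 D (Far F s) \<star>\<^bsub>D\<^esub> (hat_cyl D F ?L \<bullet>\<^bsub>D\<^esub> hat_cyl D F ?K) = Ide2 D (Far F x)"
      using T.interchange_hom[OF K(1) L(1) iS iS T.Fhom[OF d(1)] T.Fhom[OF d(3)]]
        T.VComp_Ide2[OF iS] T.VComp_Ide2[OF ix] K(2) L(2) by simp
    moreover have "Ide2 D (Far F s) \<star>\<^bsub>D\<^esub> Ide2 D (Far F d0) = Ide2 D (Far F x)"
      using T.HComp_Ide2[OF T.Fhom[OF d(1)] T.Fhom[OF d(3)]] T.FComp[OF d(1,3)] d(5) by simp
    ultimately have c: "hat_cyl D F ?L \<bullet>\<^bsub>D\<^esub> hat_cyl D F ?K = Ide2 D (Far F d0)"
      using T.hat_cyl_eqI[OF cyl(2), simplified] LK i0 by metis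
    have "hat D F (?L, h) \<bullet>\<^bsub>D\<^esub> hat D F (?K, h) = Ide2 D (Far F h) \<star>\<^bsub>D\<^esub> Ide2 D (Far F d0)"
      using T.interchange_hom[OF K(1) L(1) ih ih T.Fhom[OF d(1)] T.Fhom[OF h(3)]]
        T.VComp_Ide2[OF ih] c by (simp add: hat_def)
    also have "\<dots> = Ide2 D (Far F f)"
      using T.HComp_Ide2[OF T.Fhom[OF d(1)] T.Fhom[OF h(3)]] T.FComp[OF d(1) h(3)] h(4) by simp
    finally show "hat_seq D F ([(?L, h)] @ [(?K, h)]) = hat_seq D F [id_homotopy A f]"
      using hat_id[OF h(1)] by simp
  qed
  then show "hclass A \<Sigma> [(?L, h)] \<bullet>\<^bsub>Ho A \<Sigma>\<^esub> hclass A \<Sigma> [(?K, h)] = Ide2 (Ho A \<Sigma>) f"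
    using hclass_append[OF s1 s2] by (simp add: Ho_def)
qed

text \<open>Reversing twice restores the homotopy, so \<open>homotopy_rev\<close> applied to the
  reversal gives the other inverse law.\<close>

lemma homotopy_invertible:
  assumes "is_homotopy A \<Sigma> f g H"
  shows "\<exists>\<alpha> \<in> cells (Ho A \<Sigma>) f g. invertible_cell (Ho A \<Sigma>) \<alpha>"
proof -
  obtain W Z d0 d1 s x h where H: "H = (Cylinder W Z d0 d1 s x, h)" by (metis cylinder.exhaust surj_pair)
  note r = homotopy_rev[OF assms[unfolded H]]
  note c = hclass_cells[OF homotopy_seq.single[OF assms[unfolded H]]]
    and c' = hclass_cells[OF homotopy_seq.single[OF r(1)]]
  show ?thesis
    using c c' r(2) homotopy_rev(2)[OF r(1)] cellsD[OF c]
    unfolding invertible_cell_def by metis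
qed

lemma homotopy_equivalence:
  assumes "f \<in> hom A X Y" "g \<in> hom A Y X"
    and "is_homotopy A \<Sigma> (Ide A X) (g \<cdot> f) H" "is_homotopy A \<Sigma> (f \<cdot> g) (Ide A Y) H'"
  shows "equivalence (Ho A \<Sigma>) f"
  using assms(1,2) homotopy_invertible[OF assms(3)] homotopy_invertible[OF assms(4)]
  unfolding equivalence_def by (auto simp: hom_def)

end


section \<open>Fibrant-cofibrant objects and the replacement functors\<close>

context normal_model_category
begin

abbreviation fc :: "('o, 'a) cat" where
  "fc \<equiv> fibrant_cofibrant C Cof Fib z t"

lemma fc_simps [simp]:
  "Obj fc = {X. cofibrant C Cof z X \<and> fibrant C Fib t X}"
  "Arr fc = {f \<in> Arr C. Dom C f \<in> Obj fc \<and> Cod C f \<in> Obj fc}"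
  "Dom fc = Dom C" "Cod fc = Cod C" "Ide fc = Ide C" "Comp fc = Comp C"
  by (auto simp: fibrant_cofibrant_def full_subcat_def cofibrant_def)

lemma hom_fc: "f \<in> hom fc X Y \<longleftrightarrow> f \<in> hom C X Y \<and> X \<in> Obj fc \<and> Y \<in> Obj fc"
  by (auto simp: hom_def)

lemma fc_Obj: "X \<in> Obj fc \<Longrightarrow> X \<in> Obj C"
  by (simp add: cofibrant_def)

text \<open>Factor the identity as \<open>p i\<close> with \<open>i\<close> a trivial cofibration;
  since \<open>i id = i\<close>, 3-for-2 makes the identity a weak equivalence.\<close>

lemma Weq_Ide:
  assumes X: "X \<in> Obj C"
  shows "Ide C X \<in> Weq"
proof -
  have e: "Ide C X \<in> hom C X X" using Ide_hom[OF X] .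
  then obtain i p where i: "i \<in> Cof \<inter> Weq" "Dom C p = Cod C i" "p \<cdot> i = Ide C X" "p \<in> Fib"
    using factorization(2)[of "Ide C X"] by (auto simp: hom_def)
  have ip: "i \<in> Arr C" "p \<in> Arr C" using i classes_Arr by auto
  have "p \<cdot> i \<in> hom C (Dom C i) (Cod C p)"
    using Comp_hom[of i "Dom C i" "Cod C i" p "Cod C p"] ip i(2) by (simp add: hom_def)
  then have "Dom C i = X" using i(3) e by (simp add: hom_def)
  then have "i \<cdot> Ide C X = i" using Comp_Ide ip by auto
  then show ?thesis using three_for_two(2)[of "Ide C X" i] e ip i \<open>Dom C i = X\<close> by (auto simp: hom_def)
qed

sublocale homotopical C Weq
  using classes_Arr(3) Weq_Ide by unfold_locales auto

lemma homotopical_fc: "homotopical fc (Weq \<inter> Arr fc)"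
proof unfold_locales
  fix f assume f: "f \<in> Arr fc"
  show "Dom fc f \<in> Obj fc" "Cod fc f \<in> Obj fc" "f \<cdot>\<^bsub>fc\<^esub> Ide fc (Dom fc f) = f"
    "Ide fc (Cod fc f) \<cdot>\<^bsub>fc\<^esub> f = f"
    using f Comp_Ide Ide_Comp by auto
next
  fix X assume X: "X \<in> Obj fc"
  show "Ide fc X \<in> hom fc X X" using X fc_Obj[OF X] Ide_hom by (auto simp: hom_fc)
  then show "Ide fc X \<in> Weq \<inter> Arr fc" using Weq_Ide[OF fc_Obj[OF X]] by (auto simp: hom_def)
next
  fix f g h X Y Z T
  assume f: "f \<in> hom fc X Y" and g: "g \<in> hom fc Y Z"
  show "g \<cdot>\<^bsub>fc\<^esub> f \<in> hom fc X Z" using f g Comp_hom by (auto simp: hom_fc)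
  assume "h \<in> hom fc Z T"
  then show "h \<cdot>\<^bsub>fc\<^esub> g \<cdot>\<^bsub>fc\<^esub> f = (h \<cdot>\<^bsub>fc\<^esub> g) \<cdot>\<^bsub>fc\<^esub> f"
    using f g Comp_assoc by (auto simp: hom_fc)
qed auto

text \<open>This lets a single pair of homotopies exhibit an equivalence in both homotopy
  2-categories.\<close>

lemma fc_homotopy: "is_homotopy fc (Weq \<inter> Arr fc) f g H \<Longrightarrow> is_homotopy C Weq f g H"
  by (auto simp: is_homotopy_def is_cylinder_def hom_fc)

text \<open>The retraction is a lift of \<open>i\<close> against \<open>X -> t\<close> in the square
  whose top edge is the identity of \<open>X\<close>.\<close>

lemma trivial_cofibration_retraction:
  assumes i: "i \<in> Cof \<inter> Weq" "i \<in> hom C X Z" and X: "fibrant C Fib t X"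
  shows "\<exists>r \<in> hom C Z X. r \<cdot> i = Ide C X"
proof -
  have o: "X \<in> Obj C" "Z \<in> Obj C" using i(2) Dom_Obj Cod_Obj by (auto simp: hom_def)
  note a = to_t(1)[OF o(1)] to_t(1)[OF o(2)] Ide_hom[OF o(1)]
  have "the_arr C X t \<cdot> Ide C X = the_arr C Z t \<cdot> i"
    using to_t(2)[OF o(1) Comp_hom[OF i(2) a(2)]] to_t(2)[OF o(1) Comp_hom[OF a(3,1)]] by simp
  then have "square C i (the_arr C X t) (Ide C X) (the_arr C Z t)"
    using a i(2) by (auto simp: square_def hom_def)
  moreover have "lifts_against C i (the_arr C X t)"
    using lifting(2)[OF i(1)] X by (simp add: fibrant_def)
  ultimately show ?thesis using i(2) a(1) by (fastforce simp: lifts_against_def hom_def)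
qed

text \<open>Dually, the section is a lift of \<open>z -> Y\<close> against \<open>p\<close> in the
  square whose bottom edge is the identity of \<open>Y\<close>.\<close>

lemma trivial_fibration_section:
  assumes p: "p \<in> Fib \<inter> Weq" "p \<in> hom C Z Y" and Y: "cofibrant C Cof z Y"
  shows "\<exists>s \<in> hom C Y Z. p \<cdot> s = Ide C Y"
proof -
  have o: "Y \<in> Obj C" "Z \<in> Obj C" using p(2) Dom_Obj Cod_Obj by (auto simp: hom_def)
  note a = from_z(1)[OF o(1)] from_z(1)[OF o(2)] Ide_hom[OF o(1)]
  have "p \<cdot> the_arr C z Z = Ide C Y \<cdot> the_arr C z Y"
    using from_z(2)[OF o(1) Comp_hom[OF a(2) p(2)]] from_z(2)[OF o(1) Comp_hom[OF a(1,3)]] by simp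
  then have "square C (the_arr C z Y) p (the_arr C z Z) (Ide C Y)"
    using a p(2) by (auto simp: square_def hom_def)
  moreover have "lifts_against C (the_arr C z Y) p"
    using lifting(1)[OF _ p(1)] Y by (simp add: cofibrant_def)
  ultimately show ?thesis using p(2) a(1) by (fastforce simp: lifts_against_def hom_def)
qed

text \<open>
  Factor \<open>f = p i\<close> with a retraction \<open>r\<close> of \<open>i\<close> and a section \<open>s\<close> of \<open>p\<close>; the inverse is \<open>r s\<close>.
  The arrow of \<open>\<Sigma>\<close> in a cylinder need not be related to a codiagonal, so \<open>p i = p (s p i)\<close> and
  \<open>r (i r s) = r s\<close> already are cylinders, and no cylinder object is needed.
\<close>

lemma weak_equivalence_fc:
  assumes f: "f \<in> Weq" "f \<in> hom fc X Y"
  shows "\<exists>g H H'. g \<in> hom fc Y X \<and> is_homotopy fc (Weq \<inter> Arr fc) (Ide C X) (g \<cdot> f) H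
    \<and> is_homotopy fc (Weq \<inter> Arr fc) (f \<cdot> g) (Ide C Y) H'"
proof -
  have XY: "f \<in> hom C X Y" "X \<in> Obj fc" "Y \<in> Obj fc" using f(2) hom_fc by auto
  obtain i p where ip: "i \<in> Cof \<inter> Weq" "p \<in> Fib" "Dom C p = Cod C i" "p \<cdot> i = f"
    using factorization(2) XY(1) by (fastforce simp: hom_def)
  define Z where "Z = Cod C i"
  have arr: "i \<in> Arr C" "p \<in> Arr C" using ip classes_Arr by auto
  have pi: "p \<cdot> i \<in> hom C (Dom C i) (Cod C p)"
    using Comp_hom[of i "Dom C i" Z p "Cod C p"] arr ip(3) by (simp add: hom_def Z_def)
  have i: "i \<in> hom C X Z" and p: "p \<in> hom C Z Y"
    using pi arr ip(3,4) XY(1) by (auto simp: hom_def Z_def)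
  have pW: "p \<in> Weq" using three_for_two(1)[OF arr ip(3)] ip f by simp
  have Zo: "Z \<in> Obj C" "X \<in> Obj C" "Y \<in> Obj C" using i p Dom_Obj Cod_Obj by (auto simp: hom_def)
  note zX = from_z(1)[OF Zo(2)] and Yt = to_t(1)[OF Zo(3)]
  \<comment> \<open>The middle object inherits cofibrancy from \<open>X\<close> along
    \<open>i\<close> and fibrancy from \<open>Y\<close> along \<open>p\<close>, so the cylinders
    below stay in \<open>fc\<close>.\<close>
  have "the_arr C z Z = i \<cdot> the_arr C z X" using from_z(2)[OF Zo(1) Comp_hom[OF zX i]] .
  then have 1: "cofibrant C Cof z Z"
    using composites(1) ip(1) XY(2) zX i Zo by (auto simp: comp_closed_def cofibrant_def hom_def)
  have "the_arr C Z t = the_arr C Y t \<cdot> p" using to_t(2)[OF Zo(1) Comp_hom[OF p Yt]] .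
  then have 2: "fibrant C Fib t Z"
    using composites(2) ip(2) XY(3) Yt p Zo by (auto simp: comp_closed_def fibrant_def hom_def)
  have Z: "Z \<in> Obj fc" using 1 2 by simp
  obtain r where r: "r \<in> hom C Z X" "r \<cdot> i = Ide C X"
    using trivial_cofibration_retraction[OF ip(1) i] XY(2) by auto
  obtain s where s: "s \<in> hom C Y Z" "p \<cdot> s = Ide C Y"
    using trivial_fibration_section[of p, OF _ p] ip(2) pW XY(3) by auto
  \<comment> \<open>By 3-for-2 on \<open>r i = id\<close>; \<open>r\<close> will be the arrow of
    \<open>\<Sigma>\<close> in the second cylinder.\<close>
  have rW: "r \<in> Weq"
    using three_for_two(1)[of i r] ip(1) r i Weq_Ide[OF Zo(2)] by (auto simp: hom_def)
  have sf: "s \<cdot> f \<in> hom C X Z" and rs: "r \<cdot> s \<in> hom C Y X" and irs: "i \<cdot> r \<cdot> s \<in> hom C Y Z"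
    using Comp_hom XY(1) s(1) r(1) i by blast+
  have idX: "Ide C X \<in> hom C X X" "Ide C Y \<in> hom C Y Y" using Ide_hom Zo by auto
  have e1: "p \<cdot> s \<cdot> f = f" using Comp_assoc[OF XY(1) s(1) p] s(2) Ide_Comp XY(1) by (auto simp: hom_def)
  have e2: "r \<cdot> s \<cdot> f = (r \<cdot> s) \<cdot> f" using Comp_assoc[OF XY(1) s(1) r(1)] .
  have e3: "r \<cdot> i \<cdot> r \<cdot> s = r \<cdot> s" using Comp_assoc[OF rs i r(1)] r(2) Ide_Comp rs by (auto simp: hom_def)
  have e4: "p \<cdot> i \<cdot> r \<cdot> s = f \<cdot> r \<cdot> s" using Comp_assoc[OF rs i p] ip(4) by simp
  have c: "(r \<cdot> s) \<cdot> f \<in> hom C X X" "f \<cdot> r \<cdot> s \<in> hom C Y Y"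
    using Comp_hom[OF XY(1) rs] Comp_hom[OF rs XY(1)] .
  have W: "p \<in> Weq \<inter> Arr fc" "r \<in> Weq \<inter> Arr fc"
    using pW rW p r(1) XY(2,3) Z by (auto simp: hom_def)
  \<comment> \<open>The map \<open>r\<close> sends the ends \<open>i\<close> and \<open>s f\<close>
    to \<open>id\<close> and \<open>r s f\<close>; in the second homotopy, \<open>p\<close> sends
    the ends \<open>i r s\<close> and \<open>s\<close> to \<open>f r s\<close> and
    \<open>id\<close>.\<close>
  have "is_homotopy fc (Weq \<inter> Arr fc) (Ide C X) ((r \<cdot> s) \<cdot> f) (Cylinder Z Y i (s \<cdot> f) p f, r)"
    unfolding is_homotopy_def is_cylinder_def
    using W XY Z i sf p ip(4) e1 r e2 idX c by (auto simp: hom_fc simp del: fc_simps(1,2))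
  moreover have "is_homotopy fc (Weq \<inter> Arr fc) (f \<cdot> r \<cdot> s) (Ide C Y) (Cylinder Z X (i \<cdot> r \<cdot> s) s r (r \<cdot> s), p)"
    unfolding is_homotopy_def is_cylinder_def
    using W XY Z irs s p e3 e4 r rs idX c by (auto simp: hom_fc simp del: fc_simps(1,2))
  moreover have "r \<cdot> s \<in> hom fc Y X" using rs XY hom_fc by blast
  ultimately show ?thesis by blast
qed

text \<open>The first conclusion shows that \<open>q\<close> inverts weak equivalences, the second
  that \<open>i j\<close> does.\<close>

lemma weak_equivalence_fc_equivalence:
  assumes "f \<in> Weq \<inter> Arr fc"
  shows "equivalence (Ho fc (Weq \<inter> Arr fc)) f" "equivalence (Ho C Weq) f"
proof -
  interpret fc: homotopical fc "Weq \<inter> Arr fc" by (rule homotopical_fc)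
  obtain X Y where f: "f \<in> Weq" "f \<in> hom fc X Y" using assms by (auto simp: hom_def)
  obtain g H H' where g: "g \<in> hom fc Y X" "is_homotopy fc (Weq \<inter> Arr fc) (Ide C X) (g \<cdot> f) H"
    "is_homotopy fc (Weq \<inter> Arr fc) (f \<cdot> g) (Ide C Y) H'"
    using weak_equivalence_fc[OF f] by blast
  show "equivalence (Ho fc (Weq \<inter> Arr fc)) f"
    using fc.homotopy_equivalence[OF f(2) g(1)] g(2,3) by simp
  show "equivalence (Ho C Weq) f"
    using homotopy_equivalence[OF _ _ fc_homotopy[OF g(2)] fc_homotopy[OF g(3)]] f(2) g(1) hom_fc by blast
qed

text \<open>By naturality \<open>p_Y Q f = f p_X\<close>, where \<open>p_X\<close> and
  \<open>p_Y\<close> are trivial fibrations; conclude by 3-for-2.\<close>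

lemma cofib_repl_Weq:
  assumes f: "f \<in> Weq"
  shows "Far (cofib_repl C z \<Phi>) f \<in> Weq"
proof -
  define X Y where "X = Dom C f" and "Y = Cod C f"
  have fh: "f \<in> Arr C" "f \<in> hom C X Y" using f classes_Arr by (auto simp: hom_def X_def Y_def)
  have o: "X \<in> Obj C" "Y \<in> Obj C" using fh(2) Dom_Obj Cod_Obj by (auto simp: hom_def)
  let ?Q = "Fmap \<Phi> (the_arr C z X) (the_arr C z Y) (Ide C z) f"
  note pX = fact_lam(3,4)[OF fact_\<Phi> from_z(1)[OF o(1)]] and pY = fact_lam(3,4)[OF fact_\<Phi> from_z(1)[OF o(2)]]
  have Q: "?Q \<in> hom C (Mid \<Phi> (the_arr C z X)) (Mid \<Phi> (the_arr C z Y))"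
    using fact_map(1)[OF fact_\<Phi> cofib_square[OF fh(2)]] .
  have "Rho \<Phi> (the_arr C z Y) \<cdot> ?Q = f \<cdot> Rho \<Phi> (the_arr C z X)"
    using fact_\<Phi> cofib_square[OF fh(2)] unfolding functorial_factorization_def by blast
  moreover have "f \<cdot> Rho \<Phi> (the_arr C z X) \<in> Weq"
    using composites(3) f fh(2) pX by (auto simp: comp_closed_def hom_def)
  ultimately have "?Q \<in> Weq" using three_for_two(2)[of ?Q "Rho \<Phi> (the_arr C z Y)"] Q pY by (auto simp: hom_def)
  then show ?thesis using fh(1) by (simp add: cofib_repl_def X_def Y_def)
qed

text \<open>Likewise from \<open>R f v_X = v_Y f\<close>, where \<open>v_X\<close> and
  \<open>v_Y\<close> are trivial cofibrations.\<close>

lemma fib_repl_Weq: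
  assumes f: "f \<in> Weq"
  shows "Far (fib_repl C t \<Psi>) f \<in> Weq"
proof -
  define X Y where "X = Dom C f" and "Y = Cod C f"
  have fh: "f \<in> Arr C" "f \<in> hom C X Y" using f classes_Arr by (auto simp: hom_def X_def Y_def)
  have o: "X \<in> Obj C" "Y \<in> Obj C" using fh(2) Dom_Obj Cod_Obj by (auto simp: hom_def)
  let ?R = "Fmap \<Psi> (the_arr C X t) (the_arr C Y t) f (Ide C t)"
  note vX = fact_lam(1,2)[OF fact_\<Psi> to_t(1)[OF o(1)]] and vY = fact_lam(1,2)[OF fact_\<Psi> to_t(1)[OF o(2)]]
  have R: "?R \<in> hom C (Mid \<Psi> (the_arr C X t)) (Mid \<Psi> (the_arr C Y t))"
    using fact_map(1)[OF fact_\<Psi> fib_square[OF fh(2)]] .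
  have "?R \<cdot> Lam \<Psi> (the_arr C X t) = Lam \<Psi> (the_arr C Y t) \<cdot> f"
    using fact_\<Psi> fib_square[OF fh(2)] unfolding functorial_factorization_def by blast
  moreover have "Lam \<Psi> (the_arr C Y t) \<cdot> f \<in> Weq"
    using composites(3) f fh(2) vY by (auto simp: comp_closed_def hom_def)
  ultimately have "?R \<in> Weq" using three_for_two(1)[of "Lam \<Psi> (the_arr C X t)" ?R] R vX by (auto simp: hom_def)
  then show ?thesis using fh(1) by (simp add: fib_repl_def X_def Y_def)
qed

lemma RQ_Weq:
  assumes "f \<in> Weq"
  shows "Far (RQ_functor C z t \<Phi> \<Psi>) f \<in> Weq \<inter> Arr fc"
proof -
  have "f \<in> Arr C" using assms classes_Arr by auto
  then show ?thesis
    using fib_repl_Weq[OF cofib_repl_Weq[OF assms]] RQ_corestriction(1)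
    by (auto simp: RQ_functor_def fcomp_def compose_def is_functor_def simp del: fc_simps)
qed

end

section \<open>Discrete 2-categories and composition of 2-functors\<close>

text \<open>Composites are cut off to the carriers of their source. Since \<open>F\<close> lands in
  the carriers of \<open>E\<close>, the inner cut-off is invisible.\<close>

lemma two_comp_assoc:
  assumes "is_two_functor D E F"
  shows "two_comp D (two_comp E H G) F = two_comp D H (two_comp D G F)"
  using assms unfolding two_comp_def
  by (auto simp: is_two_functor_def is_functor_def compose_def fun_eq_iff PiE_iff)

lemma two_comp_disc: "two_comp (disc C) (disc_functor G) (disc_functor F) = disc_functor (fcomp C G F)"
  by (simp add: two_comp_def fcomp_def disc_functor_def)

lemma disc_two_functor: "is_functor C D F \<Longrightarrow> is_two_functor (disc C) (disc D) (disc_functor F)"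
  unfolding is_two_functor_def is_functor_def
  by (auto simp: disc_functor_def disc_def)

lemma two_category_disc:
  fixes A :: "('o, 'a) cat" (structure)
  assumes "category A"
  shows "two_category (disc A)"
proof -
  interpret category A by fact
  have h: "f \<in> hom (disc A) X Y \<longleftrightarrow> f \<in> hom A X Y" for f X Y by (simp add: hom_def)
  have c: "\<alpha> \<in> cells (disc A) f g \<longleftrightarrow> \<alpha> \<in> Arr A \<and> f = \<alpha> \<and> g = \<alpha>" for \<alpha> f g by (auto simp: cells_def)
  have V: "\<beta> \<bullet>\<^bsub>disc A\<^esub> \<alpha> = \<alpha>" "\<beta> \<star>\<^bsub>disc A\<^esub> \<alpha> = \<beta> \<cdot> \<alpha>" for \<alpha> \<beta> by (simp_all add: disc_def)
  have comp: "g \<cdot> f \<in> Arr A" if "f \<in> Arr A" "g \<in> Arr A" "Cod A f = Dom A g" for f g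
    using that Comp_hom[of f "Dom A f" "Cod A f" g "Cod A g"] by (simp add: hom_def)
  have assoc: "h \<cdot> g \<cdot> f = (h \<cdot> g) \<cdot> f"
    if "f \<in> Arr A" "g \<in> Arr A" "h \<in> Arr A" "Cod A f = Dom A g" "Cod A g = Dom A h" for f g h
    using that Comp_assoc[of f "Dom A f" "Cod A f" g "Cod A g" h "Cod A h"] by (simp add: hom_def)
  show ?thesis
    by unfold_locales
      (use Dom_Obj Cod_Obj Ide_hom Comp_hom Comp_Ide Ide_Comp Comp_assoc comp assoc
        in \<open>auto simp: h c V\<close>, auto simp: hom_def)
qed

text \<open>The composite is specified only on the carriers of \<open>D\<close>, so closure of these
  under all operations is established before the laws are checked.\<close>

lemma (in two_category) two_comp_two_functor:
  assumes F: "is_two_functor D E F" and G: "is_two_functor E H G"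
  shows "is_two_functor D H (two_comp D G F)"
proof -
  have i: "Ide D X \<in> Arr D" if "X \<in> Obj D" for X using Ide_hom[OF that] by (simp add: hom_def)
  have c: "g \<cdot> f \<in> Arr D" if "f \<in> Arr D" "g \<in> Arr D" "Dom D g = Cod D f" for f g
    using that Comp_hom[of f "Dom D f" "Cod D f" g "Cod D g"] by (simp add: hom_def)
  have i2: "Ide2 D f \<in> Cell D" if "f \<in> Arr D" for f using Ide2_cells[OF that] by (simp add: cells_def)
  have st: "Src D \<alpha> \<in> Arr D" "Trg D \<alpha> \<in> Arr D" if "\<alpha> \<in> Cell D" for \<alpha>
    using Src_Trg[OF that] by (auto simp: hom_def)
  have v: "\<beta> \<bullet> \<alpha> \<in> Cell D" if "\<alpha> \<in> Cell D" "\<beta> \<in> Cell D" "Src D \<beta> = Trg D \<alpha>" for \<alpha> \<beta>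
    using that VComp_cells[of \<alpha> "Src D \<alpha>" "Trg D \<alpha>" \<beta> "Trg D \<beta>"] by (simp add: cells_def)
  have h: "\<beta> \<star> \<alpha> \<in> Cell D" if "\<alpha> \<in> Cell D" "\<beta> \<in> Cell D" "Dom D (Src D \<beta>) = Cod D (Src D \<alpha>)" for \<alpha> \<beta>
    using that HComp_cells[of \<alpha> "Src D \<alpha>" "Trg D \<alpha>" \<beta> "Src D \<beta>" "Trg D \<beta>"] by (simp add: cells_def)
  note oF = F[unfolded is_two_functor_def is_functor_def] and oG = G[unfolded is_two_functor_def is_functor_def]
  show ?thesis
    unfolding is_two_functor_def is_functor_def
    using oF oG i c i2 st v h Dom_Obj Cod_Obj by (simp add: two_comp_def compose_def PiE_iff)
qed

lemma (in normal_model_category) fc_incl_functor: "is_functor fc C (incl_functor fc)"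
proof -
  interpret fc: homotopical fc "Weq \<inter> Arr fc" by (rule homotopical_fc)
  have "Ide fc X \<in> Arr fc" if "X \<in> Obj fc" for X using fc.Ide_hom[OF that] by (simp add: hom_def del: fc_simps)
  moreover have "g \<cdot>\<^bsub>fc\<^esub> f \<in> Arr fc" if "f \<in> Arr fc" "g \<in> Arr fc" "Dom C g = Cod C f" for f g
    using that fc.Comp_hom[of f "Dom C f" "Cod C f" g "Cod C g"] by (simp add: hom_def del: fc_simps(1,2))
  ultimately show ?thesis
    using fc_Obj by (auto simp: is_functor_def incl_functor_def)
qed

text \<open>Both unique existence claims are instances of \<open>Ho_universal\<close>. The final
  quantifier over \<open>rbar\<close> and \<open>jbar\<close> therefore ranges over exactly one
  pair.\<close>

theorem proposition3p25:
  fixes C :: "('o, 'a) cat" and Cof Fib W :: "'a set" and z t :: 'o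
    and \<Phi> \<Psi> :: "('o, 'a) ffact"
  assumes "normal_model_category C Cof Fib W z t \<Phi> \<Psi>"
  shows
    "let Cfc = fibrant_cofibrant C Cof Fib z t;
         Wfc = W \<inter> Arr Cfc;
         HoC = Ho C W;
         HoCfc = Ho Cfc Wfc;
         RQ = RQ_functor C z t \<Phi> \<Psi>;
         r = RQ;
         j = incl_functor Cfc;
         i = Ho_incl C W;
         i' = Ho_incl Cfc Wfc;
         q = two_comp (disc C) i' (disc_functor r);
         is_rbar = (\<lambda>rbar. is_two_functor HoC HoCfc rbar \<and> two_comp (disc C) rbar i = q);
         is_jbar = (\<lambda>jbar. is_two_functor HoCfc HoC jbar \<and>
           two_comp (disc Cfc) jbar i' = two_comp (disc Cfc) i (disc_functor j))
     in (\<exists>!rbar. is_rbar rbar) \<and> (\<exists>!jbar. is_jbar jbar) \<and>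
        (\<forall>rbar jbar. is_rbar rbar \<and> is_jbar jbar \<longrightarrow>
           (let RQbar = two_comp HoC jbar rbar
            in is_two_functor HoC HoC RQbar \<and>
               two_comp (disc C) RQbar i = two_comp (disc C) i (disc_functor RQ)))"
proof -
  interpret M: normal_model_category C Cof Fib W z t \<Phi> \<Psi> by (rule assms)
  let ?fc = "fibrant_cofibrant C Cof Fib z t" and ?RQ = "RQ_functor C z t \<Phi> \<Psi>"
  let ?W = "W \<inter> Arr ?fc"
  interpret fc: homotopical ?fc ?W by (rule M.homotopical_fc)
  let ?i = "Ho_incl C W" and ?i' = "Ho_incl ?fc ?W" and ?j = "incl_functor ?fc"
  let ?q = "two_comp (disc C) ?i' (disc_functor ?RQ)" and ?p = "two_comp (disc ?fc) ?i (disc_functor ?j)"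
  have disc_RQ: "is_two_functor (disc C) (disc ?fc) (disc_functor ?RQ)"
    using M.RQ_corestriction(1) by (rule disc_two_functor)
  have disc_j: "is_two_functor (disc ?fc) (disc C) (disc_functor ?j)"
    using M.fc_incl_functor by (rule disc_two_functor)
  have q: "is_two_functor (disc C) (Ho ?fc ?W) ?q"
    using two_category.two_comp_two_functor[OF two_category_disc[OF M.category_axioms] disc_RQ fc.Ho_incl_two_functor] .
  have p: "is_two_functor (disc ?fc) (Ho C W) ?p"
    using two_category.two_comp_two_functor[OF two_category_disc[OF fc.category_axioms] disc_j M.Ho_incl_two_functor] .
  \<comment> \<open>On arrows \<open>q\<close> is \<open>RQ\<close>, which sends weak equivalences
    to weak equivalences of \<open>fc\<close>.\<close>
  have "inverts W (Ho ?fc ?W) ?q"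
    unfolding inverts_def
  proof
    fix f assume f: "f \<in> W"
    then have "f \<in> Arr C" using M.classes_Arr by auto
    then have "Far ?q f = Far ?RQ f"
      using M.RQ_Weq[OF f] by (simp add: two_comp_def compose_def disc_functor_def Ho_incl_def del: M.fc_simps)
    then show "equivalence (Ho ?fc ?W) (Far ?q f)"
      using M.weak_equivalence_fc_equivalence(1)[OF M.RQ_Weq[OF f]] by simp
  qed
  then interpret q: homotopical_test "Ho ?fc ?W" C W ?q
    using q fc.two_category_Ho M.homotopical_axioms
    by (simp add: homotopical_test_def test_functor_def test_functor_axioms_def del: M.fc_simps)
  \<comment> \<open>On arrows \<open>i j\<close> is the identity, so this is the statement that weak
    equivalences of \<open>fc\<close> are equivalences in the larger homotopy 2-category.\<close>
  have "inverts ?W (Ho C W) ?p"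
    unfolding inverts_def
  proof
    fix f assume f: "f \<in> ?W"
    then have "Far ?p f = f"
      by (auto simp: two_comp_def compose_def disc_functor_def Ho_incl_def incl_functor_def)
    then show "equivalence (Ho C W) (Far ?p f)"
      using M.weak_equivalence_fc_equivalence(2)[OF f] by simp
  qed
  then interpret p: homotopical_test "Ho C W" ?fc ?W ?p
    using p M.two_category_Ho fc.homotopical_axioms
    by (simp add: homotopical_test_def test_functor_def test_functor_axioms_def del: M.fc_simps)
  have "is_two_functor (Ho C W) (Ho C W) (two_comp (Ho C W) jb rb) \<and>
      two_comp (disc C) (two_comp (Ho C W) jb rb) ?i = two_comp (disc C) ?i (disc_functor ?RQ)"
    if rb: "is_two_functor (Ho C W) (Ho ?fc ?W) rb" "two_comp (disc C) rb ?i = ?q"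
      and jb: "is_two_functor (Ho ?fc ?W) (Ho C W) jb" "two_comp (disc ?fc) jb ?i' = ?p" for rb jb
  proof
    show "is_two_functor (Ho C W) (Ho C W) (two_comp (Ho C W) jb rb)"
      using two_category.two_comp_two_functor[OF M.two_category_Ho rb(1) jb(1)] .
    \<comment> \<open>Replace \<open>rbar i\<close> by \<open>i' r\<close>, then
      \<open>jbar i'\<close> by \<open>i j\<close>, and finally \<open>j r\<close> by
      \<open>RQ\<close>.\<close>
    have "two_comp (disc C) (two_comp (Ho C W) jb rb) ?i = two_comp (disc C) (two_comp (disc ?fc) jb ?i') (disc_functor ?RQ)"
      by (simp only: two_comp_assoc[OF M.Ho_incl_two_functor] two_comp_assoc[OF disc_RQ] rb(2))
    also have "\<dots> = two_comp (disc C) ?i (disc_functor (fcomp C ?j ?RQ))"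
      by (simp only: two_comp_assoc[OF disc_RQ] jb(2) two_comp_disc)
    finally show "two_comp (disc C) (two_comp (Ho C W) jb rb) ?i = two_comp (disc C) ?i (disc_functor ?RQ)"
      by (simp only: M.RQ_corestriction(2))
  qed
  then show ?thesis
    unfolding Let_def using q.Ho_universal p.Ho_universal by blast
qed

end
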